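(* Let $N\ge1$ be an integer and suppose $a>\max\{0,2-N\}$. Let $u$ be a continuous function of polynomial growth on $\mathbb{R}^N$ and let $H_tu$ be its $a$-deformed heat flow. Then $H_tu$ satisfies the $a$-deformed heat equation $$\left(\partial_t-\frac1a|x|^{2-a}\Delta\right)H_tu(x)=0\qquad(t>0,\ x\in\mathbb{R}^N\setminus\{0\}).$$
   Context: Normalized I-Bessel function: for $\mu\in\mathbb{R}$ and $w\in\mathbb{C}$, $\tilde I_\mu(w)=\sum_{j=0}^\infty\frac{(w/2)^{2j}}{j!\,\Gamma(\mu+j+1)}$ (with $1/\Gamma=0$ at the poles of $\Gamma$). Normalized Gegenbauer polynomials $\check C^\nu_m(t)$ are defined by the formal power series expansion $\frac{1-x^2}{(1-2tx+x^2)^{\nu+1}}=\sum_{m=0}^\infty\check C^\nu_m(t)x^m$. For $b>0$, $\nu\in\mathbb{R}$ with $1+b\nu>0$, $w\in\mathbb{C}$, $t\in[-1,1]$, $$\mathscr{I}(b,\nu,w,t):=\Gamma(b\nu+1)\sum_{m=0}^\infty\left(\frac w2\right)^{bm}\tilde I_{b(m+\nu)}(w)\,\check C^\nu_m(t),$$ where $(w/2)^s=(|w|/2)^se^{i\theta s}$ for $w=|w|e^{i\theta}$, $\theta\in(-\pi,\pi]$; the series converges absolutely and locally uniformly. For $a>\max\{0,2-N\}$ put $B_a(r\omega,s\mu)=\mathscr{I}\left(\frac2a,\frac{N-2}{2},\frac{2(rs)^{a/2}}{ai},\langle\omega,\mu\rangle\right)$ for $r,s\ge0$, $\omega,\mu\in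 S^{N-1}$, and $c_a=\left(\int_{\mathbb{R}^N}e^{-\frac1a|x|^a}\frac{dx}{|x|^{2-a}}\right)^{-1}$. The $a$-deformed heat kernel is $$h_a(x,y;t)=c_a\int_{\mathbb{R}^N}\overline{B_a(x,\xi)}\,B_a(y,\xi)\,e^{-\frac ta|\xi|^a}\frac{d\xi}{|\xi|^{2-a}}\qquad(x,y\in\mathbb{R}^N,\ t>0),$$ an absolutely convergent integral. For a continuous function $u$ on $\mathbb{R}^N$ of polynomial growth ($|u(y)|\le C(1+|y|)^k$ for some $C,k$), the $a$-deformed heat flow is $H_tu(x)=c_a\int_{\mathbb{R}^N}h_a(x,y;t)u(y)\frac{dy}{|y|^{2-a}}$ for $t>0$, $x\in\mathbb{R}^N$ (absolutely convergent). $\Delta$ is the Euclidean Laplacian in $x$. *)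

theory Defs
  imports "HOL-Analysis.Analysis"
begin

definition bessel_I_normalized :: "real \<Rightarrow> complex \<Rightarrow> complex" where
  "bessel_I_normalized \<mu> w =
     (\<Sum>j. (w / 2) ^ (2 * j) / fact j * of_real (rGamma (\<mu> + real j + 1)))"

text \<open>The coefficient of \<open>x ^ m\<close> in \<open>(1 - x^2) * (1 - 2 t x + x^2) powr -(\<nu> + 1)\<close>, read as a formal
  power series in \<open>x\<close>: \<^term>\<open>fps_binomial c\<close> is the binomial series of \<open>(1 + X) powr c\<close>.\<close>

definition gegenbauer_normalized :: "real \<Rightarrow> nat \<Rightarrow> real \<Rightarrow> real" where
  "gegenbauer_normalized \<nu> m t =
     fps_nth ((1 - fps_X ^ 2) *
       (fps_binomial (- (\<nu> + 1)) oo (fps_X ^ 2 - fps_const (2 * t) * fps_X))) m"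

text \<open>Principal branch, argument in \<open>(-\<pi>, \<pi>]\<close>. The library has \<open>0 powr 0 = 0\<close>, whereas the
  constant term of the series below requires \<open>0 ^ 0 = 1\<close>.\<close>

definition principal_power :: "complex \<Rightarrow> real \<Rightarrow> complex" where
  "principal_power z s = (if s = 0 then 1 else z powr of_real s)"

definition script_I :: "real \<Rightarrow> real \<Rightarrow> complex \<Rightarrow> real \<Rightarrow> complex" where
  "script_I b \<nu> w t = of_real (Gamma (b * \<nu> + 1)) *
     (\<Sum>m. principal_power (w / 2) (b * real m) * bessel_I_normalized (b * (real m + \<nu>)) w *
           of_real (gegenbauer_normalized \<nu> m t))"

text \<open>In polar coordinates \<open>x = r \<omega>\<close>, \<open>y = s \<mu>\<close> the inner product \<open>\<omega> \<bullet> \<mu>\<close> is \<open>sgn x \<bullet> sgn y\<close>.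
  If \<open>r = 0\<close> or \<open>s = 0\<close> the value does not depend on the choice of \<open>\<omega>\<close> and \<open>\<mu>\<close>; see
  \<open>kernel_B_polar\<close> below.\<close>

definition kernel_B :: "real \<Rightarrow> 'a::euclidean_space \<Rightarrow> 'a \<Rightarrow> complex" where
  "kernel_B a x y =
     script_I (2 / a) ((real DIM('a) - 2) / 2)
       (of_real (2 * (norm x * norm y) powr (a / 2)) / (of_real a * \<i>)) (sgn x \<bullet> sgn y)"

definition norm_const :: "'a::euclidean_space itself \<Rightarrow> real \<Rightarrow> real" where
  "norm_const _ a =
     inverse (LINT x|lborel. exp (- (1 / a) * norm (x::'a) powr a) / norm x powr (2 - a))"

definition heat_kernel :: "real \<Rightarrow> 'a::euclidean_space \<Rightarrow> 'a \<Rightarrow> real \<Rightarrow> complex" where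
  "heat_kernel a x y t = of_real (norm_const TYPE('a) a) *
     (LINT \<xi>|lborel. cnj (kernel_B a x \<xi>) * kernel_B a y \<xi> *
        of_real (exp (- (t / a) * norm \<xi> powr a) / norm \<xi> powr (2 - a)))"

definition heat_flow :: "real \<Rightarrow> real \<Rightarrow> ('a::euclidean_space \<Rightarrow> complex) \<Rightarrow> 'a \<Rightarrow> complex" where
  "heat_flow a t u x = of_real (norm_const TYPE('a) a) *
     (LINT y|lborel. heat_kernel a x y t * u y / of_real (norm y powr (2 - a)))"

definition polynomial_growth :: "('a::real_normed_vector \<Rightarrow> complex) \<Rightarrow> bool" where
  "polynomial_growth u \<longleftrightarrow> (\<exists>C::real. \<exists>k::nat. \<forall>y. norm (u y) \<le> C * (1 + norm y) ^ k)"

definition partial_deriv ::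
    "'a::real_normed_vector \<Rightarrow> ('a \<Rightarrow> complex) \<Rightarrow> 'a \<Rightarrow> complex" where
  "partial_deriv e f x = vector_derivative (\<lambda>s. f (x + s *\<^sub>R e)) (at 0)"

definition laplacian :: "('a::euclidean_space \<Rightarrow> complex) \<Rightarrow> 'a \<Rightarrow> complex" where
  "laplacian f x = (\<Sum>e\<in>Basis. partial_deriv e (partial_deriv e f) x)"

text \<open>Existence of the derivatives occurring in \<^const>\<open>laplacian\<close>; \<^const>\<open>vector_derivative\<close> has an
  unspecified value where the derivative does not exist.\<close>

definition laplacian_exists :: "('a::euclidean_space \<Rightarrow> complex) \<Rightarrow> 'a \<Rightarrow> bool" where
  "laplacian_exists f x \<longleftrightarrow> (\<forall>e\<in>Basis.
     (\<forall>\<^sub>F z in nhds x. (\<lambda>s::real. f (z + s *\<^sub>R e)) differentiable (at 0)) \<and>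
     (\<lambda>s::real. partial_deriv e f (x + s *\<^sub>R e)) differentiable (at 0))"

lemma gegenbauer_normalized_0: "gegenbauer_normalized \<nu> 0 t = 1"
  by (simp add: gegenbauer_normalized_def fps_compose_nth_0)

lemma script_I_0:
  assumes "b > 0"
  shows "script_I b \<nu> 0 t =
    of_real (Gamma (b * \<nu> + 1)) * bessel_I_normalized (b * \<nu>) 0"
proof -
  have "(\<Sum>m. principal_power (0 / 2) (b * real m) * bessel_I_normalized (b * (real m + \<nu>)) 0 *
           of_real (gegenbauer_normalized \<nu> m t)) =
        (\<Sum>m\<in>{0::nat}. principal_power (0 / 2) (b * real m) *
           bessel_I_normalized (b * (real m + \<nu>)) 0 * of_real (gegenbauer_normalized \<nu> m t))"
    using assms by (intro suminf_finite) (auto simp: principal_power_def)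
  then show ?thesis
    by (simp add: script_I_def principal_power_def gegenbauer_normalized_0)
qed

lemma kernel_B_polar:
  fixes \<omega> \<mu> :: "'a::euclidean_space"
  assumes "a > 0" "r \<ge> 0" "s \<ge> 0" "norm \<omega> = 1" "norm \<mu> = 1"
  shows "kernel_B a (r *\<^sub>R \<omega>) (s *\<^sub>R \<mu>) =
    script_I (2 / a) ((real DIM('a) - 2) / 2)
      (of_real (2 * (r * s) powr (a / 2)) / (of_real a * \<i>)) (\<omega> \<bullet> \<mu>)"
proof (cases "r = 0 \<or> s = 0")
  case True
  then have "r * s = 0" by auto
  with True assms show ?thesis
    by (auto simp: kernel_B_def script_I_0)
next
  case False
  with assms have "sgn (r *\<^sub>R \<omega>) = \<omega>" "sgn (s *\<^sub>R \<mu>) = \<mu>"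
    by (auto simp: sgn_div_norm)
  with assms show ?thesis
    by (simp add: kernel_B_def)
qed

end

theory Submission
  imports Defs "HOL-Complex_Analysis.Complex_Analysis"
begin

text \<open>The heat kernel is computed explicitly. Differentiating the translation invariance of Lebesgue
  measure against a Gaussian gives a recursion for the Gaussian moments of two inner products, hence
  their averages over the sphere, and a finite difference identity turns these into the orthogonality
  of zonal Gegenbauer polynomials. Expanding both kernels \<open>B\<^sub>a\<close> into Gegenbauer series, only the
  diagonal terms survive the angular integration, and the radial integrals are given by Weber's second
  exponential integral. The result is a series of modes
  \<open>Z\<^sub>m(x, y) \<tau> powr -(\<mu>\<^sub>m + 1) exp (-(|x|\<^sup>a + |y|\<^sup>a) / \<tau>) \<phi>(|x|\<^sup>a |y|\<^sup>a / \<tau>\<^sup>2)\<close> with \<open>\<tau> = a t\<close>, a zonal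
  harmonic \<open>Z\<^sub>m\<close> and an entire Bessel series \<open>\<phi>\<close>. Each mode solves the heat equation, because
  \<open>Z\<^sub>m\<close> is harmonic and \<open>\<phi>\<close> solves Bessel's equation. A mode extends holomorphically in \<open>t\<close> and along
  coordinate lines in \<open>x \<noteq> 0\<close>, with bounds \<open>2\<^sup>-\<^sup>m exp (C |y| powr (a / 2) - \<kappa> |y| powr a)\<close>; by Cauchy's
  estimates one may therefore differentiate under the sum over \<open>m\<close> and the integral over \<open>y\<close>.\<close>

section \<open>Entire Bessel series\<close>

text \<open>Differentiating under the integral that defines \<open>heat_kernel\<close> runs into
  growth: termwise bounds give |B(y, \<xi>)| at most exp (C (|y| |\<xi>|) powr (a / 2)) up to a
  factor, and integrating this against the weight in \<xi> leaves a bound growing like exp (c |y|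
  powr a). Decay in y comes from cancellation, which Weber's integral makes visible as exp (- |y|
  powr a / \<tau>). The other obstacle is the degree m. Zonal polynomials are bounded only by the
  geometric rate (16 (\<nu> + 2) |x| |y|) ^ m, but the Bessel indices 2 (m + \<nu>) / a grow
  linearly in m, and |\<phi>| is at most L powr (- \<mu>) exp (L + |z| / L) for every L \<ge> 1. An
  L of order (|x| |y|) powr (a / 2) beats the geometric rate and costs exp (C |y| powr (a / 2)),
  whose exponent is only the square root of the decaying one. Along x + s e the function |x| powr a
  becomes the power a / 2 of a quadratic in s with positive real part for |s| < |x| / 4. One
  majorant on a complex disc then dominates the derivatives as well.\<close>

lemma powr_mult_rGamma_le_exp_nonneg:
  fixes L s :: real
  assumes "L > 0" "s \<ge> 0"
  shows "L powr s * rGamma (s + 1) \<le> exp L"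
proof -
  have "((\<lambda>t. t powr (s + 1 - 1) / exp t) has_integral Gamma (s + 1)) {0..}"
    using assms by (intro Gamma_integral_real) auto
  hence G: "((\<lambda>t. t powr s / exp t) has_integral Gamma (s + 1)) {0..}" by simp
  \<comment> \<open>\<open>Gamma (s + 1)\<close> is at least the part of its integral over t \<ge>
    L, where t powr s \<ge> L powr s; what remains integrates to L powr s exp (- L).\<close>
  have "((\<lambda>t. exp (-1 * t)) has_integral exp (-1 * L) / 1) {L..}"
    by (rule has_integral_exp_minus_to_infinity) auto
  hence "((\<lambda>t. L powr s * exp (-1 * t)) has_integral L powr s * (exp (-1 * L) / 1)) {L..}"
    by (rule has_integral_mult_right)
  hence E: "((\<lambda>t. if t \<in> {L..} then L powr s * exp (- t) else 0) has_integral L powr s * exp (- L)) {0..}"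
    using assms by (subst has_integral_restrict) auto
  have "L powr s * exp (- L) \<le> Gamma (s + 1)"
  proof (rule has_integral_le[OF E G])
    fix t :: real assume "t \<in> {0..}"
    show "(if t \<in> {L..} then L powr s * exp (- t) else 0) \<le> t powr s / exp t"
      using assms by (auto simp: exp_minus divide_inverse intro!: powr_mono2)
  qed
  moreover have "Gamma (s + 1) > 0" using assms by (intro Gamma_real_pos) auto
  ultimately show ?thesis
    by (simp add: rGamma_inverse_Gamma exp_minus field_simps)
qed

text \<open>For -1 < s < 0 the functional equation gives
  \<open>rGamma (s + 1) = (s + 1) * rGamma (s + 2)\<close>, and s + 1 < 1 \<le> L turns L powr s
  into L powr (s + 1), where the previous bound applies. Hence L \<ge> 1 instead of L > 0.\<close>

lemma powr_mult_rGamma_le_exp: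
  fixes L s :: real
  assumes "L \<ge> 1" "s > -1"
  shows "L powr s * rGamma (s + 1) \<le> exp L"
proof (cases "s \<ge> 0")
  case True
  with assms show ?thesis by (intro powr_mult_rGamma_le_exp_nonneg) auto
next
  case False
  have "L powr (s + 1) * rGamma (s + 1 + 1) \<le> exp L"
    using assms by (intro powr_mult_rGamma_le_exp_nonneg) auto
  moreover have "rGamma (s + 1) = (s + 1) * rGamma (s + 1 + 1)"
    using rGamma_plus1[of "s + 1"] by simp
  moreover have "L powr (s + 1) = L * L powr s" using assms by (simp add: powr_add)
  moreover have R: "rGamma (s + 1 + 1) \<ge> 0" 
    using assms by (simp add: rGamma_inverse_Gamma Gamma_real_pos less_imp_le)
  moreover have "L powr s * ((s + 1) * rGamma (s + 1 + 1)) \<le> L * L powr s * rGamma (s + 1 + 1)"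
  proof -
    have "(s + 1) * (L powr s * rGamma (s + 1 + 1)) \<le> L * (L powr s * rGamma (s + 1 + 1))"
      using False assms R by (intro mult_right_mono) auto
    thus ?thesis by (simp add: mult_ac)
  qed
  ultimately show ?thesis by simp
qed

text \<open>The regularized hypergeometric function 0F1(; \<mu> + 1; z). In the variable z = (w /
  2)^2 the normalized Bessel function is a plain power series, differentiation raises \<mu> by one,
  and negative z gives the oscillating Bessel functions J.\<close>

definition bessel_series :: "real \<Rightarrow> complex \<Rightarrow> complex" where
  "bessel_series \<mu> z = (\<Sum>j. of_real (rGamma (\<mu> + real j + 1) / fact j) * z ^ j)"

lemma bessel_I_normalized_eq: "bessel_I_normalized \<mu> w = bessel_series \<mu> ((w / 2) ^ 2)"
  by (simp add: bessel_I_normalized_def bessel_series_def power_mult[symmetric] mult_ac)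

lemma rGamma_nonneg:
  "(x::real) > 0 \<Longrightarrow> rGamma x \<ge> 0"
  by (simp add: rGamma_inverse_Gamma Gamma_real_pos less_imp_le)

lemma bessel_series_term_bound:
  assumes "\<mu> > -1" "L \<ge> 1"
  shows "L powr \<mu> * norm (of_real (rGamma (\<mu> + real j + 1) / fact j) * z ^ j :: complex) \<le>
    exp L * ((norm z / L) ^ j / fact j)"
proof -
  have *: "L powr (\<mu> + real j) * rGamma (\<mu> + real j + 1) \<le> exp L"
    using assms by (intro powr_mult_rGamma_le_exp) auto
  have "L powr \<mu> * norm (of_real (rGamma (\<mu> + real j + 1) / fact j) * z ^ j :: complex) =
    L powr (\<mu> + real j) * rGamma (\<mu> + real j + 1) * ((norm z / L) ^ j / fact j)"
    using assms rGamma_nonneg[of "\<mu> + real j + 1"]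
    by (simp add: norm_mult norm_power norm_divide powr_add powr_realpow field_simps)
  also have "\<dots> \<le> exp L * ((norm z / L) ^ j / fact j)"
    using assms by (intro mult_right_mono *) auto
  finally show ?thesis .
qed

lemma summable_bessel_series_norm:
  assumes "\<mu> > -1"
  shows "summable (\<lambda>j. norm (of_real (rGamma (\<mu> + real j + 1) / fact j) * z ^ j :: complex))"
proof (rule summable_comparison_test')
  show "summable (\<lambda>j. exp 1 * (norm z ^ j / fact j))"
    using summable_exp[of "norm z"] by (intro summable_mult) (simp add: field_simps)
  show "norm (norm (of_real (rGamma (\<mu> + real j + 1) / fact j) * z ^ j :: complex)) \<le>
     exp 1 * (norm z ^ j / fact j)" if "j \<ge> 0" for j
    using bessel_series_term_bound[of \<mu> 1 j z] assms by simp
qed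

lemmas summable_bessel_series = summable_bessel_series_norm[THEN summable_norm_cancel]

lemma sums_bessel_series:
  assumes "\<mu> > -1"
  shows "(\<lambda>j. of_real (rGamma (\<mu> + real j + 1) / fact j) * z ^ j) sums bessel_series \<mu> z"
  unfolding bessel_series_def using summable_bessel_series[OF assms] by (rule summable_sums)

text \<open>L is free: a large L gains L powr (- \<mu>) at the price exp (L + |z| / L). Since the
  indices of the modes grow linearly in the degree, a suitable L beats any given geometric growth in
  the degree.\<close>

lemma norm_bessel_series_le:
  assumes "\<mu> > -1" "L \<ge> 1"
  shows "L powr \<mu> * norm (bessel_series \<mu> z) \<le> exp (L + norm z / L)"
proof -
  let ?f = "\<lambda>j. of_real (rGamma (\<mu> + real j + 1) / fact j) * z ^ j :: complex"
  have s: "summable (\<lambda>j. norm (?f j))" by (rule summable_bessel_series_norm[OF assms(1)])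
  have E: "(\<lambda>j. (norm z / L) ^ j / fact j) sums exp (norm z / L)"
    using exp_converges[of "norm z / L"] by (simp add: divide_inverse mult.commute)
  have "L powr \<mu> * norm (bessel_series \<mu> z) \<le> L powr \<mu> * (\<Sum>j. norm (?f j))"
    unfolding bessel_series_def by (intro mult_left_mono summable_norm s) auto
  also have "\<dots> = (\<Sum>j. L powr \<mu> * norm (?f j))"
    by (rule suminf_mult[OF s, symmetric])
  also have "\<dots> \<le> (\<Sum>j. exp L * ((norm z / L) ^ j / fact j))"
    by (intro suminf_le bessel_series_term_bound assms summable_mult s sums_summable[OF E])
  also have "\<dots> = exp L * exp (norm z / L)"
    using sums_mult[OF E, of "exp L"] by (rule sums_unique[symmetric])
  finally show ?thesis by (simp add: exp_add)
qed

lemma DERIV_bessel_series: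
  assumes "\<mu> > -1"
  shows "(bessel_series \<mu> has_field_derivative bessel_series (\<mu> + 1) z) (at z)"
proof -
  let ?c = "\<lambda>j. of_real (rGamma (\<mu> + real j + 1) / fact j) :: complex"
  have "((\<lambda>x. \<Sum>n. ?c n * x ^ n) has_field_derivative (\<Sum>n. diffs ?c n * z ^ n)) (at z)"
    using summable_bessel_series[OF assms] by (rule termdiffs_strong_converges_everywhere)
  also have "(\<lambda>x. \<Sum>n. ?c n * x ^ n) = bessel_series \<mu>"
    by (simp add: fun_eq_iff bessel_series_def)
  also have "diffs ?c = (\<lambda>j. of_real (rGamma (\<mu> + 1 + real j + 1) / fact j))"
  proof
    fix j
    have "real (Suc j) * (rGamma (\<mu> + real (Suc j) + 1) / fact (Suc j)) =
        rGamma (\<mu> + 1 + real j + 1) / fact j"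
      by (simp add: field_simps del: of_nat_Suc) (simp add: add_ac)
    thus "diffs ?c j = of_real (rGamma (\<mu> + 1 + real j + 1) / fact j)"
      unfolding diffs_def by (metis of_real_mult of_real_of_nat_eq)
  qed
  finally show ?thesis by (simp only: bessel_series_def[of "\<mu> + 1"])
qed

text \<open>Bessel's equation z \<phi>'' + (\<mu> + 1) \<phi>' = \<phi> for \<phi> =
  \<open>bessel_series \<mu>\<close>, because each derivative raises the index by one. On
  coefficients it is the functional equation of \<open>rGamma\<close>: j + \<mu> + 1 times the j-th
  coefficient for \<mu> + 1 is the one for \<mu>.\<close>

lemma bessel_series_rec:
  assumes "\<mu> > -1"
  shows "z * bessel_series (\<mu> + 2) z + of_real (\<mu> + 1) * bessel_series (\<mu> + 1) z = bessel_series \<mu> z"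
proof -
  let ?c = "\<lambda>\<mu> j. of_real (rGamma (\<mu> + real j + 1) / fact j) * z ^ j :: complex"
  have 1: "(\<lambda>j. of_real (real j) * ?c (\<mu> + 1) j) sums (z * bessel_series (\<mu> + 2) z)"
  proof -
    have "(\<lambda>j. z * ?c (\<mu> + 2) j) sums (z * bessel_series (\<mu> + 2) z)"
      using assms by (intro sums_mult sums_bessel_series) auto
    also have "(\<lambda>j. z * ?c (\<mu> + 2) j) = (\<lambda>j. of_real (real (Suc j)) * ?c (\<mu> + 1) (Suc j))"
      by (simp add: fun_eq_iff add_ac field_simps del: of_nat_Suc)
         (simp add: add_ac)
    finally show ?thesis by (subst (asm) sums_Suc_iff) simp
  qed
  have 2: "(\<lambda>j. of_real (\<mu> + 1) * ?c (\<mu> + 1) j) sums (of_real (\<mu> + 1) * bessel_series (\<mu> + 1) z)"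
    using assms by (intro sums_mult sums_bessel_series) auto
  have "of_real (real j) * ?c (\<mu> + 1) j + of_real (\<mu> + 1) * ?c (\<mu> + 1) j = ?c \<mu> j" for j
  proof -
    have "rGamma (\<mu> + real j + 1) = (\<mu> + real j + 1) * rGamma (\<mu> + real j + 1 + 1)"
      by (rule rGamma_plus1[symmetric])
    thus ?thesis by (simp add: algebra_simps add_divide_distrib)
  qed
  with sums_add[OF 1 2] have "?c \<mu> sums (z * bessel_series (\<mu> + 2) z + of_real (\<mu> + 1) * bessel_series (\<mu> + 1) z)"
    by simp
  with sums_bessel_series[OF assms, of z] show ?thesis by (rule sums_unique2[symmetric])
qed

section \<open>Gegenbauer coefficients and finite differences\<close>

text \<open>The normalized polynomial is classically (m + \<nu>) / \<nu> times the Gegenbauer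
  polynomial; cancelling \<nu> against the first factor of \<open>pochhammer \<nu> (m - i)\<close>
  gives this form, which also covers \<nu> = 0, the case of the plane. For m = 0 the truncated m - i
  - 1 would give the value \<nu> instead of 1.\<close>

definition gegen_coeff :: "real \<Rightarrow> nat \<Rightarrow> nat \<Rightarrow> real" where
  "gegen_coeff \<nu> m i = (if m = 0 then 1 else
     (-1) ^ i * 2 ^ (m - 2 * i) * (\<nu> + real m) * pochhammer (\<nu> + 1) (m - i - 1) /
     (fact i * fact (m - 2 * i)))"

text \<open>With \<open>p = x \<bullet> y\<close> and \<open>q = |x|\<^sup>2 |y|\<^sup>2\<close> this is the zonal harmonic \<open>|x|\<^sup>m |y|\<^sup>m C\<^sub>m(cos \<theta>)\<close>;
  complex arguments occur when \<open>x\<close> moves along a complex line.\<close>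

definition solid_gegen :: "real \<Rightarrow> nat \<Rightarrow> 'b::{real_algebra_1,comm_ring_1} \<Rightarrow> 'b \<Rightarrow> 'b" where
  "solid_gegen \<nu> m p q = (\<Sum>i\<le>m div 2. of_real (gegen_coeff \<nu> m i) * p ^ (m - 2 * i) * q ^ i)"

lemma dim_index:
  assumes "\<nu> = (real DIM('a::euclidean_space) - 2) / 2"
  shows "real DIM('a) = 2 * \<nu> + 2" "\<nu> \<ge> -1/2"
proof -
  show N: "real DIM('a) = 2 * \<nu> + 2" unfolding assms by (simp add: field_simps)
  have "real DIM('a) \<ge> 1" using DIM_positive[where 'a = 'a] by linarith
  thus "\<nu> \<ge> -1/2" using N by linarith
qed

lemma bessel_index_gt:
  assumes "a > 0" "2 / a * \<nu> > -1"
  shows "2 / a * (real m + \<nu>) > -1"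
proof -
  have "2 / a * real m \<ge> 0" using assms by simp
  thus ?thesis using assms(2) unfolding distrib_left by linarith
qed

text \<open>With N = 2 \<nu> + 2 the assumption a > 2 - N reads 2 \<nu> / a > -1; this keeps the
  Gamma factors positive and the radial integrals convergent at 0.\<close>

lemma dim_bessel_index:
  assumes "a > 0" "a > 2 - real DIM('a::euclidean_space)" "\<nu> = (real DIM('a) - 2) / 2"
  shows "2 / a * \<nu> > -1" "2 / a * (real m + \<nu>) > -1"
proof -
  show "2 / a * \<nu> > -1" using assms(1,2) dim_index(1)[OF assms(3)] by (simp add: field_simps)
  thus "2 / a * (real m + \<nu>) > -1" by (rule bessel_index_gt[OF assms(1)])
qed

lemma fps_nth_linear_power:
  fixes c :: "'b::comm_ring_1"
  shows "fps_nth ((fps_X - fps_const c) ^ k) i = of_nat (k choose i) * (- c) ^ (k - i)"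
proof -
  have "(fps_X - fps_const c) ^ k = (fps_X + fps_const (- c)) ^ k"
    by (simp add: fps_const_neg[symmetric] del: fps_const_neg)
  also have "\<dots> = (\<Sum>j\<le>k. of_nat (k choose j) * fps_X ^ j * fps_const (- c) ^ (k - j))"
    by (rule binomial_ring)
  also have "fps_nth \<dots> i = (\<Sum>j\<le>k. if i = j then of_nat (k choose i) * (- c) ^ (k - i) else 0)"
    unfolding fps_sum_nth
    by (intro sum.cong refl)
       (auto simp: fps_of_nat[symmetric] fps_const_power mult.assoc fps_X_power_iff
         simp del: fps_of_nat)
  also have "\<dots> = of_nat (k choose i) * (- c) ^ (k - i)"
    by (auto simp: not_le binomial_eq_0)
  finally show ?thesis .
qed

text \<open>Since X^2 - 2 t X = X (X - 2 t), the coefficient of X^m in its k-th power is that of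
  X^(m - k) in (X - 2 t)^k. The summation index is i = m - k; for k < m - m div 2 the binomial
  coefficient vanishes.\<close>

lemma gegenbauer_generating_nth:
  fixes \<nu> t :: real
  shows "fps_nth (fps_binomial (- (\<nu> + 1)) oo (fps_X ^ 2 - fps_const (2 * t) * fps_X)) m =
    (\<Sum>i\<le>m div 2. (-1) ^ i * 2 ^ (m - 2 * i) * pochhammer (\<nu> + 1) (m - i) /
       (fact i * fact (m - 2 * i)) * t ^ (m - 2 * i))" (is "?L = ?R")
proof -
  have pw: "fps_nth ((fps_X ^ 2 - fps_const (2 * t) * fps_X) ^ k) m =
     (if m < k then 0 else of_nat (k choose (m - k)) * (- (2 * t)) ^ (k - (m - k)))" for k
  proof -
    have "(fps_X ^ 2 - fps_const (2 * t) * fps_X) = fps_X * (fps_X - fps_const (2 * t))"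
      by (simp add: power2_eq_square algebra_simps)
    thus ?thesis
      by (simp only: power_mult_distrib fps_X_power_mult_nth fps_nth_linear_power)
  qed
  have "?L = (\<Sum>k=0..m. (- (\<nu> + 1) gchoose k) * (of_nat (k choose (m - k)) * (- (2 * t)) ^ (k - (m - k))))"
    unfolding fps_compose_nth pw fps_binomial_nth by (intro sum.cong) auto
  also have "\<dots> = (\<Sum>k\<in>{m - m div 2..m}. (- (\<nu> + 1) gchoose k) * (of_nat (k choose (m - k)) * (- (2 * t)) ^ (k - (m - k))))"
    by (intro sum.mono_neutral_right) (auto simp: binomial_eq_0_iff)
  also have "\<dots> = ?R"
  proof (rule sum.reindex_bij_witness[of _ "\<lambda>i. m - i" "\<lambda>k. m - k"])
    fix k assume k: "k \<in> {m - m div 2..m}"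
    define i where "i = m - k"
    have i: "k = m - i" "2 * i \<le> m" "m - k = i" using k by (auto simp: i_def)
    have ki: "k - i = m - 2 * i" "i \<le> k" using i by auto
    have "(-1) ^ k * (- (2 * t)) ^ (m - 2 * i) = (-1) ^ (k + (m - 2 * i)) * (2 * t) ^ (m - 2 * i)"
      by (simp only: power_add power_minus[of "2 * t" "m - 2 * i"] mult.assoc)
    also have "(-1::real) ^ (k + (m - 2 * i)) = (-1) ^ i"
    proof -
      have "k + (m - 2 * i) = i + 2 * (m - 2 * i)" using i by auto
      thus ?thesis by (simp only: power_add power_mult) simp
    qed
    finally have sg: "(-1) ^ k * (- (2 * t)) ^ (m - 2 * i) = (-1) ^ i * (2 * t) ^ (m - 2 * i)" .
    have ch: "real (k choose i) = fact k / (fact i * fact (m - 2 * i))"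
      using ki by (simp add: binomial_fact)
    have "(- (\<nu> + 1) gchoose k) * (of_nat (k choose i) * (- (2 * t)) ^ (k - i)) =
      ((-1) ^ k * (- (2 * t)) ^ (m - 2 * i)) * (pochhammer (\<nu> + 1) k / fact k * of_nat (k choose i))"
      by (simp add: gbinomial_pochhammer ki add.commute)
    hence fin: "(- (\<nu> + 1) gchoose k) * (of_nat (k choose i) * (- (2 * t)) ^ (k - i)) =
      (-1) ^ i * (2 * t) ^ (m - 2 * i) * (pochhammer (\<nu> + 1) k / fact k * (fact k / (fact i * fact (m - 2 * i))))"
      unfolding sg ch .
    show "(-1) ^ (m - k) * 2 ^ (m - 2 * (m - k)) * pochhammer (\<nu> + 1) (m - (m - k)) / (fact (m - k) * fact (m - 2 * (m - k))) * t ^ (m - 2 * (m - k)) = 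
      (- (\<nu> + 1) gchoose k) * (of_nat (k choose (m - k)) * (- (2 * t)) ^ (k - (m - k)))"
      unfolding i(3) i(1)[symmetric] fin by (simp add: power_mult_distrib)
  qed auto
  finally show ?thesis .
qed

text \<open>Multiplication by 1 - X^2 subtracts the coefficient of degree m - 2. Its summand i - 1
  has the same monomial as summand i, and over a common denominator it contributes i to the factor
  \<nu> + m - i, which completes it to \<nu> + m.\<close>

lemma gegenbauer_normalized_eq:
  "gegenbauer_normalized \<nu> m t = (\<Sum>i\<le>m div 2. gegen_coeff \<nu> m i * t ^ (m - 2 * i))"
proof -
  define d where "d = (\<lambda>m i. (-1) ^ i * 2 ^ (m - 2 * i) * pochhammer (\<nu> + 1) (m - i) /
       (fact i * fact (m - 2 * i)) :: real)"
  define f where "f = fps_binomial (- (\<nu> + 1)) oo (fps_X ^ 2 - fps_const (2 * t) * fps_X)"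
  have f: "fps_nth f m = (\<Sum>i\<le>m div 2. d m i * t ^ (m - 2 * i))" for m
    unfolding f_def d_def by (rule gegenbauer_generating_nth)
  have "gegenbauer_normalized \<nu> m t = fps_nth f m - fps_nth (fps_X ^ 2 * f) m"
    by (simp add: gegenbauer_normalized_def f_def algebra_simps)
  also have "\<dots> = fps_nth f m - (if m < 2 then 0 else fps_nth f (m - 2))"
    by (simp add: fps_X_power_mult_nth)
  finally have main: "gegenbauer_normalized \<nu> m t = \<dots>" .
  consider "m = 0" | "m = 1" | "m \<ge> 2" by linarith
  thus ?thesis
  proof cases
    case 3
    then obtain n where m: "m = n + 2" by (metis add.commute le_Suc_ex)
    have "fps_nth f m - fps_nth f (m - 2) = 
      (\<Sum>i\<le>n div 2 + 1. (d m i - (if i = 0 then 0 else d n (i - 1))) * t ^ (m - 2 * i))"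
      unfolding f sum_subtractf left_diff_distrib m
      by (simp add: sum.atMost_Suc_shift del: sum.atMost_Suc)
    also have "\<dots> = (\<Sum>i\<le>m div 2. gegen_coeff \<nu> m i * t ^ (m - 2 * i))"
    proof (intro sum.cong)
      fix i assume "i \<in> {..m div 2}"
      hence i: "2 * i \<le> m" by auto
      have k: "pochhammer (\<nu> + 1) (m - i) = pochhammer (\<nu> + 1) (m - i - 1) * (\<nu> + real m - real i)"
      proof -
        have "m - i = Suc (m - i - 1)" "real (m - i - 1) = real m - real i - 1" using i m by auto
        thus ?thesis using pochhammer_Suc[of "\<nu> + 1" "m - i - 1"] by simp
      qed
      have "d m i - (if i = 0 then 0 else d n (i - 1)) = gegen_coeff \<nu> m i"
      proof (cases i)
        case 0
        thus ?thesis using k m by (simp add: d_def gegen_coeff_def mult_ac)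
      next
        case (Suc j)
        have "n - j = m - i - 1" "n - 2 * j = m - 2 * i" using Suc m by auto
        hence dn: "d n j = (-1) ^ j * 2 ^ (m - 2 * i) * pochhammer (\<nu> + 1) (m - i - 1) / (fact j * fact (m - 2 * i))"
          by (simp only: d_def)
        have "fact i = real i * fact j" using Suc by simp
        hence dn': "d n j = - ((-1) ^ i * 2 ^ (m - 2 * i) * pochhammer (\<nu> + 1) (m - i - 1) / (fact i * fact (m - 2 * i))) * real i"
          unfolding dn using Suc by simp
        have "d m i = ((-1) ^ i * 2 ^ (m - 2 * i) * pochhammer (\<nu> + 1) (m - i - 1) / (fact i * fact (m - 2 * i))) * (\<nu> + real m - real i)"
          unfolding d_def k by simp
        hence "d m i - d n j = ((-1) ^ i * 2 ^ (m - 2 * i) * pochhammer (\<nu> + 1) (m - i - 1) / (fact i * fact (m - 2 * i))) * ((\<nu> + real m - real i) + real i)"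
          unfolding dn' by (simp only: ring_distribs)
        also have "\<dots> = gegen_coeff \<nu> m i" using m by (simp add: gegen_coeff_def mult_ac)
        finally show ?thesis using Suc by simp
      qed
      thus "(d m i - (if i = 0 then 0 else d n (i - 1))) * t ^ (m - 2 * i) =
        gegen_coeff \<nu> m i * t ^ (m - 2 * i)" by simp
    qed (simp add: m)
    finally show ?thesis using main 3 by simp
  next
    case 1
    with main show ?thesis by (simp add: f d_def gegen_coeff_def)
  next
    case 2
    with main show ?thesis by (simp add: f d_def gegen_coeff_def algebra_simps)
  qed
qed

lemma solid_gegen_of_real:
  "solid_gegen \<nu> m (of_real p) (of_real q) = of_real (solid_gegen \<nu> m p q)"
  by (simp add: solid_gegen_def)

lemma gegenbauer_normalized_solid: "gegenbauer_normalized \<nu> m t = solid_gegen \<nu> m t 1"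
  by (simp add: gegenbauer_normalized_eq solid_gegen_def)

lemma solid_gegen_scale:
  fixes p q c :: "'b::{real_algebra_1,comm_ring_1}"
  shows "solid_gegen \<nu> m (c * p) (c ^ 2 * q) = c ^ m * solid_gegen \<nu> m p q"
  unfolding solid_gegen_def sum_distrib_left
proof (intro sum.cong refl)
  fix i assume "i \<in> {..m div 2}"
  hence "c ^ m = c ^ (m - 2 * i) * c ^ (2 * i)" by (simp flip: power_add)
  moreover have "(c\<^sup>2 * q) ^ i = c ^ (2 * i) * q ^ i"
    by (simp add: power_mult_distrib power_mult)
  ultimately show "of_real (gegen_coeff \<nu> m i) * (c * p) ^ (m - 2 * i) * (c\<^sup>2 * q) ^ i =
    c ^ m * (of_real (gegen_coeff \<nu> m i) * p ^ (m - 2 * i) * q ^ i)"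
    by (simp only: power_mult_distrib mult_ac)
qed

lemma pochhammer_le_power_fact:
  assumes "(\<nu>::real) \<ge> -1/2"
  shows "0 \<le> pochhammer (\<nu> + 1) k" "pochhammer (\<nu> + 1) k \<le> (\<nu> + 2) ^ k * fact k"
proof (induction k)
  case (Suc k)
  case 1
  show ?case using assms Suc by (simp add: pochhammer_Suc)
next
  case (Suc k)
  case 2
  have "pochhammer (\<nu> + 1) k * (\<nu> + 1 + real k) \<le> ((\<nu> + 2) ^ k * fact k) * ((\<nu> + 2) * (real k + 1))"
  proof (intro mult_mono)
    have "0 \<le> (\<nu> + 1) * real k" using assms by auto
    thus "\<nu> + 1 + real k \<le> (\<nu> + 2) * (real k + 1)" by (simp add: algebra_simps)
  qed (use assms Suc in auto)
  thus ?case by (simp add: pochhammer_Suc mult_ac add_ac)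
qed auto

text \<open>A geometric rate is enough, since the Bessel factor will beat it. The three factors 2^m
  come from 2^(m - 2 i), from \<nu> + m \<le> (\<nu> + 2) 2^m and from the binomial coefficient (m -
  i)! / (i! (m - 2 i)!).\<close>

lemma abs_gegen_coeff_le:
  assumes "\<nu> \<ge> -1/2" "2 * i \<le> m"
  shows "\<bar>gegen_coeff \<nu> m i\<bar> \<le> (8 * (\<nu> + 2)) ^ m"
proof (cases "m = 0")
  case False
  define k where "k = m - i - 1"
  have k: "m - i = Suc k" using False assms by (auto simp: k_def)
  have fk: "fact k \<le> (fact (m - i) :: real)" unfolding k by (intro fact_mono) auto
  have ch: "fact (m - i) / (fact i * fact (m - 2 * i)) = real ((m - i) choose i)"
    using assms binomial_fact[of i "m - i", where ?'a = real] by (simp add: mult_2)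
  have ch2: "real ((m - i) choose i) \<le> 2 ^ m"
  proof -
    have "(m - i) choose i \<le> 2 ^ (m - i)" by (rule binomial_le_pow2)
    also have "\<dots> \<le> 2 ^ m" by (rule power_increasing) auto
    finally have "real ((m - i) choose i) \<le> real (2 ^ m)" by (rule of_nat_mono)
    thus ?thesis by simp
  qed
  have nm: "0 \<le> \<nu> + real m" "\<nu> + real m \<le> (\<nu> + 2) * 2 ^ m"
  proof -
    show "0 \<le> \<nu> + real m" using assms False by (cases m) auto
    have "m < 2 ^ m" by (rule less_exp)
    hence "real m \<le> real (2 ^ m)" by (intro of_nat_mono less_imp_le)
    hence m2: "real m \<le> 2 ^ m" by simp
    have "(\<nu> + 1) * 1 \<le> (\<nu> + 1) * real m" using False assms by (intro mult_left_mono) auto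
    hence "\<nu> + real m \<le> (\<nu> + 2) * real m" by (simp add: algebra_simps)
    also have "\<dots> \<le> (\<nu> + 2) * 2 ^ m" using assms m2 by (intro mult_left_mono) auto
    finally show "\<nu> + real m \<le> (\<nu> + 2) * 2 ^ m" .
  qed
  have "\<bar>gegen_coeff \<nu> m i\<bar> = 2 ^ (m - 2 * i) * (\<nu> + real m) * pochhammer (\<nu> + 1) k / (fact i * fact (m - 2 * i))"
    using False nm pochhammer_le_power_fact[OF assms(1), of k]
    by (simp add: gegen_coeff_def abs_mult k_def power_abs)
  also have "\<dots> \<le> 2 ^ m * ((\<nu> + 2) * 2 ^ m) * ((\<nu> + 2) ^ k * fact (m - i)) / (fact i * fact (m - 2 * i))"
  proof (intro divide_right_mono mult_mono nm)
    show "pochhammer (\<nu> + 1) k \<le> (\<nu> + 2) ^ k * fact (m - i)"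
      using pochhammer_le_power_fact(2)[OF assms(1), of k]
        mult_left_mono[OF fk, of "(\<nu> + 2) ^ k"] assms(1) by (simp add: order_trans)
      show "(2::real) ^ (m - 2 * i) \<le> 2 ^ m" by (rule power_increasing) auto
  qed (use assms nm pochhammer_le_power_fact[OF assms(1), of k] in auto)
  also have "\<dots> = 2 ^ m * ((\<nu> + 2) * 2 ^ m) * (\<nu> + 2) ^ k * real ((m - i) choose i)"
    by (simp add: ch[symmetric])
  also have "\<dots> \<le> 2 ^ m * ((\<nu> + 2) * 2 ^ m) * (\<nu> + 2) ^ k * 2 ^ m"
    using assms by (intro mult_left_mono ch2) auto
  also have "\<dots> = 2 ^ m * 2 ^ m * 2 ^ m * (\<nu> + 2) ^ Suc k" by simp
  also have "\<dots> \<le> 2 ^ m * 2 ^ m * 2 ^ m * (\<nu> + 2) ^ m"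
    using assms k by (intro mult_left_mono power_increasing) auto
  also have "\<dots> = (8 * (\<nu> + 2)) ^ m"
    by (simp only: power_mult_distrib[symmetric]) simp
  finally show ?thesis .
qed (use assms in \<open>auto simp: gegen_coeff_def\<close>)

text \<open>X plays the role of |x| |y|, with room for complex p and q. Passing from 8 to 16 absorbs
  the number m div 2 + 1 of summands.\<close>

lemma norm_solid_gegen_le:
  fixes p q :: "'b::{real_normed_field}"
  assumes "\<nu> \<ge> -1/2" "norm p \<le> X" "norm q \<le> X ^ 2"
  shows "norm (solid_gegen \<nu> m p q) \<le> (16 * (\<nu> + 2) * X) ^ m"
proof -
  have X: "X \<ge> 0" using assms(2) norm_ge_zero order_trans by blast
  have "norm (solid_gegen \<nu> m p q) \<le> (\<Sum>i\<le>m div 2. (8 * (\<nu> + 2)) ^ m * X ^ m)"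
    unfolding solid_gegen_def
  proof (rule sum_norm_le)
    fix i assume "i \<in> {..m div 2}"
    hence i: "2 * i \<le> m" by auto
    have "norm (of_real (gegen_coeff \<nu> m i) * p ^ (m - 2 * i) * q ^ i) \<le>
       (8 * (\<nu> + 2)) ^ m * X ^ (m - 2 * i) * (X ^ 2) ^ i"
      unfolding norm_mult norm_power norm_of_real using assms X
      by (intro mult_mono power_mono abs_gegen_coeff_le i) auto
    also have "\<dots> = (8 * (\<nu> + 2)) ^ m * X ^ m"
      using i by (simp add: mult.assoc power_mult[symmetric] power_add[symmetric])
    finally show "norm (of_real (gegen_coeff \<nu> m i) * p ^ (m - 2 * i) * q ^ i) \<le> \<dots>" .
  qed
  also have "\<dots> = real (m div 2 + 1) * ((8 * (\<nu> + 2)) ^ m * X ^ m)" by simp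
  also have "\<dots> \<le> 2 ^ m * ((8 * (\<nu> + 2)) ^ m * X ^ m)"
  proof (rule mult_right_mono)
    have "m div 2 + 1 \<le> 2 ^ m"
    proof (cases m)
      case (Suc n)
      have "m div 2 + 1 \<le> m" using Suc by auto
      thus ?thesis using less_exp[of m] by linarith
    qed auto
    hence "real (m div 2 + 1) \<le> real (2 ^ m)" by (rule of_nat_mono)
    thus "real (m div 2 + 1) \<le> 2 ^ m" by simp
  qed (use assms X in auto)
  also have "\<dots> = (16 * (\<nu> + 2) * X) ^ m"
    by (simp only: power_mult_distrib[symmetric] mult.assoc[symmetric]) simp
  finally show ?thesis .
qed

text \<open>This is harmonicity of the zonal polynomial: in its Laplacian the monomial p^(m - 2 i -
  2) q^i arises from the summands i and i + 1, and the two contributions must cancel.\<close>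

lemma gegen_coeff_rec:
  assumes "2 * i + 2 \<le> m"
  shows "gegen_coeff \<nu> m i * (real (m - 2 * i) * real (m - 2 * i - 1)) +
    gegen_coeff \<nu> m (Suc i) * (4 * real (Suc i) * (\<nu> + real m - real i - 1)) = 0"
proof -
  obtain k where m: "m = 2 * i + 2 + k" using assms le_Suc_ex by blast
  have e: "m - i - 1 = Suc (i + k)" "m - Suc i - 1 = i + k" "m - 2 * i = Suc (Suc k)" "m - 2 * Suc i = k"
    using m by auto
  define A where "A = (-1) ^ i * 2 ^ k * (\<nu> + real m) * pochhammer (\<nu> + 1) (i + k) / (fact i * fact k)"
  define Y where "Y = \<nu> + 1 + real (i + k)"
  have "gegen_coeff \<nu> m i * (real (Suc (Suc k)) * real (Suc k)) = 4 * A * Y"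
    unfolding gegen_coeff_def e pochhammer_Suc A_def Y_def using m
    by (simp add: field_simps del: of_nat_Suc of_nat_add)
  moreover have "gegen_coeff \<nu> m (Suc i) * real (Suc i) = - A"
    unfolding gegen_coeff_def e A_def using m
    by (simp add: field_simps del: of_nat_Suc of_nat_add)
  moreover have "\<nu> + real m - real i - 1 = Y" using m by (simp add: Y_def)
  moreover have "gegen_coeff \<nu> m (Suc i) * (4 * real (Suc i) * Y) =
      4 * Y * (gegen_coeff \<nu> m (Suc i) * real (Suc i))" by simp
  ultimately show ?thesis unfolding e diff_Suc_1 by simp
qed

section \<open>Finite differences of rising factorials and of reciprocals\<close>

lemma finite_difference_Suc:
  fixes f :: "nat \<Rightarrow> 'b::comm_ring_1"
  shows "(\<Sum>i\<le>Suc q. (-1) ^ i * of_nat (Suc q choose i) * f i) =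
    (\<Sum>i\<le>q. (-1) ^ i * of_nat (q choose i) * (f i - f (Suc i)))"
proof -
  have "(\<Sum>i\<le>Suc q. (-1) ^ i * of_nat (Suc q choose i) * f i) =
     f 0 + (\<Sum>i\<le>q. (-1) ^ Suc i * of_nat (Suc q choose Suc i) * f (Suc i))"
    by (subst sum.atMost_Suc_shift) simp
  also have "\<dots> = (f 0 + (\<Sum>i\<le>q. (-1) ^ Suc i * of_nat (q choose Suc i) * f (Suc i))) -
     (\<Sum>i\<le>q. (-1) ^ i * of_nat (q choose i) * f (Suc i))"
    by (simp add: ring_distribs sum.distrib sum_negf sum_subtractf)
  also have "f 0 + (\<Sum>i\<le>q. (-1) ^ Suc i * of_nat (q choose Suc i) * f (Suc i)) =
     (\<Sum>i\<le>Suc q. (-1) ^ i * of_nat (q choose i) * f i)"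
    by (subst sum.atMost_Suc_shift) simp
  also have "\<dots> = (\<Sum>i\<le>q. (-1) ^ i * of_nat (q choose i) * f i)"
    by (simp add: binomial_eq_0)
  finally show ?thesis by (simp add: sum_subtractf right_diff_distrib)
qed

text \<open>A q-th difference annihilates polynomials of degree below q. For rising factorials one
  difference lowers the degree by one and produces the factor r, so induction on q applies
  directly.\<close>

lemma finite_difference_pochhammer:
  fixes X :: "'b::comm_ring_1"
  assumes "r < q"
  shows "(\<Sum>i\<le>q. (-1) ^ i * of_nat (q choose i) * pochhammer (X - of_nat i) r) = 0"
  using assms
proof (induction q arbitrary: r)
  case (Suc q)
  have d: "pochhammer (X - of_nat i) r - pochhammer (X - of_nat (Suc i)) r =
     of_nat r * pochhammer (X - of_nat i) (r - 1)" for i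
  proof (cases r)
    case (Suc s)
    have "pochhammer (X - of_nat i) r = pochhammer (X - of_nat i) s * (X - of_nat i + of_nat s)"
      by (simp add: Suc pochhammer_Suc)
    moreover have "pochhammer (X - of_nat (Suc i)) r = (X - of_nat i - 1) * pochhammer (X - of_nat i) s"
      using pochhammer_rec[of "X - of_nat (Suc i)" s] by (simp add: Suc algebra_simps)
    ultimately have "pochhammer (X - of_nat i) r - pochhammer (X - of_nat (Suc i)) r =
        pochhammer (X - of_nat i) s * (X - of_nat i + of_nat s) - (X - of_nat i - 1) * pochhammer (X - of_nat i) s"
      by (simp only:)
    also have "\<dots> = of_nat r * pochhammer (X - of_nat i) (r - 1)"
      by (simp add: Suc algebra_simps)
    finally show ?thesis .
  qed auto
  have "(\<Sum>i\<le>Suc q. (-1) ^ i * of_nat (Suc q choose i) * pochhammer (X - of_nat i) r) =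
     of_nat r * (\<Sum>i\<le>q. (-1) ^ i * of_nat (q choose i) * pochhammer (X - of_nat i) (r - 1))"
    unfolding finite_difference_Suc d sum_distrib_left by (simp add: mult_ac)
  also have "\<dots> = 0"
  proof (cases "r = 0")
    case False
    thus ?thesis using Suc.IH[of "r - 1"] Suc.prems by simp
  qed simp
  finally show ?case .
qed auto

text \<open>The partial fraction decomposition of q! / (X (X - 1) ... (X - q)) up to sign, obtained
  by applying the induction hypothesis at X and at X - 1.\<close>

lemma finite_difference_inverse:
  fixes X :: real
  assumes "X > real q"
  shows "(\<Sum>i\<le>q. (-1) ^ i * of_nat (q choose i) / (X - real i)) =
    (-1) ^ q * fact q / pochhammer (X - real q) (Suc q)"
  using assms
proof (induction q arbitrary: X)
  case (Suc q)
  have P1: "pochhammer (X - real q) (Suc q) \<noteq> 0" and P2: "pochhammer (X - 1 - real q) (Suc q) \<noteq> 0"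
    and P3: "pochhammer (X - real q) q \<noteq> 0"
    using Suc.prems by (intro pochhammer_pos less_imp_neq[symmetric], simp)+
  have "(\<Sum>i\<le>Suc q. (-1) ^ i * of_nat (Suc q choose i) / (X - real i)) =
     (\<Sum>i\<le>q. (-1) ^ i * of_nat (q choose i) / (X - real i)) -
     (\<Sum>i\<le>q. (-1) ^ i * of_nat (q choose i) / (X - 1 - real i))"
    using finite_difference_Suc[of q "\<lambda>i. 1 / (X - real i)"]
    by (simp add: right_diff_distrib sum_subtractf diff_diff_eq)
  also have "\<dots> = (-1) ^ q * fact q / pochhammer (X - real q) (Suc q) - (-1) ^ q * fact q / pochhammer (X - 1 - real q) (Suc q)"
    using Suc.prems by (subst Suc.IH, simp, subst Suc.IH, simp, simp)
  also have "\<dots> = (-1) ^ Suc q * fact (Suc q) / pochhammer (X - real (Suc q)) (Suc (Suc q))"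
  proof -
    have a: "pochhammer (X - real q) (Suc q) = pochhammer (X - real q) q * X"
      by (simp add: pochhammer_Suc)
    have b: "pochhammer (X - 1 - real q) (Suc q) = (X - 1 - real q) * pochhammer (X - real q) q"
      using pochhammer_rec[of "X - 1 - real q" q] by (simp add: algebra_simps)
    have c: "pochhammer (X - real (Suc q)) (Suc (Suc q)) = (X - 1 - real q) * pochhammer (X - real q) q * X"
      using pochhammer_rec[of "X - real (Suc q)" "Suc q"] a by (simp add: algebra_simps)
    show ?thesis unfolding a b c using P3 Suc.prems
      by (simp add: divide_simps) (simp add: algebra_simps)
  qed
  finally show ?case .
qed (simp add: pochhammer_Suc)

section \<open>Polar coordinates\<close>

lemma nn_integral_lborel_scale:
  fixes f :: "'a::euclidean_space \<Rightarrow> ennreal"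
  assumes "c > 0" and [measurable]: "f \<in> borel_measurable borel"
  shows "(\<integral>\<^sup>+ x. f x \<partial>lborel) = ennreal (c ^ DIM('a)) * (\<integral>\<^sup>+ x. f (c *\<^sub>R x) \<partial>lborel)"
proof -
  have "(\<integral>\<^sup>+ x. f x \<partial>lborel) =
     (\<integral>\<^sup>+ x. f x \<partial>(density (distr lborel borel (\<lambda>x. 0 + c *\<^sub>R x)) (\<lambda>_. ennreal (\<bar>c\<bar> ^ DIM('a)))))"
    by (subst lborel_affine[of c 0]) (use assms in auto)
  also have "\<dots> = ennreal (c ^ DIM('a)) * (\<integral>\<^sup>+ x. f (c *\<^sub>R x) \<partial>lborel)"
    using assms by (simp add: nn_integral_density nn_integral_distr nn_integral_cmult)
  finally show ?thesis .
qed

text \<open>Polar coordinates without surface measure: the two measures are compared on half-lines.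
  For s > 0 the preimage is the ball of radius s powr (1 / a); scaling it to the unit ball, which
  leaves A (sgn x) unchanged, gives \<kappa> s powr (N / a), the integral of the density. The
  variable s = |x| powr a is the one in which the radial integrals below are taken.\<close>

lemma distr_norm_powr_eq_density:
  fixes A :: "'a::euclidean_space \<Rightarrow> real" and a :: real
  defines "N \<equiv> real DIM('a)"
  assumes a: "a > 0" and [measurable]: "A \<in> borel_measurable borel"
    and A: "\<And>x. 0 \<le> A x" "\<And>x. A x \<le> M"
  defines "\<kappa> \<equiv> LINT x|lborel. indicator (cball 0 1) x * A (sgn x)"
  shows "distr (density lborel (\<lambda>x. ennreal (A (sgn x)))) borel (\<lambda>x. norm x powr a) =
     density lborel (\<lambda>s. ennreal (N / a * \<kappa> * s powr (N / a - 1) * indicator {0..} s))"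
    (is "?P = ?Q")
proof (rule measure_eqI_generator_eq)
  have N: "N > 0" by (simp add: N_def)
  have int: "integrable lborel (\<lambda>x. indicator (cball 0 1) x * A (sgn x))"
  proof (rule Bochner_Integration.integrable_bound)
    show "integrable lborel (\<lambda>x::'a. indicator (cball 0 1) x * M)"
      using emeasure_lborel_cball_finite[of 0 1] by (intro integrable_mult_left integrable_real_indicator) auto
  qed (use A in \<open>auto simp: indicator_def abs_mult intro!: AE_I2 order_trans[OF _ abs_ge_self]\<close>)
  have \<kappa>: "(\<integral>\<^sup>+ x. ennreal (A (sgn x)) * indicator (cball 0 1) x \<partial>lborel) = ennreal \<kappa>"
    unfolding \<kappa>_def using A int
    by (subst nn_integral_eq_integral[symmetric])
       (auto simp: indicator_def intro!: nn_integral_cong)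
  have \<kappa>0: "\<kappa> \<ge> 0" unfolding \<kappa>_def using A by (intro Bochner_Integration.integral_nonneg) auto
  show eq: "emeasure ?P X = emeasure ?Q X" if "X \<in> range atMost" for X
  proof -
    from that obtain s :: real where X: "X = {..s}" by auto
    have "emeasure ?P X = (\<integral>\<^sup>+ x. ennreal (A (sgn x)) * indicator {x. norm x powr a \<le> s} x \<partial>lborel)"
      unfolding X by (simp add: emeasure_distr emeasure_density vimage_def)
    moreover have "emeasure ?Q X = (\<integral>\<^sup>+ r. ennreal (N / a * \<kappa> * (r powr (N / a - 1) * indicator {0..s} r)) \<partial>lborel)"
      unfolding X by (simp add: emeasure_density) (auto intro!: nn_integral_cong simp: indicator_def)
    moreover have "(\<integral>\<^sup>+ x. ennreal (A (sgn x)) * indicator {x. norm x powr a \<le> s} x \<partial>lborel) =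
       (\<integral>\<^sup>+ r. ennreal (N / a * \<kappa> * (r powr (N / a - 1) * indicator {0..s} r)) \<partial>lborel)"
    proof (cases "s > 0")
      case False
      have "(\<integral>\<^sup>+ x. ennreal (A (sgn x)) * indicator {x. norm x powr a \<le> s} x \<partial>lborel) = (\<integral>\<^sup>+ (x::'a). 0 \<partial>lborel)"
      proof (rule nn_integral_cong_AE)
        have "AE x in lborel. (x::'a) \<noteq> 0" by (rule AE_lborel_singleton)
        thus "AE x::'a in lborel. ennreal (A (sgn x)) * indicator {x. norm x powr a \<le> s} x = 0"
        proof eventually_elim
          case (elim x)
          hence "norm x powr a > 0" by simp
          with False have "\<not> norm x powr a \<le> s" by linarith
          thus ?case by simp
        qed
      qed
      moreover have "(\<integral>\<^sup>+ r. ennreal (N / a * \<kappa> * (r powr (N / a - 1) * indicator {0..s} r)) \<partial>lborel) = (\<integral>\<^sup>+ (r::real). 0 \<partial>lborel)"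
        
      proof (intro nn_integral_cong)
        fix r :: real
        have "r = 0" if "r \<in> {0..s}" using that False by auto
        thus "ennreal (N / a * \<kappa> * (r powr (N / a - 1) * indicator {0..s} r)) = 0"
          by (cases "r \<in> {0..s}") (auto simp: indicator_def)
      qed
      ultimately show ?thesis by simp
    next
      case True
      define c where "c = s powr (1 / a)"
      have c: "c > 0" using True by (simp add: c_def)
      have iff: "norm x powr a \<le> s \<longleftrightarrow> norm x \<le> c" for x :: 'a
      proof -
        have "s = c powr a" using a True by (simp add: c_def powr_powr)
        moreover have "norm x powr a \<le> c powr a \<longleftrightarrow> norm x \<le> c"
          using a c powr_mono2[of a "norm x" c] powr_less_mono2[of a c "norm x"] by (auto simp: not_le[symmetric])
        ultimately show ?thesis by simp
      qed
      have "(\<integral>\<^sup>+ x. ennreal (A (sgn x)) * indicator {x. norm x powr a \<le> s} x \<partial>lborel) =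
         ennreal (c ^ DIM('a)) * (\<integral>\<^sup>+ x. ennreal (A (sgn (c *\<^sub>R x))) * indicator {x. norm x powr a \<le> s} (c *\<^sub>R x) \<partial>lborel)"
        by (rule nn_integral_lborel_scale) (use c in measurable)
      also have "(\<lambda>x. ennreal (A (sgn (c *\<^sub>R x))) * indicator {x. norm x powr a \<le> s} (c *\<^sub>R x)) =
         (\<lambda>x. ennreal (A (sgn x)) * indicator (cball 0 1) x)"
        using c unfolding iff by (auto simp: fun_eq_iff sgn_scaleR indicator_def)
      also have "c ^ DIM('a) = s powr (N / a)"
        using c by (simp add: c_def N_def powr_powr flip: powr_realpow)
      also have "ennreal (s powr (N / a)) * (\<integral>\<^sup>+ x. ennreal (A (sgn x)) * indicator (cball 0 1) x \<partial>lborel) = ennreal (\<kappa> * s powr (N / a))"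
        unfolding \<kappa> using \<kappa>0 by (simp add: ennreal_mult' mult_ac)
      also have "\<dots> = (\<integral>\<^sup>+ r. ennreal (N / a * \<kappa> * (r powr (N / a - 1) * indicator {0..s} r)) \<partial>lborel)"
      proof (rule nn_integral_has_integral_lborel[symmetric])
        have "((\<lambda>r. r powr (N / a - 1)) has_integral (s powr (N / a - 1 + 1) / (N / a - 1 + 1))) {0..s}"
          using True a N by (intro has_integral_powr_from_0) (auto simp: field_simps)
        hence "((\<lambda>r. N / a * \<kappa> * r powr (N / a - 1)) has_integral (N / a * \<kappa> * (s powr (N / a - 1 + 1) / (N / a - 1 + 1)))) {0..s}"
          by (rule has_integral_mult_right)
        hence "((\<lambda>r. N / a * \<kappa> * r powr (N / a - 1)) has_integral (\<kappa> * s powr (N / a))) {0..s}"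
          using N a by simp
        hence "((\<lambda>r. if r \<in> {0..s} then N / a * \<kappa> * r powr (N / a - 1) else 0) has_integral (\<kappa> * s powr (N / a))) UNIV"
          by (subst has_integral_restrict_UNIV)
        thus "((\<lambda>r. N / a * \<kappa> * (r powr (N / a - 1) * indicator {0..s} r)) has_integral (\<kappa> * s powr (N / a))) UNIV"
          by (rule has_integral_eq[rotated]) (auto simp: indicator_def)
      qed (use N a \<kappa>0 in auto)
      finally show ?thesis .
    qed
    ultimately show ?thesis by simp
  qed
  show "emeasure ?P {..real i} \<noteq> \<infinity>" for i :: nat
  proof -
    define c where "c = max 1 (real i powr (1 / a))"
    have "emeasure ?P {..real i} = (\<integral>\<^sup>+ x. ennreal (A (sgn x)) * indicator {x. norm x powr a \<le> real i} x \<partial>lborel)"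
      by (simp add: emeasure_distr emeasure_density vimage_def)
    also have "\<dots> \<le> (\<integral>\<^sup>+ x. ennreal M * indicator (cball (0::'a) c) x \<partial>lborel)"
    proof (rule nn_integral_mono, goal_cases)
      case (1 x)
      have "norm x \<le> c" if "norm x powr a \<le> real i"
      proof -
        have "norm x = (norm x powr a) powr (1 / a)" using a by (simp add: powr_powr)
        also have "\<dots> \<le> real i powr (1 / a)" using that a by (intro powr_mono2) auto
        finally show ?thesis by (simp add: c_def)
      qed
      thus ?case using A by (auto simp: indicator_def intro!: ennreal_leI)
    qed
    also have "\<dots> = ennreal M * emeasure lborel (cball (0::'a) c)" by (simp add: nn_integral_cmult_indicator)
    also have "\<dots> < \<infinity>" using emeasure_lborel_cball_finite[of "0::'a" c] by (simp add: ennreal_mult_less_top)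
    finally show ?thesis by simp
  qed
  show "\<Union> (range (\<lambda>i. {..real i})) = UNIV" by (auto simp: real_arch_simple)
  show "Int_stable (range (atMost :: real \<Rightarrow> _))" by (auto simp: Int_stable_def)
qed (auto simp: borel_eq_atMost)

text \<open>\<open>1 / N\<close> times the integral over the unit sphere, as an integral of the homogeneous extension of
  degree \<open>0\<close> over the unit ball.\<close>

definition sphere_int :: "('a::euclidean_space \<Rightarrow> real) \<Rightarrow> real" where
  "sphere_int A = (LINT x|lborel. indicator (cball 0 1) x * A (sgn x))"

lemma integrable_sphere_int:
  fixes A :: "'a::euclidean_space \<Rightarrow> real"
  assumes [measurable]: "A \<in> borel_measurable borel" and A: "\<And>x. \<bar>A (sgn x)\<bar> \<le> M"
  shows "integrable lborel (\<lambda>x. indicator (cball 0 1) x * A (sgn x))"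
proof (rule Bochner_Integration.integrable_bound)
  show "integrable lborel (\<lambda>x::'a. indicator (cball 0 1) x * M)"
    using emeasure_lborel_cball_finite[of 0 1] by (intro integrable_mult_left integrable_real_indicator) auto
qed (use A in \<open>auto simp: indicator_def abs_mult intro!: AE_I2 order_trans[OF _ abs_ge_self]\<close>)

lemma has_bochner_integral_polar_nonneg:
  fixes A :: "'a::euclidean_space \<Rightarrow> real" and g :: "real \<Rightarrow> 'b::{banach,second_countable_topology}"
  assumes a: "a > 0" and [measurable]: "A \<in> borel_measurable borel" "g \<in> borel_measurable borel"
    and A: "\<And>x. 0 \<le> A x" "\<And>x. A x \<le> M"
    and g: "has_bochner_integral lborel (\<lambda>s. (s powr (real DIM('a) / a - 1) * indicator {0..} s) *\<^sub>R g s) I"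
  shows "has_bochner_integral lborel (\<lambda>x. A (sgn x) *\<^sub>R g (norm x powr a)) ((real DIM('a) / a * sphere_int A) *\<^sub>R I)"
proof -
  have pos: "sphere_int A \<ge> 0" unfolding sphere_int_def using A by (intro Bochner_Integration.integral_nonneg) auto
  have "has_bochner_integral lborel (\<lambda>s. (real DIM('a) / a * sphere_int A) *\<^sub>R ((s powr (real DIM('a) / a - 1) * indicator {0..} s) *\<^sub>R g s)) ((real DIM('a) / a * sphere_int A) *\<^sub>R I)"
    using g by (intro has_bochner_integral_scaleR_right)
  hence "has_bochner_integral (density lborel (\<lambda>s. ennreal (real DIM('a) / a * sphere_int A * s powr (real DIM('a) / a - 1) * indicator {0..} s))) g ((real DIM('a) / a * sphere_int A) *\<^sub>R I)"
    using a pos by (subst has_bochner_integral_density) (auto simp: mult_ac)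
  also have "density lborel (\<lambda>s. ennreal (real DIM('a) / a * sphere_int A * s powr (real DIM('a) / a - 1) * indicator {0..} s)) = 
     distr (density lborel (\<lambda>x. ennreal (A (sgn x)))) borel (\<lambda>x. norm x powr a)"
    unfolding sphere_int_def by (rule distr_norm_powr_eq_density[OF a _ A, symmetric]) auto
  finally have "has_bochner_integral (density lborel (\<lambda>x. ennreal (A (sgn x)))) (\<lambda>x. g (norm x powr a)) ((real DIM('a) / a * sphere_int A) *\<^sub>R I)"
    by (subst (asm) has_bochner_integral_iff, subst has_bochner_integral_iff)
       (simp add: integrable_distr_eq integral_distr)
  thus ?thesis
    using A by (simp add: has_bochner_integral_iff integrable_density integral_density)
qed

lemma has_bochner_integral_polar:
  fixes A :: "'a::euclidean_space \<Rightarrow> real" and g :: "real \<Rightarrow> 'b::{banach,second_countable_topology}"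
  assumes a: "a > 0" and [measurable]: "A \<in> borel_measurable borel" "g \<in> borel_measurable borel"
    and A: "\<And>x. \<bar>A (sgn x)\<bar> \<le> M"
    and g: "has_bochner_integral lborel (\<lambda>s. (s powr (real DIM('a) / a - 1) * indicator {0..} s) *\<^sub>R g s) I"
  shows "has_bochner_integral lborel (\<lambda>x. A (sgn x) *\<^sub>R g (norm x powr a)) ((real DIM('a) / a * sphere_int A) *\<^sub>R I)"
proof -
  \<comment> \<open>A signed A is shifted by M. It is bounded only at the points sgn x, whereas the
    nonnegative version wants bounds everywhere; the clipping supplies them and changes nothing at
    these points.\<close>
  define B where "B = (\<lambda>x. max 0 (min (2 * M) (A x + M)))"
  have M: "M \<ge> 0" using A[of 0] by linarith
  have [measurable]: "B \<in> borel_measurable borel" unfolding B_def by measurable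
  have B: "B (sgn x) = A (sgn x) + M" for x using A[of x] by (auto simp: B_def)
  have 1: "has_bochner_integral lborel (\<lambda>x. B (sgn x) *\<^sub>R g (norm x powr a)) ((real DIM('a) / a * sphere_int B) *\<^sub>R I)"
    by (rule has_bochner_integral_polar_nonneg[OF a _ _ _ _ g, of B "2 * M"]) (auto simp: B_def M)
  have 2: "has_bochner_integral lborel (\<lambda>x::'a. M *\<^sub>R g (norm x powr a)) ((real DIM('a) / a * sphere_int (\<lambda>_::'a. M)) *\<^sub>R I)"
    by (rule has_bochner_integral_polar_nonneg[OF a _ _ _ _ g, of "\<lambda>_. M" "M"]) (auto simp: M)
  have "sphere_int B - sphere_int (\<lambda>_::'a. M) = sphere_int A"
    unfolding sphere_int_def
  proof (subst Bochner_Integration.integral_diff[symmetric])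
    show "integrable lborel (\<lambda>x::'a. indicator (cball 0 1) x * B (sgn x))"
      using A M by (intro integrable_sphere_int[where M = "2 * M"]) (auto simp: B_def)
    show "integrable lborel (\<lambda>x::'a. indicator (cball 0 1) x * M)"
      using integrable_sphere_int[of "\<lambda>_::'a. M" M] M by simp
  qed (simp add: B algebra_simps)
  hence "(real DIM('a) / a * sphere_int B) *\<^sub>R I - (real DIM('a) / a * sphere_int (\<lambda>_::'a. M)) *\<^sub>R I = (real DIM('a) / a * sphere_int A) *\<^sub>R I"
    by (simp only: scaleR_diff_left[symmetric] right_diff_distrib[symmetric])
  with has_bochner_integral_diff[OF 1 2] show ?thesis by (simp add: B scaleR_add_left)
qed

section \<open>Integrals depending holomorphically on a parameter\<close>

lemma norm_deriv_le_Cauchy: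
  fixes f :: "complex \<Rightarrow> complex"
  assumes "f holomorphic_on ball c r" "dist c s + \<rho> < r" "\<rho> > 0"
    and "\<And>w. w \<in> ball c r \<Longrightarrow> norm (f w) \<le> B"
  shows "norm (deriv f s) \<le> B / \<rho>"
proof -
  have sub: "cball s \<rho> \<subseteq> ball c r"
  proof
    fix w assume "w \<in> cball s \<rho>"
    hence "dist s w \<le> \<rho>" by simp
    thus "w \<in> ball c r" using assms(2) dist_triangle[of c w s] by simp
  qed
  have "cmod ((deriv ^^ 1) f s) \<le> fact 1 * B / \<rho> ^ 1"
  proof (rule Cauchy_inequality)
    show "f holomorphic_on ball s \<rho>" using assms(1) sub ball_subset_cball holomorphic_on_subset by blast
    show "continuous_on (cball s \<rho>) f"
      using assms(1) sub holomorphic_on_imp_continuous_on continuous_on_subset by blast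
    show "cmod (f x) \<le> B" if "cmod (s - x) = \<rho>" for x
      using that sub by (intro assms(4)) (auto simp: dist_norm)
  qed fact
  thus ?thesis by simp
qed

text \<open>A majorant of f alone suffices: Cauchy's estimate bounds the derivative by g / \<rho>
  near s, hence also the difference quotients, and dominated convergence applies along every
  sequence of increments. The derivative is measurable as a limit of such quotients.\<close>

lemma integral_holomorphic_parameter:
  fixes f :: "complex \<Rightarrow> 'b \<Rightarrow> complex"
  assumes hol: "\<And>z. z \<in> space M \<Longrightarrow> (\<lambda>s. f s z) holomorphic_on ball c r"
    and meas: "\<And>s. s \<in> ball c r \<Longrightarrow> f s \<in> borel_measurable M"
    and bound: "\<And>s z. s \<in> ball c r \<Longrightarrow> z \<in> space M \<Longrightarrow> norm (f s z) \<le> g z"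
    and g: "integrable M g" and s: "s \<in> ball c r"
  shows "((\<lambda>s. LINT z|M. f s z) has_field_derivative (LINT z|M. deriv (\<lambda>s. f s z) s)) (at s)"
    and "(\<lambda>z. deriv (\<lambda>s. f s z) s) \<in> borel_measurable M"
proof -
  \<comment> \<open>A third of the distance to the boundary: every point within \<rho> of s still
    has a closed disc of radius \<rho> inside the ball, as Cauchy's estimate requires.\<close>
  define \<rho> where "\<rho> = (r - dist c s) / 3"
  have \<rho>: "\<rho> > 0" using s by (simp add: \<rho>_def)
  have ds: "((\<lambda>s. f s z) has_field_derivative deriv (\<lambda>s. f s z) w) (at w)"
    if "z \<in> space M" "w \<in> ball c r" for z w
    using holomorphic_derivI[OF hol[OF that(1)] _ that(2)] by simp
  have near: "w \<in> ball c r" "dist c w + \<rho> < r" if "w \<in> ball s \<rho>" for w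
    using that dist_triangle[of c w s] \<rho> by (auto simp: \<rho>_def field_simps)
  have quot: "norm ((f (s + h) z - f s z) / h) \<le> g z / \<rho>"
    if "z \<in> space M" "h \<noteq> 0" "norm h < \<rho>" for h z
  proof -
    have "norm (f (s + h) z - f s z) \<le> g z / \<rho> * norm (s + h - s)"
    proof (rule field_differentiable_bound[of "ball s \<rho>" "\<lambda>s. f s z" "deriv (\<lambda>s. f s z)" "g z / \<rho>"])
      fix w assume w: "w \<in> ball s \<rho>"
      show "((\<lambda>s. f s z) has_field_derivative deriv (\<lambda>s. f s z) w) (at w within ball s \<rho>)"
        by (rule has_field_derivative_at_within[OF ds[OF that(1) near(1)[OF w]]])
      show "norm (deriv (\<lambda>s. f s z) w) \<le> g z / \<rho>"
        by (rule norm_deriv_le_Cauchy[OF hol[OF that(1)] near(2)[OF w] \<rho> bound[OF _ that(1)]])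
    qed (use that \<rho> in \<open>auto simp: dist_norm\<close>)
    thus ?thesis using that \<rho> by (simp add: norm_divide field_simps)
  qed
  have key: "(\<lambda>z. deriv (\<lambda>s. f s z) s) \<in> borel_measurable M \<and> 
      (\<lambda>n. LINT z|M. (f (s + X n) z - f s z) / X n) \<longlonglongrightarrow> (LINT z|M. deriv (\<lambda>s. f s z) s)"
    if X: "X \<longlonglongrightarrow> 0" "\<And>n. X n \<noteq> 0" "\<And>n. norm (X n) < \<rho>" for X
  proof -
    have lim: "(\<lambda>n. (f (s + X n) z - f s z) / X n) \<longlonglongrightarrow> deriv (\<lambda>s. f s z) s" if "z \<in> space M" for z
    proof -
      have "((\<lambda>h. (f (s + h) z - f s z) / h) \<longlongrightarrow> deriv (\<lambda>s. f s z) s) (at 0)"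
        using ds[OF that s] by (simp add: DERIV_def)
      moreover have "filterlim X (at 0) sequentially"
        using X by (auto simp: filterlim_at)
      ultimately show ?thesis by (rule filterlim_compose)
    qed
    have ball: "s + X n \<in> ball c r" for n using near[of "s + X n"] X(3)[of n] by (simp add: dist_norm)
    have meas': "(\<lambda>z. (f (s + X n) z - f s z) / X n) \<in> borel_measurable M" for n
      using meas[OF ball[of n]] meas[OF s] by measurable
    have md: "(\<lambda>z. deriv (\<lambda>s. f s z) s) \<in> borel_measurable M"
      by (rule borel_measurable_LIMSEQ_metric[OF meas' lim])
    moreover have "(\<lambda>n. LINT z|M. (f (s + X n) z - f s z) / X n) \<longlonglongrightarrow> (LINT z|M. deriv (\<lambda>s. f s z) s)"
    proof (rule integral_dominated_convergence[where w = "\<lambda>z. g z / \<rho>"])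
      show "integrable M (\<lambda>z. g z / \<rho>)" using g by simp
      show "AE z in M. (\<lambda>n. (f (s + X n) z - f s z) / X n) \<longlonglongrightarrow> deriv (\<lambda>s. f s z) s"
        by (rule AE_I2) (rule lim)
      show "AE z in M. norm ((f (s + X n) z - f s z) / X n) \<le> g z / \<rho>" for n
        by (rule AE_I2) (rule quot[OF _ X(2,3)])
    qed (fact md meas')+
    ultimately show ?thesis by blast
  qed
  show "(\<lambda>z. deriv (\<lambda>s. f s z) s) \<in> borel_measurable M"
  proof -
    have "(\<lambda>n. of_real (\<rho> / 2 / real (Suc n)) :: complex) \<longlonglongrightarrow> of_real 0"
      by (intro tendsto_of_real) real_asymp
    moreover have "norm (of_real (\<rho> / 2 / real (Suc n)) :: complex) < \<rho>" for n
    proof -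
      have "\<rho> / 2 / real (Suc n) \<le> \<rho> / 2 / 1" using \<rho> by (intro divide_left_mono) auto
      also have "\<dots> < \<rho>" using \<rho> by simp
      finally show ?thesis using \<rho> by (simp only: norm_of_real) simp
    qed
    moreover have "(of_real (\<rho> / 2 / real (Suc n)) :: complex) \<noteq> 0" for n
      using \<rho> by (simp only: of_real_eq_0_iff) simp
    ultimately show ?thesis
      using key[of "\<lambda>n. of_real (\<rho> / 2 / real (Suc n))"] by (simp only: of_real_0 simp_thms)
  qed
  have intf: "integrable M (f w)" if "w \<in> ball c r" for w
    by (rule Bochner_Integration.integrable_bound[OF g meas[OF that]])
       (use bound[OF that] in \<open>auto intro!: AE_I2 order_trans[OF _ abs_ge_self]\<close>)
  show "((\<lambda>s. LINT z|M. f s z) has_field_derivative (LINT z|M. deriv (\<lambda>s. f s z) s)) (at s)"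
    unfolding DERIV_def tendsto_at_iff_sequentially
  proof (intro allI impI)
    fix X :: "nat \<Rightarrow> complex" assume X0: "\<forall>i. X i \<in> UNIV - {0}" and Xl: "X \<longlonglongrightarrow> 0"
    obtain n0 where n0: "\<And>n. n \<ge> n0 \<Longrightarrow> norm (X n) < \<rho>"
      using LIMSEQ_D[OF Xl \<rho>] by auto
    have "(\<lambda>n. LINT z|M. (f (s + X (n + n0)) z - f s z) / X (n + n0)) \<longlonglongrightarrow> (LINT z|M. deriv (\<lambda>s. f s z) s)"
    proof (rule conjunct2[OF key])
      show "(\<lambda>n. X (n + n0)) \<longlonglongrightarrow> 0" by (rule LIMSEQ_ignore_initial_segment[OF Xl])
    qed (use X0 n0 in auto)
    also have "(\<lambda>n. LINT z|M. (f (s + X (n + n0)) z - f s z) / X (n + n0)) =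
       (\<lambda>n. ((LINT z|M. f (s + X (n + n0)) z) - (LINT z|M. f s z)) / X (n + n0))"
    proof
      fix n
      have "s + X (n + n0) \<in> ball c r" using near[of "s + X (n + n0)"] n0[of "n + n0"] by (simp add: dist_norm)
      note b = this
      show "(LINT z|M. (f (s + X (n + n0)) z - f s z) / X (n + n0)) =
        ((LINT z|M. f (s + X (n + n0)) z) - (LINT z|M. f s z)) / X (n + n0)"
        using Bochner_Integration.integral_diff[OF intf[OF b] intf[OF s]] by simp
    qed
    finally show "((\<lambda>h. ((LINT z|M. f (s + h) z) - (LINT z|M. f s z)) / h) \<circ> X) \<longlonglongrightarrow> (LINT z|M. deriv (\<lambda>s. f s z) s)"
      unfolding comp_def by (rule LIMSEQ_offset)
  qed
qed

text \<open>On the ball of half the radius Cauchy's estimate dominates the derivative by g / (r /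
  2), so the first-order lemma applies to the derivative in place of f.\<close>

lemma integral_holomorphic_parameter_second:
  fixes f :: "complex \<Rightarrow> 'b \<Rightarrow> complex"
  assumes r: "r > 0" and hol: "\<And>z. z \<in> space M \<Longrightarrow> (\<lambda>s. f s z) holomorphic_on ball c r"
    and meas: "\<And>s. s \<in> ball c r \<Longrightarrow> f s \<in> borel_measurable M"
    and bound: "\<And>s z. s \<in> ball c r \<Longrightarrow> z \<in> space M \<Longrightarrow> norm (f s z) \<le> g z"
    and g: "integrable M g"
  shows "((\<lambda>s. LINT z|M. deriv (\<lambda>s. f s z) s) has_field_derivative (LINT z|M. (deriv ^^ 2) (\<lambda>s. f s z) c)) (at c)"
    and "integrable M (\<lambda>z. (deriv ^^ 2) (\<lambda>s. f s z) c)"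
proof -
  let ?f = "\<lambda>s z. deriv (\<lambda>s. f s z) s"
  have hol': "(\<lambda>s. ?f s z) holomorphic_on ball c (r / 2)" if "z \<in> space M" for z
    using r by (intro holomorphic_deriv holomorphic_on_subset[OF hol[OF that]]) auto
  have meas': "?f s \<in> borel_measurable M" if "s \<in> ball c (r / 2)" for s
    by (rule integral_holomorphic_parameter(2)[where f = f, OF hol meas bound g]) (use that r in auto)
  have bound': "norm (?f s z) \<le> g z / (r / 2)" if "s \<in> ball c (r / 2)" "z \<in> space M" for s z
    by (rule norm_deriv_le_Cauchy[OF hol[OF that(2)] _ _ bound[OF _ that(2)]]) (use that r in auto)
  have g': "integrable M (\<lambda>z. g z / (r / 2))" using g by simp
  have d2: "(deriv ^^ 2) h c = deriv (\<lambda>s. deriv h s) c" for h :: "complex \<Rightarrow> complex"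
    by (simp add: numeral_2_eq_2)
  show "((\<lambda>s. LINT z|M. deriv (\<lambda>s. f s z) s) has_field_derivative (LINT z|M. (deriv ^^ 2) (\<lambda>s. f s z) c)) (at c)"
    unfolding d2 by (rule integral_holomorphic_parameter(1)[where f = ?f and r = "r / 2", OF hol' meas' bound' g']) (use r in auto)
  have m1: "(\<lambda>z. deriv (\<lambda>s. ?f s z) c) \<in> borel_measurable M"
    by (rule integral_holomorphic_parameter(2)[where f = ?f and r = "r / 2", OF hol' meas' bound' g']) (use r in auto)
  have m2: "norm (deriv (\<lambda>s. ?f s z) c) \<le> \<bar>g z / (r / 2) / (r / 4)\<bar>" if "z \<in> space M" for z
    by (rule order_trans[OF norm_deriv_le_Cauchy[OF hol'[OF that] _ _ bound'[OF _ that], where \<rho> = "r / 4"] abs_ge_self])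
       (use r in auto)
  have m3: "integrable M (\<lambda>z. g z / (r / 2) / (r / 4))" using g by simp
  show "integrable M (\<lambda>z. (deriv ^^ 2) (\<lambda>s. f s z) c)"
    unfolding d2
    by (rule Bochner_Integration.integrable_bound[OF m3 m1 AE_I2]) (simp only: real_norm_def m2)
qed

lemma integrable_deriv_parameter:
  fixes f :: "complex \<Rightarrow> 'b \<Rightarrow> complex"
  assumes r: "r > 0" and hol: "\<And>z. z \<in> space M \<Longrightarrow> (\<lambda>s. f s z) holomorphic_on ball c r"
    and meas: "\<And>s. s \<in> ball c r \<Longrightarrow> f s \<in> borel_measurable M"
    and bound: "\<And>s z. s \<in> ball c r \<Longrightarrow> z \<in> space M \<Longrightarrow> norm (f s z) \<le> g z"
    and g: "integrable M g"
  shows "integrable M (\<lambda>z. deriv (\<lambda>s. f s z) c)"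
proof -
  have m1: "(\<lambda>z. deriv (\<lambda>s. f s z) c) \<in> borel_measurable M"
    by (rule integral_holomorphic_parameter(2)[where f = f, OF hol meas bound g]) (use r in auto)
  have m2: "norm (deriv (\<lambda>s. f s z) c) \<le> \<bar>g z / (r / 2)\<bar>" if "z \<in> space M" for z
    by (rule order_trans[OF norm_deriv_le_Cauchy[OF hol[OF that] _ _ bound[OF _ that], where \<rho> = "r / 2"] abs_ge_self])
       (use r in auto)
  have m3: "integrable M (\<lambda>z. g z / (r / 2))" using g by simp
  show ?thesis
    by (rule Bochner_Integration.integrable_bound[OF m3 m1 AE_I2]) (simp only: real_norm_def m2)
qed

section \<open>Gaussian moments\<close>

lemma has_bochner_integral_Gamma:
  fixes x \<kappa> :: real
  assumes "x > 0" "\<kappa> > 0"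
  shows "has_bochner_integral lborel (\<lambda>s. s powr (x - 1) * indicator {0..} s * exp (- \<kappa> * s)) (Gamma x / \<kappa> powr x)"
proof -
  let ?f = "\<lambda>t. t powr (x - 1) * indicator {0..} t * exp (- t)"
  have "((\<lambda>t. t powr (x - 1) / exp t) has_integral Gamma x) {0..}"
    by (rule Gamma_integral_real) fact
  hence "((\<lambda>t. if t \<in> {0..} then t powr (x - 1) / exp t else 0) has_integral Gamma x) UNIV"
    by (subst has_integral_restrict_UNIV)
  hence "(?f has_integral Gamma x) UNIV"
    by (rule has_integral_eq[rotated]) (auto simp: indicator_def exp_minus field_simps)
  hence "integral\<^sup>N lborel (\<lambda>t. ennreal (?f t)) = ennreal (Gamma x)"
    by (intro nn_integral_has_integral_lborel) auto
  hence "has_bochner_integral lborel ?f (Gamma x)"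
    using assms by (intro has_bochner_integral_nn_integral) (auto intro: less_imp_le Gamma_real_pos)
  hence "has_bochner_integral lborel (\<lambda>s. ?f (0 + \<kappa> * s)) (Gamma x /\<^sub>R \<bar>\<kappa>\<bar>)"
    using assms by (subst (asm) lborel_has_bochner_integral_real_affine_iff[of \<kappa> _ _ 0]) auto
  hence "has_bochner_integral lborel (\<lambda>s. \<kappa> powr (1 - x) * ?f (0 + \<kappa> * s)) (\<kappa> powr (1 - x) * (Gamma x /\<^sub>R \<bar>\<kappa>\<bar>))"
    by (rule has_bochner_integral_mult_right)
  also have "(\<lambda>s. \<kappa> powr (1 - x) * ?f (0 + \<kappa> * s)) = (\<lambda>s. s powr (x - 1) * indicator {0..} s * exp (- \<kappa> * s))"
  proof
    fix s show "\<kappa> powr (1 - x) * ?f (0 + \<kappa> * s) = s powr (x - 1) * indicator {0..} s * exp (- \<kappa> * s)"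
    proof (cases "s \<ge> 0")
      case True
      have "\<kappa> powr (1 - x) * \<kappa> powr (x - 1) = 1" using assms by (simp flip: powr_add)
      thus ?thesis using True assms by (simp add: powr_mult)
    next
      case False
      hence "\<not> 0 \<le> \<kappa> * s" using assms by (simp add: zero_le_mult_iff)
      with False show ?thesis by simp
    qed
  qed
  also have "\<kappa> powr (1 - x) * (Gamma x /\<^sub>R \<bar>\<kappa>\<bar>) = Gamma x / \<kappa> powr x"
    using assms by (simp add: powr_diff field_simps)
  finally show ?thesis .
qed

lemma has_bochner_integral_norm_powr_exp:
  fixes a p \<kappa> :: real and A :: "'a::euclidean_space \<Rightarrow> real"
  assumes a: "a > 0" and p: "p > - real DIM('a)" and \<kappa>: "\<kappa> > 0"
    and [measurable]: "A \<in> borel_measurable borel" and A: "\<And>x. \<bar>A (sgn x)\<bar> \<le> M"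
  shows "has_bochner_integral lborel (\<lambda>x. A (sgn x) * (norm x powr p * exp (- \<kappa> * norm x powr a)))
    (real DIM('a) / a * sphere_int A * (Gamma ((real DIM('a) + p) / a) / \<kappa> powr ((real DIM('a) + p) / a)))"
proof -
  let ?x = "(real DIM('a) + p) / a"
  have "has_bochner_integral lborel (\<lambda>s. s powr (?x - 1) * indicator {0..} s * exp (- \<kappa> * s)) (Gamma ?x / \<kappa> powr ?x)"
    using assms by (intro has_bochner_integral_Gamma) auto
  also have "(\<lambda>s. s powr (?x - 1) * indicator {0..} s * exp (- \<kappa> * s)) =
    (\<lambda>s. (s powr (real DIM('a) / a - 1) * indicator {0..} s) *\<^sub>R (s powr (p / a) * exp (- \<kappa> * s)))"
    by (simp add: fun_eq_iff powr_add[symmetric] field_simps add_divide_distrib)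
  finally have "has_bochner_integral lborel (\<lambda>x::'a. A (sgn x) *\<^sub>R ((norm x powr a) powr (p / a) * exp (- \<kappa> * (norm x powr a))))
    ((real DIM('a) / a * sphere_int A) *\<^sub>R (Gamma ?x / \<kappa> powr ?x))"
    by (intro has_bochner_integral_polar[where M = M and A = A and g = "\<lambda>s. s powr (p / a) * exp (- \<kappa> * s)"]) (use a A in auto)
  thus ?thesis using a by (simp add: powr_powr)
qed

lemma integrable_norm_powr_exp:
  assumes "a > 0" "p > - real DIM('a::euclidean_space)" "\<kappa> > 0"
  shows "integrable lborel (\<lambda>x::'a. norm x powr p * exp (- \<kappa> * norm x powr a))"
  using has_bochner_integral_norm_powr_exp[OF assms, of "\<lambda>_. 1" 1]
  by (auto simp: has_bochner_integral_iff)

text \<open>With \<rho> = r powr a, half of \<kappa> \<rho> absorbs each factor: completing the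
  square gives C sqrt \<rho> \<le> \<kappa> / 2 \<rho> + C^2 / (2 \<kappa>), and for r > 1 one has
  r^k \<le> \<rho>^n for n \<ge> k / a, which a single term of the exponential series
  dominates.\<close>

lemma power_exp_sqrt_le_exp:
  fixes a C \<kappa> :: real
  assumes "a > 0" "\<kappa> > 0"
  obtains K where "K > 0" "\<And>r. r \<ge> 0 \<Longrightarrow> (1 + r) ^ k * exp (C * r powr (a / 2)) \<le> K * exp (\<kappa> * r powr a)"
proof -
  obtain n :: nat where n: "real n \<ge> real k / a" using real_arch_simple by blast
  define c where "c = \<kappa> / 2"
  have c: "c > 0" using assms by (simp add: c_def)
  define K where "K = 2 ^ k * (1 + fact n / c ^ n) * exp (C\<^sup>2 / (2 * \<kappa>))"
  have "K > 0" unfolding K_def using c by (intro mult_pos_pos add_pos_pos) auto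
  moreover have "(1 + r) ^ k * exp (C * r powr (a / 2)) \<le> K * exp (\<kappa> * r powr a)" if r: "r \<ge> 0" for r
  proof -
    define \<rho> where "\<rho> = r powr a"
    have \<rho>: "\<rho> \<ge> 0" by (simp add: \<rho>_def)
    have sq: "(r powr (a / 2))\<^sup>2 = \<rho>"
      by (simp add: \<rho>_def power2_eq_square flip: powr_add)
    have e1: "C * r powr (a / 2) \<le> c * \<rho> + C\<^sup>2 / (2 * \<kappa>)"
    proof -
      have "0 \<le> (\<kappa> * r powr (a / 2) - C)\<^sup>2" by simp
      also have "\<dots> = \<kappa>\<^sup>2 * \<rho> - 2 * \<kappa> * (C * r powr (a / 2)) + C\<^sup>2"
        by (simp add: power2_diff power_mult_distrib sq mult_ac)
      finally have "2 * \<kappa> * (C * r powr (a / 2)) \<le> \<kappa>\<^sup>2 * \<rho> + C\<^sup>2" by simp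
      also have "\<dots> = 2 * \<kappa> * (c * \<rho> + C\<^sup>2 / (2 * \<kappa>))"
        using assms by (simp add: c_def power2_eq_square field_simps)
      finally show ?thesis using assms by simp
    qed
    have e2: "(1 + r) ^ k \<le> 2 ^ k * (1 + fact n / c ^ n) * exp (c * \<rho>)"
    proof (cases "r \<le> 1")
      case True
      have "(1 + r) ^ k \<le> 2 ^ k * 1 * 1" using r True by (simp add: power_mono)
      also have "\<dots> \<le> 2 ^ k * (1 + fact n / c ^ n) * exp (c * \<rho>)"
        using c \<rho> by (intro mult_mono) auto
      finally show ?thesis .
    next
      case False
      have "r ^ k = \<rho> powr (real k / a)"
        using False assms by (simp add: \<rho>_def powr_powr powr_realpow)
      also have "\<dots> \<le> \<rho> powr real n"
        using False n assms by (intro powr_mono) (auto simp: \<rho>_def ge_one_powr_ge_zero)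
      also have "\<dots> = \<rho> ^ n" using False by (intro powr_realpow) (auto simp: \<rho>_def)
      also have "\<dots> = fact n / c ^ n * ((c * \<rho>) ^ n / fact n)"
        using c by (simp add: power_mult_distrib)
      also have "\<dots> \<le> fact n / c ^ n * exp (c * \<rho>)"
      proof (rule mult_left_mono)
        show "(c * \<rho>) ^ n / fact n \<le> exp (c * \<rho>)"
        proof -
          have "(\<Sum>i\<in>{n}. (c * \<rho>) ^ i /\<^sub>R fact i) \<le> exp (c * \<rho>)"
            unfolding exp_def using c \<rho> by (intro sum_le_suminf summable_exp_generic) auto
          thus ?thesis by (simp add: divide_inverse mult.commute)
        qed
      qed (use c in auto)
      also have "\<dots> \<le> (1 + fact n / c ^ n) * exp (c * \<rho>)" by (intro mult_right_mono) auto
      finally have rk: "r ^ k \<le> (1 + fact n / c ^ n) * exp (c * \<rho>)" .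
      have "(1 + r) ^ k \<le> (2 * r) ^ k" using False by (intro power_mono) auto
      also have "\<dots> = 2 ^ k * r ^ k" by (simp add: power_mult_distrib)
      also have "\<dots> \<le> 2 ^ k * ((1 + fact n / c ^ n) * exp (c * \<rho>))" using rk by simp
      finally show ?thesis by (simp add: mult_ac)
    qed
    have "(1 + r) ^ k * exp (C * r powr (a / 2)) \<le> (2 ^ k * (1 + fact n / c ^ n) * exp (c * \<rho>)) * exp (c * \<rho> + C\<^sup>2 / (2 * \<kappa>))"
      using e1 e2 c by (intro mult_mono) auto
    also have "\<dots> = 2 ^ k * (1 + fact n / c ^ n) * exp (C\<^sup>2 / (2 * \<kappa>)) * (exp (c * \<rho>) * exp (c * \<rho>))"
      by (simp only: exp_add mult_ac)
    also have "exp (c * \<rho>) * exp (c * \<rho>) = exp (\<kappa> * r powr a)"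
      by (simp add: c_def \<rho>_def flip: exp_add)
    finally show ?thesis by (simp add: K_def)
  qed
  ultimately show ?thesis by (rule that)
qed

lemma integrable_norm_powr_growth:
  fixes a p C \<kappa> :: real
  assumes "a > 0" "p > - real DIM('a::euclidean_space)" "\<kappa> > 0"
  shows "integrable lborel (\<lambda>x::'a. norm x powr p * ((1 + norm x) ^ k * exp (C * norm x powr (a / 2)) * exp (- \<kappa> * norm x powr a)))"
proof -
  obtain K where K: "K > 0" "\<And>r. r \<ge> 0 \<Longrightarrow> (1 + r) ^ k * exp (C * r powr (a / 2)) \<le> K * exp (\<kappa> / 2 * r powr a)"
    using power_exp_sqrt_le_exp[of a "\<kappa> / 2" k C] assms by auto
  have "integrable lborel (\<lambda>x::'a. K * (norm x powr p * exp (- (\<kappa> / 2) * norm x powr a)))"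
    using assms by (intro integrable_mult_right integrable_norm_powr_exp) auto
  thus ?thesis
  proof (rule Bochner_Integration.integrable_bound)
    show "AE x::'a in lborel. norm (norm x powr p * ((1 + norm x) ^ k * exp (C * norm x powr (a / 2)) * exp (- \<kappa> * norm x powr a))) \<le>
       norm (K * (norm x powr p * exp (- (\<kappa> / 2) * norm x powr a)))"
    proof (rule AE_I2)
      fix x :: 'a
      have e: "exp (- \<kappa> * norm x powr a) = exp (- (\<kappa> / 2) * norm x powr a) * exp (- (\<kappa> / 2) * norm x powr a)"
        by (simp flip: exp_add)
      have "norm x powr p * ((1 + norm x) ^ k * exp (C * norm x powr (a / 2)) * exp (- \<kappa> * norm x powr a)) \<le>
        norm x powr p * (K * exp (\<kappa> / 2 * norm x powr a) * exp (- \<kappa> * norm x powr a))"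
        by (intro mult_left_mono mult_right_mono K) auto
      also have "norm x powr p * (K * exp (\<kappa> / 2 * norm x powr a) * exp (- \<kappa> * norm x powr a)) =
        K * (norm x powr p * exp (- (\<kappa> / 2) * norm x powr a)) * (exp (\<kappa> / 2 * norm x powr a) * exp (- (\<kappa> / 2) * norm x powr a))"
        by (simp only: e mult_ac)
      also have "exp (\<kappa> / 2 * norm x powr a) * exp (- (\<kappa> / 2) * norm x powr a) = 1"
        by (simp flip: exp_add)
      finally show "norm (norm x powr p * ((1 + norm x) ^ k * exp (C * norm x powr (a / 2)) * exp (- \<kappa> * norm x powr a))) \<le>
         norm (K * (norm x powr p * exp (- (\<kappa> / 2) * norm x powr a)))"
        using K(1) by (simp add: abs_mult)
    qed
  qed measurable
qed

text \<open>The factor exp (norm x) leaves room for a Gaussian translated by a complex multiple s of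
  a unit vector with |s| < 1.\<close>

lemma integrable_gauss_growth:
  "integrable lborel (\<lambda>x::'a::euclidean_space. (1 + norm x) ^ k * exp (norm x - (norm x)\<^sup>2 / 2))"
proof -
  have "integrable lborel (\<lambda>x::'a. norm x powr 0 * ((1 + norm x) ^ k * exp (1 * norm x powr (2 / 2)) * exp (- (1 / 2) * norm x powr 2)))"
    by (rule integrable_norm_powr_growth) auto
  thus ?thesis
  proof (rule integrable_cong_AE_imp)
    have "AE x in lborel. (x::'a) \<noteq> 0" by (rule AE_lborel_singleton)
    thus "AE x::'a in lborel. norm x powr 0 * ((1 + norm x) ^ k * exp (1 * norm x powr (2 / 2)) * exp (- (1 / 2) * norm x powr 2)) =
       (1 + norm x) ^ k * exp (norm x - (norm x)\<^sup>2 / 2)"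
      by eventually_elim (simp add: powr_numeral mult.assoc flip: exp_add)
  qed measurable
qed

lemma integrable_gauss_moment:
  fixes \<omega> \<mu> :: "'a::euclidean_space"
  assumes "norm \<omega> = 1" "norm \<mu> = 1"
  shows "integrable lborel (\<lambda>\<xi>. (\<omega> \<bullet> \<xi>) ^ j * (\<mu> \<bullet> \<xi>) ^ k * exp (- (norm \<xi>)\<^sup>2 / 2))"
proof (rule Bochner_Integration.integrable_bound[OF integrable_gauss_growth[of "j + k"]])
  show "AE \<xi> in lborel. norm ((\<omega> \<bullet> \<xi>) ^ j * (\<mu> \<bullet> \<xi>) ^ k * exp (- (norm \<xi>)\<^sup>2 / 2)) \<le>
     norm ((1 + norm \<xi>) ^ (j + k) * exp (norm \<xi> - (norm \<xi>)\<^sup>2 / 2))"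
  proof (rule AE_I2)
    fix \<xi> :: 'a
    have u: "\<bar>\<omega> \<bullet> \<xi>\<bar> \<le> 1 + norm \<xi>" "\<bar>\<mu> \<bullet> \<xi>\<bar> \<le> 1 + norm \<xi>"
      using Cauchy_Schwarz_ineq2[of \<omega> \<xi>] Cauchy_Schwarz_ineq2[of \<mu> \<xi>] assms by auto
    have "\<bar>\<omega> \<bullet> \<xi>\<bar> ^ j * \<bar>\<mu> \<bullet> \<xi>\<bar> ^ k * exp (- (norm \<xi>)\<^sup>2 / 2) \<le>
      (1 + norm \<xi>) ^ j * (1 + norm \<xi>) ^ k * exp (norm \<xi> - (norm \<xi>)\<^sup>2 / 2)"
      by (intro mult_mono power_mono u) auto
    thus "norm ((\<omega> \<bullet> \<xi>) ^ j * (\<mu> \<bullet> \<xi>) ^ k * exp (- (norm \<xi>)\<^sup>2 / 2)) \<le>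
     norm ((1 + norm \<xi>) ^ (j + k) * exp (norm \<xi> - (norm \<xi>)\<^sup>2 / 2))"
      by (simp add: abs_mult power_abs power_add)
  qed
qed measurable

definition gauss_moment :: "'a::euclidean_space \<Rightarrow> 'a \<Rightarrow> nat \<Rightarrow> nat \<Rightarrow> real" where
  "gauss_moment \<omega> \<mu> j k = (LINT \<xi>|lborel. (\<omega> \<bullet> \<xi>) ^ j * (\<mu> \<bullet> \<xi>) ^ k * exp (- (norm \<xi>)\<^sup>2 / 2))"

lemma gauss_moment_commute: "gauss_moment \<omega> \<mu> j k = gauss_moment \<mu> \<omega> k j"
  by (simp add: gauss_moment_def mult_ac)

text \<open>Integration by parts against the Gaussian, obtained by differentiating the translation
  invariance of Lebesgue measure.\<close>

lemma gauss_moment_Suc: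
  fixes \<omega> \<mu> :: "'a::euclidean_space"
  assumes \<omega>: "norm \<omega> = 1" and \<mu>: "norm \<mu> = 1"
  shows "gauss_moment \<omega> \<mu> (Suc j) k =
    real j * gauss_moment \<omega> \<mu> (j - 1) k + real k * (\<omega> \<bullet> \<mu>) * gauss_moment \<omega> \<mu> j (k - 1)"
proof -
  define t where "t = \<omega> \<bullet> \<mu>"
  have t: "\<bar>t\<bar> \<le> 1" using Cauchy_Schwarz_ineq2[of \<omega> \<mu>] assms by (simp add: t_def)
  \<comment> \<open>For real s this is the moment integrand at \<xi> + s \<omega>. As |\<omega>| =
    1, the square of the norm is the polynomial |\<xi>|^2 + 2 s (\<omega> \<bullet> \<xi>) + s^2, so
    f is entire in s.\<close>
  define f :: "complex \<Rightarrow> 'a \<Rightarrow> complex" where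
    "f = (\<lambda>s \<xi>. (of_real (\<omega> \<bullet> \<xi>) + s) ^ j * (of_real (\<mu> \<bullet> \<xi>) + s * of_real t) ^ k *
       exp (- ((of_real ((norm \<xi>)\<^sup>2) + 2 * s * of_real (\<omega> \<bullet> \<xi>) + s\<^sup>2) / 2)))"
  define g :: "'a \<Rightarrow> real" where
    "g = (\<lambda>\<xi>. exp (1 / 2) * ((1 + norm \<xi>) ^ (j + k) * exp (norm \<xi> - (norm \<xi>)\<^sup>2 / 2)))"
  have g: "integrable lborel g"
    unfolding g_def by (intro integrable_mult_right integrable_gauss_growth)
  have bound: "norm (f s \<xi>) \<le> g \<xi>" if s: "s \<in> ball 0 1" for s \<xi>
  proof -
    have s': "norm s \<le> 1" using s by simp
    have u: "\<bar>\<omega> \<bullet> \<xi>\<bar> \<le> norm \<xi>" "\<bar>\<mu> \<bullet> \<xi>\<bar> \<le> norm \<xi>"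
      using Cauchy_Schwarz_ineq2[of \<omega> \<xi>] Cauchy_Schwarz_ineq2[of \<mu> \<xi>] assms by auto
    have "norm (f s \<xi>) = norm (of_real (\<omega> \<bullet> \<xi>) + s) ^ j * norm (of_real (\<mu> \<bullet> \<xi>) + s * of_real t) ^ k *
       exp (Re (- ((of_real ((norm \<xi>)\<^sup>2) + 2 * s * of_real (\<omega> \<bullet> \<xi>) + s\<^sup>2) / 2)))"
      by (simp only: f_def norm_mult norm_power norm_exp_eq_Re)
    also have "\<dots> \<le> (1 + norm \<xi>) ^ j * (1 + norm \<xi>) ^ k * exp (1 / 2 + norm \<xi> - (norm \<xi>)\<^sup>2 / 2)"
    proof (intro mult_mono power_mono)
      show "norm (of_real (\<omega> \<bullet> \<xi>) + s) \<le> 1 + norm \<xi>"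
        using norm_triangle_ineq[of "of_real (\<omega> \<bullet> \<xi>)" s] u s' by simp
      have "norm (s * of_real t) \<le> 1" using s' t by (simp add: norm_mult mult_le_one)
      thus "norm (of_real (\<mu> \<bullet> \<xi>) + s * of_real t) \<le> 1 + norm \<xi>"
        using norm_triangle_ineq[of "of_real (\<mu> \<bullet> \<xi>)" "s * of_real t"] u by simp
      have "- Re (s\<^sup>2) \<le> norm (s\<^sup>2)" using abs_Re_le_cmod[of "s\<^sup>2"] by linarith
      also have "\<dots> \<le> 1" using s' by (simp add: norm_power power_le_one)
      finally have 1: "- Re (s\<^sup>2) \<le> 1" .
      have "\<bar>Re s * (\<omega> \<bullet> \<xi>)\<bar> \<le> 1 * norm \<xi>"
        unfolding abs_mult using s' u abs_Re_le_cmod[of s] by (intro mult_mono) auto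
      hence 2: "- (Re s * (\<omega> \<bullet> \<xi>)) \<le> norm \<xi>" by linarith
      have "Re (- ((of_real ((norm \<xi>)\<^sup>2) + 2 * s * of_real (\<omega> \<bullet> \<xi>) + s\<^sup>2) / 2)) =
         - ((norm \<xi>)\<^sup>2 / 2) - Re s * (\<omega> \<bullet> \<xi>) - Re (s\<^sup>2) / 2"
        by (simp add: add_divide_distrib)
      with 1 2 show "exp (Re (- ((of_real ((norm \<xi>)\<^sup>2) + 2 * s * of_real (\<omega> \<bullet> \<xi>) + s\<^sup>2) / 2))) \<le> exp (1 / 2 + norm \<xi> - (norm \<xi>)\<^sup>2 / 2)"
        by simp
    qed auto
    also have "exp (1 / 2 + norm \<xi> - (norm \<xi>)\<^sup>2 / 2) = exp (1 / 2) * exp (norm \<xi> - (norm \<xi>)\<^sup>2 / 2)"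
      by (simp flip: exp_add)
    also have "(1 + norm \<xi>) ^ j * (1 + norm \<xi>) ^ k * (exp (1 / 2) * exp (norm \<xi> - (norm \<xi>)\<^sup>2 / 2)) = g \<xi>"
      by (simp add: g_def power_add)
    finally show ?thesis .
  qed
  have hol: "(\<lambda>s. f s \<xi>) holomorphic_on ball 0 1" for \<xi>
    unfolding f_def by (intro holomorphic_intros) auto
  have meas: "f s \<in> borel_measurable lborel" for s
    unfolding f_def by measurable
  have deriv: "deriv (\<lambda>s. f s \<xi>) 0 = of_real
      (real j * ((\<omega> \<bullet> \<xi>) ^ (j - 1) * (\<mu> \<bullet> \<xi>) ^ k * exp (- (norm \<xi>)\<^sup>2 / 2)) +
       real k * t * ((\<omega> \<bullet> \<xi>) ^ j * (\<mu> \<bullet> \<xi>) ^ (k - 1) * exp (- (norm \<xi>)\<^sup>2 / 2)) -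
       (\<omega> \<bullet> \<xi>) ^ Suc j * (\<mu> \<bullet> \<xi>) ^ k * exp (- (norm \<xi>)\<^sup>2 / 2))" for \<xi>
  proof -
    define U V T E :: complex where "U = of_real (\<omega> \<bullet> \<xi>)" and "V = of_real (\<mu> \<bullet> \<xi>)" and "T = of_real t"
      and "E = of_real (exp (- (norm \<xi>)\<^sup>2 / 2))"
    have E: "E = exp (- (of_real ((norm \<xi>)\<^sup>2) / 2))"
      by (simp add: E_def flip: exp_of_real)
    have "((\<lambda>s. f s \<xi>) has_field_derivative
      (of_nat j * U ^ (j - 1)) * V ^ k * E + U ^ j * (of_nat k * V ^ (k - 1) * T) * E + U ^ j * V ^ k * (E * (- U))) (at 0)"
      unfolding f_def U_def[symmetric] V_def[symmetric] T_def[symmetric] E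
      by (auto intro!: derivative_eq_intros simp: algebra_simps)
    hence "deriv (\<lambda>s. f s \<xi>) 0 = (of_nat j * U ^ (j - 1)) * V ^ k * E + U ^ j * (of_nat k * V ^ (k - 1) * T) * E + U ^ j * V ^ k * (E * (- U))"
      by (rule DERIV_imp_deriv)
    thus ?thesis by (simp add: U_def V_def T_def E_def algebra_simps)
  qed
  have const: "(LINT \<xi>|lborel. f (of_real s) \<xi>) = (LINT \<xi>|lborel. f 0 \<xi>)" for s :: real
  proof -
    have "f (of_real s) \<xi> = f 0 (s *\<^sub>R \<omega> + \<xi>)" for \<xi>
    proof -
      have "(norm (s *\<^sub>R \<omega> + \<xi>))\<^sup>2 = (norm \<xi>)\<^sup>2 + 2 * s * (\<omega> \<bullet> \<xi>) + s\<^sup>2"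
        using \<omega> by (simp add: power2_norm_eq_inner inner_add inner_commute algebra_simps power2_eq_square[of s] flip: norm_eq_1)
      moreover have "\<omega> \<bullet> (s *\<^sub>R \<omega> + \<xi>) = \<omega> \<bullet> \<xi> + s" using \<omega> by (simp add: inner_add norm_eq_1)
      moreover have "\<mu> \<bullet> (s *\<^sub>R \<omega> + \<xi>) = \<mu> \<bullet> \<xi> + s * t" by (simp add: inner_add t_def inner_commute)
      ultimately show ?thesis unfolding f_def by simp
    qed
    hence "(LINT \<xi>|lborel. f (of_real s) \<xi>) = (LINT \<xi>|lborel. f 0 (s *\<^sub>R \<omega> + \<xi>))" by simp
    also have "\<dots> = (LINT \<xi>|distr lborel borel ((+) (s *\<^sub>R \<omega>)). f 0 \<xi>)"
      using meas[of 0] by (subst integral_distr) auto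
    also have "\<dots> = (LINT \<xi>|lborel. f 0 \<xi>)" by (simp add: lborel_distr_plus)
    finally show ?thesis .
  qed
  have "((\<lambda>s. LINT \<xi>|lborel. f s \<xi>) has_field_derivative (LINT \<xi>|lborel. deriv (\<lambda>s. f s \<xi>) 0)) (at 0)"
    by (rule integral_holomorphic_parameter(1)[where f = f and r = 1, OF hol meas bound g]) auto
  hence "((\<lambda>s. LINT \<xi>|lborel. f (of_real s) \<xi>) has_vector_derivative (LINT \<xi>|lborel. deriv (\<lambda>s. f s \<xi>) 0)) (at 0)"
    using has_vector_derivative_real_field[of "\<lambda>s. LINT \<xi>|lborel. f s \<xi>" _ 0 UNIV] by simp
  moreover have "((\<lambda>s. LINT \<xi>|lborel. f (of_real s) \<xi>) has_vector_derivative 0) (at (0::real))"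
    unfolding const by (rule has_vector_derivative_const)
  ultimately have "(LINT \<xi>|lborel. deriv (\<lambda>s. f s \<xi>) 0) = 0"
    by (rule vector_derivative_unique_at)
  hence "(LINT \<xi>|lborel. (real j * ((\<omega> \<bullet> \<xi>) ^ (j - 1) * (\<mu> \<bullet> \<xi>) ^ k * exp (- (norm \<xi>)\<^sup>2 / 2)) +
       real k * t * ((\<omega> \<bullet> \<xi>) ^ j * (\<mu> \<bullet> \<xi>) ^ (k - 1) * exp (- (norm \<xi>)\<^sup>2 / 2)) -
       (\<omega> \<bullet> \<xi>) ^ Suc j * (\<mu> \<bullet> \<xi>) ^ k * exp (- (norm \<xi>)\<^sup>2 / 2))) = 0"
    unfolding deriv by (simp only: integral_complex_of_real of_real_eq_0_iff)
  moreover have i1: "integrable lborel (\<lambda>\<xi>. c * ((\<omega> \<bullet> \<xi>) ^ m * (\<mu> \<bullet> \<xi>) ^ n * exp (- (norm \<xi>)\<^sup>2 / 2)))" for c m n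
    by (intro integrable_mult_right integrable_gauss_moment assms)
  ultimately have "real j * gauss_moment \<omega> \<mu> (j - 1) k + real k * t * gauss_moment \<omega> \<mu> j (k - 1) - gauss_moment \<omega> \<mu> (Suc j) k = 0"
    using Bochner_Integration.integral_diff[OF Bochner_Integration.integrable_add[OF i1[of "real j" "j - 1" k] i1[of "real k * t" j "k - 1"]]
      integrable_gauss_moment[OF assms, of "Suc j" k]]
      Bochner_Integration.integral_add[OF i1[of "real j" "j - 1" k] i1[of "real k * t" j "k - 1"]]
    unfolding gauss_moment_def by (simp only: integral_mult_right_zero)
  thus ?thesis by (simp add: t_def)
qed

section \<open>Orthogonality of zonal Gegenbauer polynomials\<close>

text \<open>The coefficients of the power series of \<open>exp (x\<^sup>2 / 2)\<close>.\<close>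

definition gauss_coeff :: "nat \<Rightarrow> real" where
  "gauss_coeff p = (if even p then 1 / (2 ^ (p div 2) * fact (p div 2)) else 0)"

lemma gauss_coeff_double: "gauss_coeff (2 * p) = 1 / (2 ^ p * fact p)"
  by (simp add: gauss_coeff_def)

lemma gauss_coeff_rec: "real (p + 2) * gauss_coeff (p + 2) = gauss_coeff p"
proof (cases "even p")
  case True
  then obtain q where q: "p = 2 * q" by blast
  have "gauss_coeff (p + 2) = 1 / (2 ^ Suc q * fact (Suc q))"
    using gauss_coeff_double[of "Suc q"] by (simp add: q)
  moreover have "real (p + 2) = 2 * real (Suc q)" by (simp add: q)
  ultimately show ?thesis by (simp add: q gauss_coeff_double del: of_nat_Suc of_nat_add)
qed (simp add: gauss_coeff_def)

definition gauss_coeff_shift :: "nat \<Rightarrow> nat \<Rightarrow> real" where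
  "gauss_coeff_shift j l = (if l \<le> j then gauss_coeff (j - l) else 0)"

text \<open>The coefficient of u^j v^k in exp (u^2 / 2 + v^2 / 2 + t u v), the moment generating
  function of two standard normal variables with correlation t; l is the power of t u v. The guard
  in \<open>gauss_coeff_shift\<close> prevents truncated subtraction from producing
  \<open>gauss_coeff 0 = 1\<close> for l > j.\<close>

definition gauss_moment_poly :: "nat \<Rightarrow> nat \<Rightarrow> real \<Rightarrow> real" where
  "gauss_moment_poly j k t =
     (\<Sum>l\<le>j. gauss_coeff_shift j l * gauss_coeff_shift k l * t ^ l / fact l)"

lemma gauss_coeff_shift_rec:
  "real (Suc j - l) * gauss_coeff_shift (Suc j) l = (if j = 0 then 0 else gauss_coeff_shift (j - 1) l)"
proof (cases "l \<le> Suc j")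
  case True
  then obtain p where p: "Suc j = l + p" using le_Suc_ex by blast
  consider "p = 0" | "p = 1" | q where "p = q + 2" 
    using that by (cases p; cases "p - 1") auto
  thus ?thesis
  proof cases
    case 3
    hence "j = l + q + 1" using p by simp
    thus ?thesis using gauss_coeff_rec[of q] by (simp add: gauss_coeff_shift_def)
  qed (use p in \<open>auto simp: gauss_coeff_shift_def gauss_coeff_def\<close>)
qed (auto simp: gauss_coeff_shift_def)

lemma gauss_moment_poly_commute: "gauss_moment_poly j k t = gauss_moment_poly k j t"
proof -
  have "gauss_moment_poly j k t = (\<Sum>l\<le>j + k. gauss_coeff_shift j l * gauss_coeff_shift k l * t ^ l / fact l)" for j k
    unfolding gauss_moment_poly_def by (intro sum.mono_neutral_left) (auto simp: gauss_coeff_shift_def)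
  note eq = this
  show ?thesis unfolding eq[of j k] eq[of k j] add.commute[of k j]
    by (intro sum.cong refl) (simp only: mult_ac)
qed

text \<open>Comparison of coefficients in dF/du = (u + t v) F for the generating function F. In the
  sum, j + 1 splits as (j + 1 - l) + l: the first part lowers the index in exp (u^2 / 2), the second
  the power of t u v.\<close>

lemma gauss_moment_poly_Suc:
  "real (Suc j) * gauss_moment_poly (Suc j) k t =
     (if j = 0 then 0 else gauss_moment_poly (j - 1) k t) + (if k = 0 then 0 else t * gauss_moment_poly j (k - 1) t)"
proof -
  let ?T = "\<lambda>l. gauss_coeff_shift k l * t ^ l / fact l"
  have "real (Suc j) * gauss_moment_poly (Suc j) k t =
     (\<Sum>l\<le>Suc j. real (Suc j - l) * gauss_coeff_shift (Suc j) l * ?T l + real l * gauss_coeff_shift (Suc j) l * ?T l)"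
    unfolding gauss_moment_poly_def sum_distrib_left
  proof (intro sum.cong refl)
    fix l assume "l \<in> {..Suc j}"
    hence e: "real (Suc j) = real (Suc j - l) + real l" by simp
    show "real (Suc j) * (gauss_coeff_shift (Suc j) l * gauss_coeff_shift k l * t ^ l / fact l) =
      real (Suc j - l) * gauss_coeff_shift (Suc j) l * ?T l + real l * gauss_coeff_shift (Suc j) l * ?T l"
      unfolding e by (simp only: distrib_right times_divide_eq_right mult.assoc add_divide_distrib)
  qed
  also have "\<dots> = (\<Sum>l\<le>Suc j. real (Suc j - l) * gauss_coeff_shift (Suc j) l * ?T l) + (\<Sum>l\<le>Suc j. real l * gauss_coeff_shift (Suc j) l * ?T l)"
    by (rule sum.distrib)
  also have "(\<Sum>l\<le>Suc j. real (Suc j - l) * gauss_coeff_shift (Suc j) l * ?T l) = (if j = 0 then 0 else gauss_moment_poly (j - 1) k t)"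
  proof (cases j)
    case (Suc i)
    have "(\<Sum>l\<le>Suc j. gauss_coeff_shift i l * ?T l) = (\<Sum>l\<le>i. gauss_coeff_shift i l * ?T l)"
      using Suc by (intro sum.mono_neutral_right) (auto simp: gauss_coeff_shift_def)
    thus ?thesis unfolding gauss_coeff_shift_rec using Suc by (simp add: gauss_moment_poly_def mult_ac)
  next
    case 0
    thus ?thesis unfolding gauss_coeff_shift_rec by (simp del: sum.atMost_Suc)
  qed
  also have "(\<Sum>l\<le>Suc j. real l * gauss_coeff_shift (Suc j) l * ?T l) =
      (\<Sum>l\<le>j. real (Suc l) * gauss_coeff_shift (Suc j) (Suc l) * ?T (Suc l))"
    by (subst sum.atMost_Suc_shift) (simp del: fact_Suc of_nat_Suc power_Suc)
  also have "\<dots> = (if k = 0 then 0 else t * gauss_moment_poly j (k - 1) t)"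
  proof (cases k)
    case 0
    thus ?thesis by (simp add: gauss_coeff_shift_def)
  next
    case (Suc i)
    have sh: "gauss_coeff_shift (Suc j) (Suc l) = gauss_coeff_shift j l" for j l
      by (simp add: gauss_coeff_shift_def)
    have "real (Suc l) * gauss_coeff_shift (Suc j) (Suc l) * ?T (Suc l) =
      t * (gauss_coeff_shift j l * gauss_coeff_shift i l * t ^ l / fact l)" for l
    proof -
      have "t ^ Suc l / fact (Suc l) = t * t ^ l / (real (Suc l) * fact l)" by simp
      hence h: "real (Suc l) * (t ^ Suc l / fact (Suc l)) = t * (t ^ l / fact l)"
        by (simp del: of_nat_Suc power_Suc fact_Suc)
      have "real (Suc l) * gauss_coeff_shift (Suc j) (Suc l) * ?T (Suc l) =
          gauss_coeff_shift j l * gauss_coeff_shift i l * (real (Suc l) * (t ^ Suc l / fact (Suc l)))"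
        unfolding Suc sh by (simp only: times_divide_eq_right[symmetric] mult_ac)
      also have "\<dots> = t * (gauss_coeff_shift j l * gauss_coeff_shift i l * t ^ l / fact l)"
        unfolding h by (simp add: mult_ac)
      finally show ?thesis .
    qed
    hence "(\<Sum>l\<le>j. real (Suc l) * gauss_coeff_shift (Suc j) (Suc l) * ?T (Suc l)) = t * gauss_moment_poly j i t"
      unfolding gauss_moment_poly_def sum_distrib_left by (intro sum.cong refl)
    thus ?thesis by (simp only: Suc) simp
  qed
  finally show ?thesis .
qed

lemma gauss_moment_poly_0_0: "gauss_moment_poly 0 0 t = 1"
  by (simp add: gauss_moment_poly_def gauss_coeff_shift_def gauss_coeff_def)

text \<open>Both sides satisfy the recursion of \<open>gauss_moment_Suc\<close>, which reduces j + k
  by two. It acts on a positive first exponent; for j = 0 the roles of \<omega> and \<mu> are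
  exchanged, so both vectors stay arbitrary in the induction.\<close>

lemma gauss_moment_eq:
  fixes \<omega> \<mu> :: "'a::euclidean_space"
  assumes "norm \<omega> = 1" "norm \<mu> = 1"
  shows "gauss_moment \<omega> \<mu> j k =
    gauss_moment \<omega> \<mu> 0 0 * (fact j * fact k * gauss_moment_poly j k (\<omega> \<bullet> \<mu>))"
  using assms
proof (induction "j + k" arbitrary: j k \<omega> \<mu> rule: less_induct)
  case less
  have step: "gauss_moment \<omega>' \<mu>' (Suc i) k' =
      gauss_moment \<omega>' \<mu>' 0 0 * (fact (Suc i) * fact k' * gauss_moment_poly (Suc i) k' (\<omega>' \<bullet> \<mu>'))"
    if lt: "Suc i + k' = j + k" and n: "norm \<omega>' = 1" "norm \<mu>' = 1" for i k' and \<omega>' \<mu>' :: 'a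
  proof -
    define V where "V = gauss_moment \<omega>' \<mu>' 0 0"
    define t where "t = \<omega>' \<bullet> \<mu>'"
    have 1: "real i * gauss_moment \<omega>' \<mu>' (i - 1) k' = V * (fact i * fact k' * (if i = 0 then 0 else gauss_moment_poly (i - 1) k' t))"
    proof (cases i)
      case (Suc h)
      thus ?thesis using less.hyps[of h k' \<omega>' \<mu>'] lt n by (simp add: V_def t_def)
    qed simp
    have 2: "real k' * t * gauss_moment \<omega>' \<mu>' i (k' - 1) = V * (fact i * fact k' * (if k' = 0 then 0 else t * gauss_moment_poly i (k' - 1) t))"
    proof (cases k')
      case (Suc h)
      thus ?thesis using less.hyps[of i h \<omega>' \<mu>'] lt n by (simp add: V_def t_def)
    qed simp
    have "gauss_moment \<omega>' \<mu>' (Suc i) k' = V * (fact i * fact k' *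
       ((if i = 0 then 0 else gauss_moment_poly (i - 1) k' t) + (if k' = 0 then 0 else t * gauss_moment_poly i (k' - 1) t)))"
      unfolding gauss_moment_Suc[OF n] t_def[symmetric] 1 2 by (simp only: ring_distribs)
    also have "\<dots> = V * (fact (Suc i) * fact k' * gauss_moment_poly (Suc i) k' t)"
      unfolding gauss_moment_poly_Suc[symmetric] by (simp add: mult_ac)
    finally show ?thesis by (simp add: V_def t_def)
  qed
  show ?case
  proof (cases j)
    case (Suc i)
    thus ?thesis using step[of i k \<omega> \<mu>] less.prems by simp
  next
    case 0
    show ?thesis
    proof (cases k)
      case (Suc i)
      have "gauss_moment \<omega> \<mu> 0 k = gauss_moment \<mu> \<omega> (Suc i) 0"
        by (simp add: Suc gauss_moment_commute[of \<omega>])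
      also have "\<dots> = gauss_moment \<mu> \<omega> 0 0 * (fact (Suc i) * fact 0 * gauss_moment_poly (Suc i) 0 (\<mu> \<bullet> \<omega>))"
        using step[of i 0 \<mu> \<omega>] 0 Suc less.prems by simp
      finally show ?thesis
        using 0 Suc by (simp add: gauss_moment_commute[of \<mu>] gauss_moment_poly_commute[of _ 0] inner_commute)
    qed (simp add: 0 gauss_moment_poly_0_0)
  qed
qed

text \<open>In polar coordinates a Gaussian moment of degree 2 n is the sphere integral times Gamma
  (N / 2 + n) and a power of 2. Comparison with the moment of degree 0 removes the common constants;
  the quotient Gamma (N / 2 + n) / Gamma (N / 2) is the rising factorial on the left.\<close>

lemma sphere_int_inner_powers:
  fixes \<omega> \<mu> :: "'a::euclidean_space"
  assumes n: "norm \<omega> = 1" "norm \<mu> = 1" and jk: "j + k = 2 * n"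
  shows "sphere_int (\<lambda>\<eta>::'a. (\<omega> \<bullet> \<eta>) ^ j * (\<mu> \<bullet> \<eta>) ^ k) * (2 ^ n * pochhammer (real DIM('a) / 2) n) =
    sphere_int (\<lambda>_::'a. 1) * (fact j * fact k * gauss_moment_poly j k (\<omega> \<bullet> \<mu>))"
    (is "sphere_int ?A * _ = _")
proof -
  define N where "N = real DIM('a)"
  have N: "N > 0" by (simp add: N_def)
  have key: "gauss_moment \<omega> \<mu> j k =
     N / 2 * sphere_int (\<lambda>\<eta>::'a. (\<omega> \<bullet> \<eta>) ^ j * (\<mu> \<bullet> \<eta>) ^ k) * (Gamma (N / 2) * pochhammer (N / 2) n * 2 powr (N / 2) * 2 ^ n)"
    if jk: "j + k = 2 * n" for j k n
  proof -
    let ?A = "\<lambda>\<eta>::'a. (\<omega> \<bullet> \<eta>) ^ j * (\<mu> \<bullet> \<eta>) ^ k"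
    have A: "\<bar>?A (sgn x)\<bar> \<le> 1" for x
    proof -
      have "norm (sgn x) \<le> 1" by (simp add: norm_sgn)
      hence "\<bar>\<omega> \<bullet> sgn x\<bar> \<le> 1" "\<bar>\<mu> \<bullet> sgn x\<bar> \<le> 1"
        using Cauchy_Schwarz_ineq2[of \<omega> "sgn x"] Cauchy_Schwarz_ineq2[of \<mu> "sgn x"] n by auto
      hence "\<bar>\<omega> \<bullet> sgn x\<bar> ^ j * \<bar>\<mu> \<bullet> sgn x\<bar> ^ k \<le> 1" by (intro mult_le_one power_le_one) auto
      thus ?thesis by (simp only: abs_mult power_abs)
    qed
    have "has_bochner_integral lborel (\<lambda>x. ?A (sgn x) * (norm x powr real (j + k) * exp (- (1/2) * norm x powr 2)))
      (real DIM('a) / 2 * sphere_int ?A * (Gamma ((real DIM('a) + real (j + k)) / 2) / (1/2) powr ((real DIM('a) + real (j + k)) / 2)))"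
    proof (rule has_bochner_integral_norm_powr_exp[where M = 1])
      show "real (j + k) > - real DIM('a)" using N unfolding N_def by linarith
    qed (use A in auto)
    hence "(LINT x|lborel. ?A (sgn x) * (norm x powr real (j + k) * exp (- (1/2) * norm x powr 2))) =
      N / 2 * sphere_int ?A * (Gamma ((N + real (j + k)) / 2) / (1/2) powr ((N + real (j + k)) / 2))"
      unfolding N_def by (rule has_bochner_integral_integral_eq)
    also have "(N + real (j + k)) / 2 = N / 2 + real n" using jk by simp
    also have "Gamma (N / 2 + real n) = Gamma (N / 2) * pochhammer (N / 2) n"
    proof -
      have "N / 2 \<notin> \<int>\<^sub>\<le>\<^sub>0" using N by (auto elim!: nonpos_Ints_cases)
      hence "pochhammer (N / 2) n = Gamma (N / 2 + real n) / Gamma (N / 2)" by (rule pochhammer_Gamma)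
      moreover have "Gamma (N / 2) > 0" using N by (intro Gamma_real_pos) auto
      ultimately show ?thesis by simp
    qed
    also have "(1 / 2) powr (N / 2 + real n) = inverse (2 powr (N / 2) * 2 ^ n)"
    proof -
      have "(1 / 2 :: real) powr (N / 2 + real n) = 1 / 2 powr (N / 2 + real n)" by (subst powr_divide) auto
      also have "2 powr (N / 2 + real n) = 2 powr (N / 2) * 2 powr real n" by (rule powr_add)
      also have "2 powr real n = (2::real) ^ n" by (rule powr_realpow) simp
      finally show ?thesis by (simp only: inverse_eq_divide)
    qed
    also have "(LINT x|lborel. ?A (sgn x) * (norm x powr real (j + k) * exp (- (1/2) * norm x powr 2))) =
       gauss_moment \<omega> \<mu> j k"
      unfolding gauss_moment_def
    proof (rule integral_cong_AE)
      have "AE x in lborel. (x::'a) \<noteq> 0" by (rule AE_lborel_singleton)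
      thus "AE x in lborel. ?A (sgn x) * (norm x powr real (j + k) * exp (- (1/2) * norm x powr 2)) =
         (\<omega> \<bullet> x) ^ j * (\<mu> \<bullet> x) ^ k * exp (- (norm x)\<^sup>2 / 2)"
      proof eventually_elim
        case (elim x)
        have pw: "norm x powr real (j + k) = norm x ^ j * norm x ^ k"
          using elim powr_realpow[of "norm x" "j + k"] by (simp add: power_add)
        have u: "\<nu> \<bullet> x = norm x * (\<nu> \<bullet> sgn x)" for \<nu> :: 'a
          using elim by (simp add: sgn_div_norm)
        have "norm x powr 2 = (norm x)\<^sup>2" using elim by (simp add: powr_numeral)
        thus ?case unfolding pw u[of \<omega>] u[of \<mu>] power_mult_distrib by simp
      qed
    qed measurable
    finally have "gauss_moment \<omega> \<mu> j k = N / 2 * sphere_int ?A * (Gamma (N / 2) * pochhammer (N / 2) n / inverse (2 powr (N / 2) * 2 ^ n))" .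
    thus ?thesis by (simp only: divide_inverse[of _ "inverse _"] inverse_inverse_eq mult.assoc)
  qed
  define G where "G = N / 2 * Gamma (N / 2) * 2 powr (N / 2)"
  have G: "G > 0" unfolding G_def using N by (intro mult_pos_pos Gamma_real_pos) auto
  have "G * (sphere_int ?A * (2 ^ n * pochhammer (N / 2) n)) = gauss_moment \<omega> \<mu> j k"
    unfolding key[OF jk] by (simp add: G_def mult_ac)
  also have "\<dots> = gauss_moment \<omega> \<mu> 0 0 * (fact j * fact k * gauss_moment_poly j k (\<omega> \<bullet> \<mu>))"
    by (rule gauss_moment_eq[OF n])
  also have "gauss_moment \<omega> \<mu> 0 0 = G * sphere_int (\<lambda>_::'a. 1)"
    using key[of 0 0 0] by (simp add: G_def mult_ac)
  finally show ?thesis using G by (simp add: N_def)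
qed

lemma sphere_int_inner_powers_odd:
  fixes \<omega> \<mu> :: "'a::euclidean_space"
  assumes jk: "odd (j + k)"
  shows "sphere_int (\<lambda>\<eta>::'a. (\<omega> \<bullet> \<eta>) ^ j * (\<mu> \<bullet> \<eta>) ^ k) = 0"
proof -
  let ?f = "\<lambda>x::'a. indicator (cball 0 1) x * ((\<omega> \<bullet> sgn x) ^ j * (\<mu> \<bullet> sgn x) ^ k) :: real"
  have "(LINT x|lborel. ?f x) = (LINT x|distr lborel borel uminus. ?f x)"
  proof -
    have "(lborel :: 'a measure) = distr lborel borel uminus"
      using lborel_affine[of "-1" "0::'a"] by (simp add: density_1)
    thus ?thesis by simp
  qed
  also have "\<dots> = (LINT x|lborel. ?f (- x))" 
  proof -
    have [measurable]: "cball (0::'a) 1 \<in> sets borel" "(sgn :: 'a \<Rightarrow> 'a) \<in> borel_measurable borel"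
      by (auto simp: sgn_div_norm)
    have "?f \<in> borel_measurable borel" by measurable
    thus ?thesis by (subst integral_distr) auto
  qed
  also have "\<dots> = (LINT x|lborel. - ?f x)"
  proof (rule Bochner_Integration.integral_cong)
    fix x :: 'a
    have sg: "(p * X) * (q * Y) = - (X * Y)" if "p * q = -1" for p q X Y :: real
    proof -
      have "(p * X) * (q * Y) = (p * q) * (X * Y)" by (simp only: mult_ac)
      thus ?thesis using that by simp
    qed
    have "(-1::real) ^ j * (-1) ^ k = -1" using jk by (simp flip: power_add)
    hence "(- (\<omega> \<bullet> sgn x)) ^ j * (- (\<mu> \<bullet> sgn x)) ^ k = - ((\<omega> \<bullet> sgn x) ^ j * (\<mu> \<bullet> sgn x) ^ k)"
      unfolding power_minus[of "\<omega> \<bullet> sgn x" j] power_minus[of "\<mu> \<bullet> sgn x" k]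
      by (rule sg)
    thus "?f (- x) = - ?f x" by (simp add: sgn_minus indicator_def)
  qed simp
  finally show ?thesis by (simp add: sphere_int_def)
qed

text \<open>The coefficient of t^l when a power of degree j = l + 2 p is integrated against the
  zonal polynomial of degree m = l + 2 q. After cancellation the summand is a signed binomial
  coefficient times a quotient R of rising factorials. For p < q this quotient is a polynomial in i
  of degree q - p - 1, which the q-th difference annihilates; for p = q it is 1 / (\<nu> + m - i),
  which partial fractions sum.\<close>

lemma gegen_coeff_sum:
  fixes \<nu> :: real
  assumes \<nu>: "\<nu> \<ge> -1/2" and m: "m \<ge> 1" "m = l + 2 * q" and pq: "p \<le> q"
  shows "(\<Sum>i\<le>q. gegen_coeff \<nu> m i * fact (m - 2 * i) * (1 / (2 ^ (q - i) * fact (q - i))) /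
       (2 ^ (l + p + q - i) * pochhammer (\<nu> + 1) (l + p + q - i))) =
     (if p < q then 0 else gegen_coeff \<nu> m q * fact q * fact l * 2 ^ q / (2 ^ m * pochhammer (\<nu> + 1) m))"
    (is "?L = ?R")
proof -
  define R where "R = (\<lambda>i. pochhammer (\<nu> + 1) (m - i - 1) / pochhammer (\<nu> + 1) (l + p + q - i))"
  have pos: "pochhammer (\<nu> + 1) k > 0" for k using \<nu> by (intro pochhammer_pos) auto
  have "?L = (\<Sum>i\<le>q. (\<nu> + real m) / (2 ^ p * fact q) * ((-1) ^ i * of_nat (q choose i) * R i))"
  proof (intro sum.cong refl)
    fix i assume "i \<in> {..q}"
    hence i: "i \<le> q" by simp
    have "m - 2 * i = (q - i) + (l + q - i)" using m i by auto
    hence e1: "(2::real) ^ (m - 2 * i) = 2 ^ (q - i) * 2 ^ (l + q - i)" by (simp add: power_add)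
    have "l + p + q - i = p + (l + q - i)" using i by auto
    hence e2: "(2::real) ^ (l + p + q - i) = 2 ^ p * 2 ^ (l + q - i)" by (simp add: power_add)
    have e3: "real (q choose i) = fact q / (fact i * fact (q - i))" using i by (simp add: binomial_fact)
    have g: "gegen_coeff \<nu> m i * fact (m - 2 * i) = (-1) ^ i * (2 ^ (q - i) * 2 ^ (l + q - i)) * (\<nu> + real m) * pochhammer (\<nu> + 1) (m - i - 1) / fact i"
      using m unfolding gegen_coeff_def e1 by simp
    show "gegen_coeff \<nu> m i * fact (m - 2 * i) * (1 / (2 ^ (q - i) * fact (q - i))) /
       (2 ^ (l + p + q - i) * pochhammer (\<nu> + 1) (l + p + q - i)) =
       (\<nu> + real m) / (2 ^ p * fact q) * ((-1) ^ i * of_nat (q choose i) * R i)"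
      unfolding g e2 e3 R_def by (simp add: divide_simps)
  qed
  also have "\<dots> = (\<nu> + real m) / (2 ^ p * fact q) * (\<Sum>i\<le>q. (-1) ^ i * of_nat (q choose i) * R i)"
    by (simp only: sum_distrib_left)
  also have "\<dots> = ?R"
  proof (cases "p < q")
    case True
    have "R i = pochhammer (\<nu> + 1 + real (l + p + q) - real i) (q - p - 1)" if "i \<le> q" for i
    proof -
      have "m - i - 1 = (l + p + q - i) + (q - p - 1)" using True m that by auto
      hence "pochhammer (\<nu> + 1) (m - i - 1) = pochhammer (\<nu> + 1) (l + p + q - i) * pochhammer (\<nu> + 1 + real (l + p + q - i)) (q - p - 1)"
        by (simp only: pochhammer_product') 
      moreover have "real (l + p + q - i) = real (l + p + q) - real i" using that by (simp add: of_nat_diff)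
      ultimately show ?thesis using pos[of "l + p + q - i"] by (simp add: R_def add_diff_eq)
    qed
    hence "(\<Sum>i\<le>q. (-1) ^ i * of_nat (q choose i) * R i) =
       (\<Sum>i\<le>q. (-1) ^ i * of_nat (q choose i) * pochhammer (\<nu> + 1 + real (l + p + q) - real i) (q - p - 1))"
      by (intro sum.cong) auto
    also have "\<dots> = 0" using True by (intro finite_difference_pochhammer) auto
    finally show ?thesis using True by simp
  next
    case False
    hence p: "p = q" using pq by simp
    have X: "\<nu> + real m > real q" using \<nu> m by (cases q) auto
    have "R i = 1 / (\<nu> + real m - real i)" if "i \<le> q" for i
    proof -
      have "l + p + q - i = Suc (m - i - 1)" using p m that by auto
      hence "pochhammer (\<nu> + 1) (l + p + q - i) = pochhammer (\<nu> + 1) (m - i - 1) * (\<nu> + 1 + real (m - i - 1))"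
        by (simp only: pochhammer_Suc)
      moreover have "\<nu> + 1 + real (m - i - 1) = \<nu> + real m - real i" using m that by (auto simp: of_nat_diff)
      ultimately show ?thesis using pos[of "m - i - 1"] by (simp add: R_def)
    qed
    hence "(\<Sum>i\<le>q. (-1) ^ i * of_nat (q choose i) * R i) =
       (\<Sum>i\<le>q. (-1) ^ i * of_nat (q choose i) / (\<nu> + real m - real i))"
      by (intro sum.cong) auto
    also have "\<dots> = (-1) ^ q * fact q / pochhammer (\<nu> + real m - real q) (Suc q)"
      by (rule finite_difference_inverse[OF X])
    also have "(\<nu> + real m) / (2 ^ p * fact q) * \<dots> = gegen_coeff \<nu> m q * fact q * fact l * 2 ^ q / (2 ^ m * pochhammer (\<nu> + 1) m)"
    proof -
      have mm: "m = (m - q - 1) + Suc q" using m by auto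
      have "pochhammer (\<nu> + 1) m = pochhammer (\<nu> + 1) (m - q - 1) * pochhammer (\<nu> + 1 + real (m - q - 1)) (Suc q)"
        by (subst mm) (rule pochhammer_product')
      moreover have "\<nu> + 1 + real (m - q - 1) = \<nu> + real m - real q" using m by (auto simp: of_nat_diff)
      ultimately have P: "pochhammer (\<nu> + 1) m = pochhammer (\<nu> + 1) (m - q - 1) * pochhammer (\<nu> + real m - real q) (Suc q)" by (simp only:)
      have P2: "pochhammer (\<nu> + real m - real q) (Suc q) > 0" using X by (intro pochhammer_pos) auto
      have l: "m - 2 * q = l" using m by simp
      have pw: "(2::real) ^ m = 2 ^ l * 2 ^ q * 2 ^ q" by (simp add: m power_add power_mult power2_eq_square mult_2)
      show ?thesis
        using m pos[of "m - q - 1"] P2 unfolding gegen_coeff_def l P p pw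
        by (simp add: divide_simps del: pochhammer_Suc)
    qed
    finally show ?thesis using False by simp
  qed
  finally show ?thesis .
qed

lemma abs_inner_sgn_le:
  fixes \<omega> :: "'a::euclidean_space"
  assumes "norm \<omega> = 1" shows "\<bar>\<omega> \<bullet> sgn x\<bar> \<le> 1"
proof -
  have "norm (sgn x) \<le> 1" by (simp add: norm_sgn)
  thus ?thesis using Cauchy_Schwarz_ineq2[of \<omega> "sgn x"] assms by auto
qed

lemma sphere_int_sum:
  fixes A :: "nat \<Rightarrow> 'a::euclidean_space \<Rightarrow> real"
  assumes "finite I" "\<And>i. i \<in> I \<Longrightarrow> A i \<in> borel_measurable borel"
    and "\<And>i x. i \<in> I \<Longrightarrow> \<bar>A i (sgn x)\<bar> \<le> M i"
  shows "sphere_int (\<lambda>\<eta>. \<Sum>i\<in>I. c i * A i \<eta>) = (\<Sum>i\<in>I. c i * sphere_int (A i))"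
proof -
  have "sphere_int (\<lambda>\<eta>. \<Sum>i\<in>I. c i * A i \<eta>) = (LINT x|lborel. (\<Sum>i\<in>I. c i * (indicator (cball 0 1) x * A i (sgn x))))"
    unfolding sphere_int_def sum_distrib_left by (simp only: mult_ac)
  also have "\<dots> = (\<Sum>i\<in>I. LINT x|lborel. c i * (indicator (cball 0 1) x * A i (sgn x)))"
    using assms by (intro Bochner_Integration.integral_sum integrable_mult_right integrable_sphere_int[where M = "M _"]) auto
  finally show ?thesis by (simp add: sphere_int_def)
qed

text \<open>Lower powers are orthogonal to the zonal polynomial of degree m, and the m-th power
  reproduces it, divided by its leading coefficient. Expanding the polynomial and the moments gives
  a double sum; for each t^l the inner sum over i is \<open>gegen_coeff_sum\<close>. Only l with the
  parity of m contribute, since odd \<open>gauss_coeff\<close> vanish, and odd j + m is settled by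
  reflection.\<close>

lemma sphere_int_power_gegen:
  fixes \<omega> \<mu> :: "'a::euclidean_space" and \<nu> :: real
  assumes n: "norm \<omega> = 1" "norm \<mu> = 1" and \<nu>: "\<nu> = (real DIM('a) - 2) / 2" and jm: "j \<le> m" and m: "m \<ge> 1"
  shows "sphere_int (\<lambda>\<eta>::'a. (\<omega> \<bullet> \<eta>) ^ j * solid_gegen \<nu> m (\<mu> \<bullet> \<eta>) 1) =
    (if j = m then sphere_int (\<lambda>_::'a. 1) * (fact m / (2 ^ m * pochhammer (\<nu> + 1) m)) * solid_gegen \<nu> m (\<omega> \<bullet> \<mu>) 1 else 0)"
proof -
  define t where "t = \<omega> \<bullet> \<mu>"
  have \<nu>0: "\<nu> \<ge> -1/2" and \<nu>N: "real DIM('a) / 2 = \<nu> + 1" using dim_index[OF \<nu>] by linarith+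
  have pos: "pochhammer (\<nu> + 1) k > 0" for k using \<nu>0 by (intro pochhammer_pos) auto
  define c where "c = (\<lambda>i. gegen_coeff \<nu> m i)"
  let ?S = "\<lambda>j k. sphere_int (\<lambda>\<eta>::'a. (\<omega> \<bullet> \<eta>) ^ j * (\<mu> \<bullet> \<eta>) ^ k)"
  have "sphere_int (\<lambda>\<eta>::'a. (\<omega> \<bullet> \<eta>) ^ j * solid_gegen \<nu> m (\<mu> \<bullet> \<eta>) 1) =
    sphere_int (\<lambda>\<eta>::'a. \<Sum>i\<le>m div 2. c i * ((\<omega> \<bullet> \<eta>) ^ j * (\<mu> \<bullet> \<eta>) ^ (m - 2 * i)))"
    by (simp add: solid_gegen_def sum_distrib_left c_def mult_ac)
  also have "\<dots> = (\<Sum>i\<le>m div 2. c i * ?S j (m - 2 * i))"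
  proof (rule sphere_int_sum[where M = "\<lambda>_. 1"])
    fix i and x :: 'a
    have "\<bar>\<omega> \<bullet> sgn x\<bar> ^ j * \<bar>\<mu> \<bullet> sgn x\<bar> ^ (m - 2 * i) \<le> 1"
      using n by (intro mult_le_one power_le_one abs_inner_sgn_le) auto
    thus "\<bar>(\<omega> \<bullet> sgn x) ^ j * (\<mu> \<bullet> sgn x) ^ (m - 2 * i)\<bar> \<le> 1"
      by (simp only: abs_mult power_abs)
  qed auto
  finally have main: "sphere_int (\<lambda>\<eta>::'a. (\<omega> \<bullet> \<eta>) ^ j * solid_gegen \<nu> m (\<mu> \<bullet> \<eta>) 1) = \<dots>" .
  show ?thesis
  proof (cases "even (j + m)")
    case False
    have "?S j (m - 2 * i) = 0" if "i \<le> m div 2" for i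
    proof (rule sphere_int_inner_powers_odd)
      have "2 * i \<le> m" using that by auto
      thus "odd (j + (m - 2 * i))" using False by simp
    qed
    thus ?thesis unfolding main using False by auto
  next
    case True
    then obtain n0 where n0: "j + m = 2 * n0" by blast
    define \<sigma> where "\<sigma> = sphere_int (\<lambda>_::'a. 1)"
    define P where "P = (\<lambda>i. 2 ^ (n0 - i) * pochhammer (\<nu> + 1) (n0 - i))"
    have P: "P i > 0" for i unfolding P_def using pos by simp
    have S: "?S j (m - 2 * i) = \<sigma> * fact j * (fact (m - 2 * i) * gauss_moment_poly j (m - 2 * i) t / P i)"
      if "i \<le> m div 2" for i
    proof -
      have "j + (m - 2 * i) = 2 * (n0 - i)" using that n0 by auto
      from sphere_int_inner_powers[OF n this] have
        "?S j (m - 2 * i) * P i = \<sigma> * (fact j * fact (m - 2 * i) * gauss_moment_poly j (m - 2 * i) t)"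
        unfolding \<nu>N P_def \<sigma>_def t_def .
      thus ?thesis using P[of i] by (simp add: field_simps)
    qed
    have "(\<Sum>i\<le>m div 2. c i * ?S j (m - 2 * i)) =
      (\<Sum>i\<le>m div 2. \<Sum>l\<le>j. \<sigma> * fact j * (gauss_coeff_shift j l * t ^ l / fact l) * (c i * fact (m - 2 * i) * gauss_coeff_shift (m - 2 * i) l / P i))"
    proof (intro sum.cong refl)
      fix i assume "i \<in> {..m div 2}"
      hence i: "i \<le> m div 2" by simp
      show "c i * ?S j (m - 2 * i) = (\<Sum>l\<le>j. \<sigma> * fact j * (gauss_coeff_shift j l * t ^ l / fact l) * (c i * fact (m - 2 * i) * gauss_coeff_shift (m - 2 * i) l / P i))"
        unfolding S[OF i] gauss_moment_poly_def sum_distrib_left sum_divide_distrib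
        by (intro sum.cong refl) (simp add: mult_ac)
    qed
    also have "\<dots> = (\<Sum>l\<le>j. \<sigma> * fact j * (gauss_coeff_shift j l * t ^ l / fact l) * (\<Sum>i\<le>m div 2. c i * fact (m - 2 * i) * gauss_coeff_shift (m - 2 * i) l / P i))"
      by (subst sum.swap) (simp only: sum_distrib_left)
    also have "\<dots> = (\<Sum>l\<le>j. if even (m - l) then \<sigma> * fact j * (gauss_coeff_shift j l * t ^ l / fact l) *
       (if j < m then 0 else c ((m - l) div 2) * fact ((m - l) div 2) * fact l * 2 ^ ((m - l) div 2) / (2 ^ m * pochhammer (\<nu> + 1) m)) else 0)"
    proof (intro sum.cong refl)
      fix l assume "l \<in> {..j}"
      hence l: "l \<le> j" "l \<le> m" using jm by auto
      show "\<sigma> * fact j * (gauss_coeff_shift j l * t ^ l / fact l) * (\<Sum>i\<le>m div 2. c i * fact (m - 2 * i) * gauss_coeff_shift (m - 2 * i) l / P i) =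
        (if even (m - l) then \<sigma> * fact j * (gauss_coeff_shift j l * t ^ l / fact l) *
       (if j < m then 0 else c ((m - l) div 2) * fact ((m - l) div 2) * fact l * 2 ^ ((m - l) div 2) / (2 ^ m * pochhammer (\<nu> + 1) m)) else 0)"
      proof (cases "even (m - l)")
        case False
        have "even (j + m)" using True .
        hence "odd (j - l)" using False l by (auto simp: even_diff_nat)
        thus ?thesis using False by (simp add: gauss_coeff_shift_def gauss_coeff_def)
      next
        case ev: True
        then obtain q where "m - l = 2 * q" by blast
        hence q: "m = l + 2 * q" using l by simp
        have "even (j - l)" using True ev l by (auto simp: even_diff_nat)
        then obtain p where "j - l = 2 * p" by blast
        hence p: "j = l + 2 * p" using l by simp
        have pq: "p \<le> q" using p q jm by simp
        have n0': "n0 = l + p + q" using n0 p q by simp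
        have "(\<Sum>i\<le>m div 2. c i * fact (m - 2 * i) * gauss_coeff_shift (m - 2 * i) l / P i) =
          (\<Sum>i\<le>q. c i * fact (m - 2 * i) * gauss_coeff_shift (m - 2 * i) l / P i)"
        proof (intro sum.mono_neutral_right ballI)
          fix i assume "i \<in> {..m div 2} - {..q}"
          hence "i > q" "2 * i \<le> m" by auto
          hence "m - 2 * i < l" using q by auto
          thus "c i * fact (m - 2 * i) * gauss_coeff_shift (m - 2 * i) l / P i = 0" by (simp add: gauss_coeff_shift_def)
        qed (use q in auto)
        also have "\<dots> = (\<Sum>i\<le>q. gegen_coeff \<nu> m i * fact (m - 2 * i) * (1 / (2 ^ (q - i) * fact (q - i))) /
          (2 ^ (l + p + q - i) * pochhammer (\<nu> + 1) (l + p + q - i)))"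
        proof (intro sum.cong refl)
          fix i assume "i \<in> {..q}"
          hence i: "m - 2 * i - l = 2 * (q - i)" "l \<le> m - 2 * i" using q by auto
          hence "gauss_coeff_shift (m - 2 * i) l = 1 / (2 ^ (q - i) * fact (q - i))"
            unfolding gauss_coeff_shift_def i(1) gauss_coeff_double by simp
          thus "c i * fact (m - 2 * i) * gauss_coeff_shift (m - 2 * i) l / P i =
            gegen_coeff \<nu> m i * fact (m - 2 * i) * (1 / (2 ^ (q - i) * fact (q - i))) /
            (2 ^ (l + p + q - i) * pochhammer (\<nu> + 1) (l + p + q - i))"
            by (simp only: c_def P_def n0')
        qed
        also have "\<dots> = (if p < q then 0 else gegen_coeff \<nu> m q * fact q * fact l * 2 ^ q / (2 ^ m * pochhammer (\<nu> + 1) m))"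
          by (rule gegen_coeff_sum[OF \<nu>0 m q pq])
        finally have e: "(\<Sum>i\<le>m div 2. c i * fact (m - 2 * i) * gauss_coeff_shift (m - 2 * i) l / P i) = \<dots>" .
        have "p < q \<longleftrightarrow> j < m" "(m - l) div 2 = q" using p q by auto
        thus ?thesis unfolding e using ev by (simp add: c_def)
      qed
    qed
    also have "\<dots> = (if j = m then \<sigma> * (fact m / (2 ^ m * pochhammer (\<nu> + 1) m)) * solid_gegen \<nu> m t 1 else 0)"
    proof (cases "j = m")
      case False
      hence "j < m" using jm by simp
      thus ?thesis using False by (auto intro!: sum.neutral)
    next
      case jeq: True
      have "(\<Sum>l\<le>j. if even (m - l) then \<sigma> * fact j * (gauss_coeff_shift j l * t ^ l / fact l) *
       (if j < m then 0 else c ((m - l) div 2) * fact ((m - l) div 2) * fact l * 2 ^ ((m - l) div 2) / (2 ^ m * pochhammer (\<nu> + 1) m)) else 0)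
        = (\<Sum>l\<in>{l\<in>{..m}. even (m - l)}. \<sigma> * fact m * (gauss_coeff_shift m l * t ^ l / fact l) *
        (c ((m - l) div 2) * fact ((m - l) div 2) * fact l * 2 ^ ((m - l) div 2) / (2 ^ m * pochhammer (\<nu> + 1) m)))"
        unfolding jeq by (simp only: sum.inter_filter[symmetric] finite_atMost less_irrefl if_False)
      also have "\<dots> = (\<Sum>i\<le>m div 2. \<sigma> * (fact m / (2 ^ m * pochhammer (\<nu> + 1) m)) * (c i * t ^ (m - 2 * i)))"
      proof (rule sum.reindex_bij_witness[of _ "\<lambda>i. m - 2 * i" "\<lambda>l. (m - l) div 2"])
        fix l assume "l \<in> {l\<in>{..m}. even (m - l)}"
        hence "even (m - l)" and lm: "l \<le> m" by blast+
        then obtain q where q: "m - l = 2 * q" by blast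
        hence "m - 2 * q = l" using lm by linarith
        have g: "gauss_coeff_shift m l = 1 / (2 ^ q * fact q)"
          using lm unfolding gauss_coeff_shift_def q gauss_coeff_double by simp
        show "m - 2 * ((m - l) div 2) = l" "(m - l) div 2 \<in> {..m div 2}"
          using q lm by auto
        have "(m - l) div 2 = q" using q by simp
        with \<open>m - 2 * q = l\<close> show "\<sigma> * (fact m / (2 ^ m * pochhammer (\<nu> + 1) m)) * (c ((m - l) div 2) * t ^ (m - 2 * ((m - l) div 2))) =
          \<sigma> * fact m * (gauss_coeff_shift m l * t ^ l / fact l) *
        (c ((m - l) div 2) * fact ((m - l) div 2) * fact l * 2 ^ ((m - l) div 2) / (2 ^ m * pochhammer (\<nu> + 1) m))"
          using pos[of m] by (simp add: g)
      qed auto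
      finally show ?thesis using jeq by (simp add: solid_gegen_def c_def sum_distrib_left)
    qed
    finally show ?thesis unfolding main t_def \<sigma>_def .
  qed
qed

lemma abs_solid_gegen_inner_sgn_le:
  fixes \<omega> :: "'a::euclidean_space"
  assumes "norm \<omega> = 1" "\<nu> \<ge> -1/2"
  shows "\<bar>solid_gegen \<nu> m (\<omega> \<bullet> sgn x) 1\<bar> \<le> (16 * (\<nu> + 2)) ^ m"
  using norm_solid_gegen_le[of \<nu> "\<omega> \<bullet> sgn x" 1 1 m] abs_inner_sgn_le[OF assms(1)] assms(2) by simp

lemma borel_measurable_solid_gegen_inner [measurable]:
  "(\<lambda>x::'a::euclidean_space. solid_gegen \<nu> m (\<omega> \<bullet> x) 1 :: real) \<in> borel_measurable borel"
  unfolding solid_gegen_def by measurable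

text \<open>By symmetry k \<le> m; then at most the leading power of the polynomial of degree k
  survives against degree m. Its coefficient cancels the constant of
  \<open>sphere_int_power_gegen\<close>, so in this normalization the zonal polynomials are
  reproducing kernels without further factors.\<close>

lemma sphere_int_gegen_gegen:
  fixes \<omega> \<mu> :: "'a::euclidean_space" and \<nu> :: real
  assumes n: "norm \<omega> = 1" "norm \<mu> = 1" and \<nu>: "\<nu> = (real DIM('a) - 2) / 2"
  shows "sphere_int (\<lambda>\<eta>::'a. solid_gegen \<nu> k (\<omega> \<bullet> \<eta>) 1 * solid_gegen \<nu> m (\<mu> \<bullet> \<eta>) 1) =
    (if k = m then sphere_int (\<lambda>_::'a. 1) * solid_gegen \<nu> m (\<omega> \<bullet> \<mu>) 1 else 0)"
proof -
  have \<nu>0: "\<nu> \<ge> -1/2" by (rule dim_index(2)[OF \<nu>])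
  have pos: "pochhammer (\<nu> + 1) k > 0" for k using \<nu>0 by (intro pochhammer_pos) auto
  have le: "sphere_int (\<lambda>\<eta>::'a. solid_gegen \<nu> k (\<omega> \<bullet> \<eta>) 1 * solid_gegen \<nu> m (\<mu> \<bullet> \<eta>) 1) =
    (if k = m then sphere_int (\<lambda>_::'a. 1) * solid_gegen \<nu> m (\<omega> \<bullet> \<mu>) 1 else 0)"
    if km: "k \<le> m" and n: "norm \<omega> = 1" "norm \<mu> = 1" for k m and \<omega> \<mu> :: 'a
  proof (cases "m = 0")
    case True
    thus ?thesis using km by (simp add: solid_gegen_def gegen_coeff_def)
  next
    case False
    hence m: "m \<ge> 1" by simp
    have "sphere_int (\<lambda>\<eta>::'a. solid_gegen \<nu> k (\<omega> \<bullet> \<eta>) 1 * solid_gegen \<nu> m (\<mu> \<bullet> \<eta>) 1) =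
      sphere_int (\<lambda>\<eta>::'a. \<Sum>i\<le>k div 2. gegen_coeff \<nu> k i * ((\<omega> \<bullet> \<eta>) ^ (k - 2 * i) * solid_gegen \<nu> m (\<mu> \<bullet> \<eta>) 1))"
      unfolding solid_gegen_def[of \<nu> k] sum_distrib_right by (simp add: mult.assoc)
    also have "\<dots> = (\<Sum>i\<le>k div 2. gegen_coeff \<nu> k i * sphere_int (\<lambda>\<eta>. (\<omega> \<bullet> \<eta>) ^ (k - 2 * i) * solid_gegen \<nu> m (\<mu> \<bullet> \<eta>) 1))"
    proof (rule sphere_int_sum[where M = "\<lambda>_. 1 * (16 * (\<nu> + 2)) ^ m"])
      fix i and x :: 'a
      have "\<bar>\<omega> \<bullet> sgn x\<bar> ^ (k - 2 * i) * \<bar>solid_gegen \<nu> m (\<mu> \<bullet> sgn x) 1\<bar> \<le> 1 * (16 * (\<nu> + 2)) ^ m"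
        using n \<nu>0 by (intro mult_mono power_le_one abs_inner_sgn_le abs_solid_gegen_inner_sgn_le) auto
      thus "\<bar>(\<omega> \<bullet> sgn x) ^ (k - 2 * i) * solid_gegen \<nu> m (\<mu> \<bullet> sgn x) 1\<bar> \<le> 1 * (16 * (\<nu> + 2)) ^ m"
        by (simp only: abs_mult power_abs)
    qed auto
    also have "\<dots> = (\<Sum>i\<le>k div 2. if i = 0 then gegen_coeff \<nu> k 0 * (if k = m then sphere_int (\<lambda>_::'a. 1) * (fact m / (2 ^ m * pochhammer (\<nu> + 1) m)) * solid_gegen \<nu> m (\<omega> \<bullet> \<mu>) 1 else 0) else 0)"
    proof (intro sum.cong refl)
      fix i assume "i \<in> {..k div 2}"
      hence "2 * i \<le> k" by auto
      hence "k - 2 * i = m \<longleftrightarrow> i = 0 \<and> k = m" "k - 2 * i \<le> m" using km m by auto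
      thus "gegen_coeff \<nu> k i * sphere_int (\<lambda>\<eta>. (\<omega> \<bullet> \<eta>) ^ (k - 2 * i) * solid_gegen \<nu> m (\<mu> \<bullet> \<eta>) 1) =
        (if i = 0 then gegen_coeff \<nu> k 0 * (if k = m then sphere_int (\<lambda>_::'a. 1) * (fact m / (2 ^ m * pochhammer (\<nu> + 1) m)) * solid_gegen \<nu> m (\<omega> \<bullet> \<mu>) 1 else 0) else 0)"
        by (simp add: sphere_int_power_gegen[OF n \<nu> _ m])
    qed
    also have "\<dots> = gegen_coeff \<nu> k 0 * (if k = m then sphere_int (\<lambda>_::'a. 1) * (fact m / (2 ^ m * pochhammer (\<nu> + 1) m)) * solid_gegen \<nu> m (\<omega> \<bullet> \<mu>) 1 else 0)"
      by (simp add: sum.delta)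
    also have "\<dots> = (if k = m then sphere_int (\<lambda>_::'a. 1) * solid_gegen \<nu> m (\<omega> \<bullet> \<mu>) 1 else 0)"
    proof -
      obtain m' where m': "m = Suc m'" using m by (cases m) auto
      have "gegen_coeff \<nu> m 0 = 2 ^ m * pochhammer (\<nu> + 1) m / fact m"
        using m' by (simp add: gegen_coeff_def pochhammer_Suc mult_ac add_ac)
      thus ?thesis using pos[of m] by auto
    qed
    finally show ?thesis .
  qed
  show ?thesis
  proof (cases "k \<le> m")
    case False
    thus ?thesis using le[of m k \<mu> \<omega>] n by (simp add: mult.commute)
  qed (use le n in auto)
qed

section \<open>Weber's second exponential integral\<close>

definition real_bessel_series :: "real \<Rightarrow> real \<Rightarrow> real" where
  "real_bessel_series \<mu> x = (\<Sum>j. rGamma (\<mu> + real j + 1) / fact j * x ^ j)"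

lemma summable_real_bessel_series_norm:
  assumes "\<mu> > -1"
  shows "summable (\<lambda>j. norm (rGamma (\<mu> + real j + 1) / fact j * x ^ j))"
  using summable_bessel_series_norm[OF assms, of "of_real x"]
  by (simp only: of_real_power[symmetric] of_real_mult[symmetric] norm_of_real real_norm_def)

lemma sums_real_bessel_series:
  assumes "\<mu> > -1"
  shows "(\<lambda>j. rGamma (\<mu> + real j + 1) / fact j * x ^ j) sums real_bessel_series \<mu> x"
  unfolding real_bessel_series_def
  by (intro summable_sums summable_norm_cancel[OF summable_real_bessel_series_norm] assms)

lemma bessel_series_of_real:
  assumes "\<mu> > -1"
  shows "bessel_series \<mu> (of_real x) = of_real (real_bessel_series \<mu> x)"
proof (rule sums_unique2[OF sums_bessel_series[OF assms]])
  have "(\<lambda>j. of_real (rGamma (\<mu> + real j + 1) / fact j * x ^ j) :: complex) sums of_real (real_bessel_series \<mu> x)"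
    by (rule sums_of_real[OF sums_real_bessel_series[OF assms]])
  thus "(\<lambda>j. of_real (rGamma (\<mu> + real j + 1) / fact j) * complex_of_real x ^ j) sums of_real (real_bessel_series \<mu> x)"
    by simp
qed

lemma has_sum_Times_real:
  fixes f :: "'a \<Rightarrow> real" and g :: "'b \<Rightarrow> real"
  assumes f: "(f has_sum S) A" and g: "(g has_sum T) B"
  shows "((\<lambda>(x, y). f x * g y) has_sum S * T) (A \<times> B)"
proof (rule has_sum_SigmaI)
  show "((\<lambda>y. case (x, y) of (x, y) \<Rightarrow> f x * g y) has_sum f x * T) B" for x
    using has_sum_cmult_right[OF g, of "f x"] by simp
  show "((\<lambda>x. f x * T) has_sum S * T) A"
    by (rule has_sum_cmult_left[OF f])
  have fa: "(\<lambda>x. norm (f x)) summable_on A" and ga: "(\<lambda>y. norm (g y)) summable_on B"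
    using summable_on_iff_abs_summable_on_real[THEN iffD1] f g summable_on_def by blast+
  have "(\<lambda>z. norm (case z of (x, y) \<Rightarrow> f x * g y)) summable_on A \<times> B"
  proof (rule Infinite_Sum.abs_summable_on_Sigma_iff[THEN iffD2], intro conjI ballI)
    show "(\<lambda>y. norm (case (x, y) of (x, y) \<Rightarrow> f x * g y)) summable_on B" for x
      using summable_on_cmult_right[OF ga, of "\<bar>f x\<bar>"] by (simp add: abs_mult)
    have "(\<lambda>x. \<bar>f x\<bar> * (\<Sum>\<^sub>\<infinity>y\<in>B. \<bar>g y\<bar>)) summable_on A"
      using summable_on_cmult_left[OF fa] by simp
    moreover have "(\<Sum>\<^sub>\<infinity>y\<in>B. \<bar>g y\<bar>) \<ge> 0" by (intro infsum_nonneg) auto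
    ultimately show "(\<lambda>x. norm (\<Sum>\<^sub>\<infinity>y\<in>B. norm (case (x, y) of (x, y) \<Rightarrow> f x * g y))) summable_on A"
      by (simp add: abs_mult infsum_cmult_right' abs_mult)
  qed
  thus "(\<lambda>(x, y). f x * g y) summable_on A \<times> B" by (rule abs_summable_summable)
qed

text \<open>The Chu-Vandermonde identity for j + (\<mu> + k) over k with real upper entry, rewritten
  in Gamma values. It is the coefficient identity behind Weber's integral.\<close>

lemma Gamma_Vandermonde:
  assumes \<mu>: "\<mu> > (-1::real)"
  shows "(\<Sum>l\<le>min j k. rGamma (\<mu> + real l + 1) / (fact l * fact (j - l) * fact (k - l))) =
    Gamma (\<mu> + real j + real k + 1) * (rGamma (\<mu> + real j + 1) / fact j) * (rGamma (\<mu> + real k + 1) / fact k)"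
proof -
  have pg: "pochhammer (\<mu> + real l + 1) n = Gamma (\<mu> + real (l + n) + 1) * rGamma (\<mu> + real l + 1)" for l n
  proof -
    have "\<mu> + real l + 1 \<notin> \<int>\<^sub>\<le>\<^sub>0" using \<mu> by (auto elim!: nonpos_Ints_cases)
    hence "pochhammer (\<mu> + real l + 1) n = Gamma (\<mu> + real l + 1 + real n) / Gamma (\<mu> + real l + 1)"
      by (rule pochhammer_Gamma)
    thus ?thesis by (simp add: rGamma_inverse_Gamma divide_inverse add_ac)
  qed
  have G: "Gamma (\<mu> + real l + 1) > 0" for l using \<mu> by (intro Gamma_real_pos) auto
  have "(\<Sum>l=0..k. (real j gchoose l) * (\<mu> + real k gchoose (k - l))) = (real j + (\<mu> + real k) gchoose k)"
    by (rule gbinomial_Vandermonde)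
  also have "real j + (\<mu> + real k) gchoose k = pochhammer (\<mu> + real j + 1) k / fact k"
    by (simp add: gbinomial_pochhammer' add_ac)
  also have "(\<Sum>l=0..k. (real j gchoose l) * (\<mu> + real k gchoose (k - l))) =
     (\<Sum>l\<le>min j k. (real j gchoose l) * (\<mu> + real k gchoose (k - l)))"
    by (intro sum.mono_neutral_right) (auto simp: binomial_gbinomial[symmetric])
  also have "\<dots> = (\<Sum>l\<le>min j k. fact j * Gamma (\<mu> + real k + 1) * (rGamma (\<mu> + real l + 1) / (fact l * fact (j - l) * fact (k - l))))"
  proof (intro sum.cong refl)
    fix l assume "l \<in> {..min j k}"
    hence l: "l \<le> j" "l \<le> k" by auto
    have 1: "real j gchoose l = fact j / (fact l * fact (j - l))"
      using l by (simp add: binomial_gbinomial[symmetric] binomial_fact)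
    have "\<mu> + real k gchoose (k - l) = pochhammer (\<mu> + real l + 1) (k - l) / fact (k - l)"
      using l by (simp add: gbinomial_pochhammer' of_nat_diff)
    also have "\<dots> = Gamma (\<mu> + real k + 1) * rGamma (\<mu> + real l + 1) / fact (k - l)"
      unfolding pg using l by simp
    finally show "(real j gchoose l) * (\<mu> + real k gchoose (k - l)) =
       fact j * Gamma (\<mu> + real k + 1) * (rGamma (\<mu> + real l + 1) / (fact l * fact (j - l) * fact (k - l)))"
      unfolding 1 by simp
  qed
  also have "\<dots> = fact j * Gamma (\<mu> + real k + 1) * (\<Sum>l\<le>min j k. rGamma (\<mu> + real l + 1) / (fact l * fact (j - l) * fact (k - l)))"
    by (simp only: sum_distrib_left)
  finally have eq: "fact j * Gamma (\<mu> + real k + 1) * (\<Sum>l\<le>min j k. rGamma (\<mu> + real l + 1) / (fact l * fact (j - l) * fact (k - l))) =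
    pochhammer (\<mu> + real j + 1) k / fact k" .
  have "(\<Sum>l\<le>min j k. rGamma (\<mu> + real l + 1) / (fact l * fact (j - l) * fact (k - l))) =
     (fact j * Gamma (\<mu> + real k + 1) * (\<Sum>l\<le>min j k. rGamma (\<mu> + real l + 1) / (fact l * fact (j - l) * fact (k - l)))) / (fact j * Gamma (\<mu> + real k + 1))"
    using G[of k] by simp
  thus ?thesis unfolding eq pg by (simp add: rGamma_inverse_Gamma divide_inverse mult_ac add_ac)
qed

text \<open>The right side is a triple series over p, q, l from two exponentials and a Bessel
  series. Absolute convergence allows regrouping by j = p + l and k = q + l, using (-\<alpha>)^l
  (-\<beta>)^l = (\<alpha> \<beta>)^l; the remaining finite sum over l is
  \<open>Gamma_Vandermonde\<close>.\<close>

lemma has_sum_Weber: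
  fixes \<mu> \<alpha> \<beta> :: real
  assumes \<mu>: "\<mu> > -1"
  defines "b \<equiv> \<lambda>j. rGamma (\<mu> + real j + 1) / fact j"
  shows "((\<lambda>(j, k). b j * b k * Gamma (\<mu> + real j + real k + 1) * (- \<alpha>) ^ j * (- \<beta>) ^ k) has_sum
     exp (- \<alpha>) * (exp (- \<beta>) * real_bessel_series \<mu> (\<alpha> * \<beta>))) UNIV"
proof -
  define T where "T = (\<lambda>(p, q, l). (- \<alpha>) ^ p / fact p * ((- \<beta>) ^ q / fact q * (b l * (\<alpha> * \<beta>) ^ l)))"
  have e: "((\<lambda>p. x ^ p / fact p) has_sum exp x) UNIV" for x :: real
  proof (rule norm_summable_imp_has_sum)
    show "summable (\<lambda>n. norm (x ^ n / fact n))" using summable_norm_exp[of x] by (simp add: field_simps)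
    show "(\<lambda>n. x ^ n / fact n) sums exp x" using exp_converges[of x] by (simp add: field_simps)
  qed
  have b: "((\<lambda>l. b l * (\<alpha> * \<beta>) ^ l) has_sum real_bessel_series \<mu> (\<alpha> * \<beta>)) UNIV"
    unfolding b_def by (intro norm_summable_imp_has_sum summable_real_bessel_series_norm sums_real_bessel_series \<mu>)
  have "(T has_sum exp (- \<alpha>) * (exp (- \<beta>) * real_bessel_series \<mu> (\<alpha> * \<beta>))) UNIV"
    using has_sum_Times_real[OF e[of "- \<alpha>"] has_sum_Times_real[OF e[of "- \<beta>"] b]]
    by (simp add: T_def case_prod_unfold)
  also have "?this \<longleftrightarrow> ((\<lambda>((j, k), l). T (j - l, k - l, l)) has_sum exp (- \<alpha>) * (exp (- \<beta>) * real_bessel_series \<mu> (\<alpha> * \<beta>)))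
     (Sigma UNIV (\<lambda>(j, k). {..min j k}))"
    by (rule has_sum_reindex_bij_witness[of _ "\<lambda>((j, k), l). (j - l, k - l, l)" "\<lambda>(p, q, l). ((p + l, q + l), l)"]) auto
  finally have "((\<lambda>jk. \<Sum>l\<in>(\<lambda>(j, k). {..min j k}) jk. T (fst jk - l, snd jk - l, l)) has_sum exp (- \<alpha>) * (exp (- \<beta>) * real_bessel_series \<mu> (\<alpha> * \<beta>))) UNIV"
    by (rule has_sum_SigmaD) (auto simp: case_prod_unfold intro!: has_sum_finite)
  also have "(\<lambda>jk. \<Sum>l\<in>(\<lambda>(j, k). {..min j k}) jk. T (fst jk - l, snd jk - l, l)) =
     (\<lambda>(j, k). b j * b k * Gamma (\<mu> + real j + real k + 1) * (- \<alpha>) ^ j * (- \<beta>) ^ k)"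
  proof
    fix jk :: "nat \<times> nat"
    obtain j k where jk: "jk = (j, k)" by (cases jk)
    have "T (j - l, k - l, l) = (- \<alpha>) ^ j * (- \<beta>) ^ k * (rGamma (\<mu> + real l + 1) / (fact l * fact (j - l) * fact (k - l)))"
      if "l \<le> min j k" for l
    proof -
      have "(- \<alpha>) ^ j = (- \<alpha>) ^ (j - l) * (- \<alpha>) ^ l" "(- \<beta>) ^ k = (- \<beta>) ^ (k - l) * (- \<beta>) ^ l"
        using that by (simp_all flip: power_add)
      moreover have "(- \<alpha>) ^ l * (- \<beta>) ^ l = (\<alpha> * \<beta>) ^ l" by (simp flip: power_mult_distrib)
      ultimately have "(- \<alpha>) ^ j * (- \<beta>) ^ k = (- \<alpha>) ^ (j - l) * (- \<beta>) ^ (k - l) * (\<alpha> * \<beta>) ^ l"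
        by (metis (no_types, lifting) mult.assoc mult.commute)
      thus ?thesis by (simp add: T_def b_def mult_ac)
    qed
    hence "(\<Sum>l\<le>min j k. T (j - l, k - l, l)) = (- \<alpha>) ^ j * (- \<beta>) ^ k * (\<Sum>l\<le>min j k. rGamma (\<mu> + real l + 1) / (fact l * fact (j - l) * fact (k - l)))"
      unfolding sum_distrib_left by (intro sum.cong) auto
    thus "(\<Sum>l\<in>(case jk of (j, k) \<Rightarrow> {..min j k}). T (fst jk - l, snd jk - l, l)) =
      (case jk of (j, k) \<Rightarrow> b j * b k * Gamma (\<mu> + real j + real k + 1) * (- \<alpha>) ^ j * (- \<beta>) ^ k)"
      unfolding Gamma_Vandermonde[OF \<mu>] jk by (simp add: b_def mult_ac)
  qed
  finally show ?thesis .
qed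

lemma square_sums_tendsto_has_sum:
  fixes f :: "nat \<times> nat \<Rightarrow> real"
  assumes "(f has_sum S) UNIV"
  shows "(\<lambda>M. \<Sum>j<M. \<Sum>k<M. f (j, k)) \<longlonglongrightarrow> S"
proof -
  have "(sum f \<longlongrightarrow> S) (finite_subsets_at_top UNIV)" using assms by (simp add: has_sum_def)
  moreover have "filterlim (\<lambda>M. {..<M} \<times> {..<M}) (finite_subsets_at_top (UNIV :: (nat \<times> nat) set)) sequentially"
    unfolding filterlim_finite_subsets_at_top
  proof (intro allI impI)
    fix X :: "(nat \<times> nat) set" assume X: "finite X \<and> X \<subseteq> UNIV"
    obtain M1 where M1: "\<And>x. x \<in> fst ` X \<Longrightarrow> x < M1" using X finite_nat_set_iff_bounded[of "fst ` X"] by auto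
    obtain M2 where M2: "\<And>x. x \<in> snd ` X \<Longrightarrow> x < M2" using X finite_nat_set_iff_bounded[of "snd ` X"] by auto
    show "\<forall>\<^sub>F M in sequentially. finite ({..<M} \<times> {..<M}) \<and> X \<subseteq> {..<M} \<times> {..<M} \<and> {..<M} \<times> {..<M} \<subseteq> UNIV"
      using eventually_ge_at_top[of "max M1 M2"]
    proof eventually_elim
      case (elim M)
      have "x < M \<and> y < M" if "(x, y) \<in> X" for x y
        using M1[of x] M2[of y] that elim by force
      thus ?case by auto
    qed
  qed
  ultimately have "(\<lambda>M. sum f ({..<M} \<times> {..<M})) \<longlonglongrightarrow> S" by (rule filterlim_compose)
  thus ?thesis by (simp add: sum.cartesian_product)
qed

text \<open>The bound is uniform in M and so provides the majorant for truncated series in Weber's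
  integral.\<close>

lemma sum_norm_real_bessel_series_le:
  assumes "\<mu> > -1" "L \<ge> 1"
  shows "(\<Sum>j<M. norm (rGamma (\<mu> + real j + 1) / fact j * x ^ j)) \<le> L powr (- \<mu>) * exp (L + \<bar>x\<bar> / L)"
proof -
  have E: "(\<lambda>j. (\<bar>x\<bar> / L) ^ j / fact j) sums exp (\<bar>x\<bar> / L)"
    using exp_converges[of "\<bar>x\<bar> / L"] by (simp add: divide_inverse mult.commute)
  have "L powr \<mu> * (\<Sum>j<M. norm (rGamma (\<mu> + real j + 1) / fact j * x ^ j)) \<le> (\<Sum>j<M. exp L * ((\<bar>x\<bar> / L) ^ j / fact j))"
    unfolding sum_distrib_left
  proof (rule sum_mono)
    fix j show "L powr \<mu> * norm (rGamma (\<mu> + real j + 1) / fact j * x ^ j) \<le> exp L * ((\<bar>x\<bar> / L) ^ j / fact j)"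
      using bessel_series_term_bound[OF assms, of j "of_real x"]
      by (simp only: of_real_power[symmetric] of_real_mult[symmetric] norm_of_real real_norm_def)
  qed
  also have "\<dots> = exp L * (\<Sum>j<M. (\<bar>x\<bar> / L) ^ j / fact j)" by (simp only: sum_distrib_left)
  also have "(\<Sum>j<M. (\<bar>x\<bar> / L) ^ j / fact j) \<le> exp (\<bar>x\<bar> / L)"
    unfolding sums_unique[OF E] using assms by (intro sum_le_suminf sums_summable[OF E]) auto
  finally have "L powr \<mu> * (\<Sum>j<M. norm (rGamma (\<mu> + real j + 1) / fact j * x ^ j)) \<le> exp L * exp (\<bar>x\<bar> / L)"
    by simp
  hence "L powr (- \<mu>) * (L powr \<mu> * (\<Sum>j<M. norm (rGamma (\<mu> + real j + 1) / fact j * x ^ j))) \<le> L powr (- \<mu>) * (exp L * exp (\<bar>x\<bar> / L))"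
    by (rule mult_left_mono) simp
  thus ?thesis using assms by (simp add: mult.assoc[symmetric] exp_add flip: powr_add)
qed

text \<open>Two oscillating Bessel functions of negative argument integrate to one of positive
  argument. Both series are truncated at M and integrated term by term with Gamma integrals; the
  resulting square sums converge by \<open>has_sum_Weber\<close> with \<alpha> = A / c and \<beta> =
  B / c, and the integrals converge by domination.\<close>

theorem Weber_second_exponential_integral:
  fixes \<mu> c A B :: real
  assumes \<mu>: "\<mu> > -1" and c: "c > 0" and A: "A \<ge> 0" and B: "B \<ge> 0"
  shows "has_bochner_integral lborel
    (\<lambda>s. s powr \<mu> * indicator {0..} s * exp (- c * s) * (real_bessel_series \<mu> (- A * s) * real_bessel_series \<mu> (- B * s)))
    (c powr (- \<mu> - 1) * exp (- (A + B) / c) * real_bessel_series \<mu> (A * B / c\<^sup>2))"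
proof -
  define b where "b = (\<lambda>j. rGamma (\<mu> + real j + 1) / fact j)"
  define w where "w = (\<lambda>s. s powr \<mu> * indicator {0..} s * exp (- c * s))"
  define \<Phi> where "\<Phi> = (\<lambda>M x. \<Sum>j<M. b j * x ^ j)"
  \<comment> \<open>The two truncated series together are bounded by a constant times exp ((A + B) /
    L s). This L makes the rate at most c / 2, so half of the decay exp (- c s) is left.\<close>
  define L where "L = max 1 (2 * (A + B) / c)"
  have L: "L \<ge> 1" "(A + B) / L \<le> c / 2"
  proof -
    show L1: "L \<ge> 1" by (simp add: L_def)
    have "2 * (A + B) / c \<le> L" by (simp add: L_def)
    thus "(A + B) / L \<le> c / 2" using c L1 by (simp add: field_simps)
  qed
  define K where "K = L powr (- \<mu>) * exp L * (L powr (- \<mu>) * exp L)"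
  have G: "integrable lborel (\<lambda>s. K * (s powr (\<mu> + 1 - 1) * indicator {0..} s * exp (- (c / 2) * s)))"
    using has_bochner_integral_Gamma[of "\<mu> + 1" "c / 2"] \<mu> c
    by (intro integrable_mult_right) (auto simp: has_bochner_integral_iff)
  have \<Phi>lim: "(\<lambda>M. \<Phi> M x) \<longlonglongrightarrow> real_bessel_series \<mu> x" for x
    using sums_real_bessel_series[OF \<mu>, of x] by (simp add: sums_def \<Phi>_def b_def)
  have \<Phi>bd: "\<bar>\<Phi> M x\<bar> \<le> L powr (- \<mu>) * exp (L + \<bar>x\<bar> / L)" for M x
  proof -
    have "\<bar>\<Phi> M x\<bar> \<le> (\<Sum>j<M. norm (b j * x ^ j))" unfolding \<Phi>_def real_norm_def by (rule sum_abs)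
    also have "\<dots> \<le> L powr (- \<mu>) * exp (L + \<bar>x\<bar> / L)"
      unfolding b_def by (rule sum_norm_real_bessel_series_le[OF \<mu> L(1)])
    finally show ?thesis .
  qed
  have bound: "norm (w s * (\<Phi> M (- A * s) * \<Phi> M (- B * s))) \<le> K * (s powr (\<mu> + 1 - 1) * indicator {0..} s * exp (- (c / 2) * s))" for M s
  proof (cases "s \<ge> 0")
    case True
    have "norm (w s * (\<Phi> M (- A * s) * \<Phi> M (- B * s))) = w s * (\<bar>\<Phi> M (- A * s)\<bar> * \<bar>\<Phi> M (- B * s)\<bar>)"
      by (simp add: w_def abs_mult)
    also have "\<dots> \<le> w s * ((L powr (- \<mu>) * exp (L + \<bar>- A * s\<bar> / L)) * (L powr (- \<mu>) * exp (L + \<bar>- B * s\<bar> / L)))"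
      by (intro mult_left_mono mult_mono \<Phi>bd) (auto simp: w_def)
    also have "\<dots> = K * (w s * exp ((A + B) / L * s))"
    proof -
      have "exp ((A + B) / L * s) = exp (\<bar>- A * s\<bar> / L) * exp (\<bar>- B * s\<bar> / L)"
        using True A B by (simp add: abs_mult add_divide_distrib distrib_right flip: exp_add)
      thus ?thesis by (simp only: K_def exp_add mult_ac)
    qed
    also have "\<dots> \<le> K * (w s * exp (c / 2 * s))"
    proof -
      have "(A + B) / L * s \<le> c / 2 * s" using L True by (intro mult_right_mono) auto
      thus ?thesis by (intro mult_left_mono) (auto simp: K_def w_def)
    qed
    also have "w s * exp (c / 2 * s) = s powr (\<mu> + 1 - 1) * indicator {0..} s * exp (- (c / 2) * s)"
      by (simp add: w_def mult.assoc flip: exp_add)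
    finally show ?thesis .
  qed (simp add: w_def)
  let ?f = "\<lambda>s. w s * (real_bessel_series \<mu> (- A * s) * real_bessel_series \<mu> (- B * s))"
  have meas: "(\<lambda>s. w s * (\<Phi> M (- A * s) * \<Phi> M (- B * s))) \<in> borel_measurable lborel" for M
    unfolding w_def \<Phi>_def by measurable
  have lim: "(\<lambda>M. w s * (\<Phi> M (- A * s) * \<Phi> M (- B * s))) \<longlonglongrightarrow> ?f s" for s
    by (intro tendsto_intros \<Phi>lim)
  have meas_f: "?f \<in> borel_measurable lborel"
    by (rule borel_measurable_LIMSEQ_metric[OF meas lim])
  note dc = meas_f meas G AE_I2[OF lim] AE_I2[OF bound]
  have int: "integrable lborel ?f" by (rule integrable_dominated_convergence[OF dc])
  have I: "(LINT s|lborel. w s * (\<Phi> M (- A * s) * \<Phi> M (- B * s))) = (\<Sum>j<M. \<Sum>k<M.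
      c powr (- \<mu> - 1) * (b j * b k * Gamma (\<mu> + real j + real k + 1) * (- (A / c)) ^ j * (- (B / c)) ^ k))" for M
  proof -
    have g: "has_bochner_integral lborel (\<lambda>s. w s * ((b j * (- A * s) ^ j) * (b k * (- B * s) ^ k)))
      (c powr (- \<mu> - 1) * (b j * b k * Gamma (\<mu> + real j + real k + 1) * (- (A / c)) ^ j * (- (B / c)) ^ k))" for j k
    proof -
      let ?x = "\<mu> + real j + real k + 1"
      have "has_bochner_integral lborel (\<lambda>s. (b j * b k * (- A) ^ j * (- B) ^ k) * (s powr (?x - 1) * indicator {0..} s * exp (- c * s)))
        ((b j * b k * (- A) ^ j * (- B) ^ k) * (Gamma ?x / c powr ?x))"
        using \<mu> c by (intro has_bochner_integral_mult_right has_bochner_integral_Gamma) auto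
      also have "(b j * b k * (- A) ^ j * (- B) ^ k) * (Gamma ?x / c powr ?x) =
         c powr (- \<mu> - 1) * (b j * b k * Gamma ?x * (- (A / c)) ^ j * (- (B / c)) ^ k)"
      proof -
        have "c powr ?x = c powr (\<mu> + 1) * c ^ j * c ^ k"
          using c by (simp add: powr_realpow[symmetric] powr_add[symmetric] add_ac)
        moreover have "c powr (- \<mu> - 1) = 1 / c powr (\<mu> + 1)"
          using c powr_minus_divide[of c "\<mu> + 1"] by simp
        moreover have "(- (A / c)) ^ j = (- A) ^ j / c ^ j" "(- (B / c)) ^ k = (- B) ^ k / c ^ k"
          by (simp_all flip: power_divide)
        ultimately show ?thesis by (simp add: mult_ac)
      qed
      finally show ?thesis
      proof (rule has_bochner_integral_cong_AE[THEN iffD1, rotated 3])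
        have "AE s in lborel. s \<noteq> (0::real)" by (rule AE_lborel_singleton)
        thus "AE s in lborel. (b j * b k * (- A) ^ j * (- B) ^ k) * (s powr (?x - 1) * indicator {0..} s * exp (- c * s)) =
           w s * ((b j * (- A * s) ^ j) * (b k * (- B * s) ^ k))"
        proof eventually_elim
          case (elim s)
          show ?case
          proof (cases "s \<ge> 0")
            case True
            hence "s > 0" using elim by simp
            hence p: "s powr (?x - 1) = s powr \<mu> * s ^ j * s ^ k" by (simp add: powr_add powr_realpow)
            show ?thesis unfolding p w_def power_mult_distrib by (simp only: mult_ac)
          qed (simp add: w_def)
        qed
      qed (auto simp: w_def)
    qed
    have "has_bochner_integral lborel (\<lambda>s. \<Sum>j<M. \<Sum>k<M. w s * ((b j * (- A * s) ^ j) * (b k * (- B * s) ^ k)))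
      (\<Sum>j<M. \<Sum>k<M. c powr (- \<mu> - 1) * (b j * b k * Gamma (\<mu> + real j + real k + 1) * (- (A / c)) ^ j * (- (B / c)) ^ k))"
      by (intro has_bochner_integral_sum g)
    moreover have "(\<lambda>s. \<Sum>j<M. \<Sum>k<M. w s * ((b j * (- A * s) ^ j) * (b k * (- B * s) ^ k))) =
       (\<lambda>s. w s * (\<Phi> M (- A * s) * \<Phi> M (- B * s)))"
      unfolding \<Phi>_def sum_product by (simp only: sum_distrib_left)
    ultimately show ?thesis by (simp only: has_bochner_integral_integral_eq)
  qed
  have "(\<lambda>M. \<Sum>j<M. \<Sum>k<M. c powr (- \<mu> - 1) * (b j * b k * Gamma (\<mu> + real j + real k + 1) * (- (A / c)) ^ j * (- (B / c)) ^ k))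
     \<longlonglongrightarrow> c powr (- \<mu> - 1) * (exp (- (A / c)) * (exp (- (B / c)) * real_bessel_series \<mu> (A / c * (B / c))))"
    using square_sums_tendsto_has_sum[OF has_sum_cmult_right[OF has_sum_Weber[OF \<mu>, of "A / c" "B / c"], of "c powr (- \<mu> - 1)"]]
    by (simp add: b_def)
  moreover have "(\<lambda>M. LINT s|lborel. w s * (\<Phi> M (- A * s) * \<Phi> M (- B * s))) \<longlonglongrightarrow> (LINT s|lborel. ?f s)"
    by (rule integral_dominated_convergence[OF dc])
  ultimately have "(LINT s|lborel. ?f s) = c powr (- \<mu> - 1) * (exp (- (A / c)) * (exp (- (B / c)) * real_bessel_series \<mu> (A / c * (B / c))))"
    unfolding I by (rule LIMSEQ_unique[rotated])
  also have "exp (- (A / c)) * (exp (- (B / c)) * real_bessel_series \<mu> (A / c * (B / c))) =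
     exp (- (A + B) / c) * real_bessel_series \<mu> (A * B / c\<^sup>2)"
    by (simp add: power2_eq_square exp_add[symmetric] add_divide_distrib diff_divide_distrib mult.assoc[symmetric] del: exp_add)
  finally show ?thesis using int
    by (simp add: has_bochner_integral_iff w_def mult_ac)
qed

section \<open>Modes of the heat kernel\<close>

text \<open>With D = 32 (\<nu> + 2), twice the rate of the zonal bound, the zonal factor is at most
  2^-m (D X)^m. The choice L = max 1 ((D X) powr (a / 2)) gives (D X)^m \<le> L powr (2 m / a) = L
  powr \<mu> L powr (- 2 \<nu> / a), and the Bessel bound absorbs L powr \<mu>. Three factors exp L
  remain: one from L powr (- 2 \<nu> / a) \<le> L, which uses 2 \<nu> / a > -1, one from the Bessel
  bound, and one from exp (|z| / L), as |z| \<le> X powr a \<le> L^2.\<close>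

lemma norm_gegen_bessel_le:
  fixes p q z :: complex and \<nu> a X :: real
  assumes \<nu>: "\<nu> \<ge> -1/2" and a: "a > 0" and b\<nu>: "2 / a * \<nu> > -1" and X: "X \<ge> 0"
    and p: "norm p \<le> X" and q: "norm q \<le> X ^ 2" and z: "norm z \<le> X powr a"
  shows "norm (solid_gegen \<nu> m p q * bessel_series (2 / a * (real m + \<nu>)) z) \<le>
    (1 / 2) ^ m * exp (3 + 3 * (32 * (\<nu> + 2) * X) powr (a / 2))"
proof -
  define D where "D = 32 * (\<nu> + 2)"
  have D: "D \<ge> 1" using \<nu> by (simp add: D_def)
  define L where "L = max 1 ((D * X) powr (a / 2))"
  define \<mu> where "\<mu> = 2 / a * (real m + \<nu>)"
  have L1: "L \<ge> 1" by (simp add: L_def)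
  have \<mu>: "\<mu> > -1" unfolding \<mu>_def by (rule bessel_index_gt[OF a b\<nu>])
  have DX: "D * X \<le> L powr (2 / a)"
  proof -
    have "D * X = ((D * X) powr (a / 2)) powr (2 / a)" using a D X by (simp add: powr_powr)
    also have "\<dots> \<le> L powr (2 / a)" using a by (intro powr_mono2) (auto simp: L_def)
    finally show ?thesis .
  qed
  have "(D * X) ^ m \<le> (L powr (2 / a)) ^ m" using DX D X by (intro power_mono) auto
  also have "\<dots> = L powr \<mu> * L powr (- (2 / a * \<nu>))"
  proof -
    have "\<mu> + - (2 / a * \<nu>) = real m * (2 / a)" unfolding \<mu>_def by (simp add: algebra_simps add_divide_distrib)
    hence "L powr \<mu> * L powr (- (2 / a * \<nu>)) = L powr (real m * (2 / a))" by (simp only: powr_add[symmetric])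
    thus ?thesis using L1 by (simp add: powr_power mult.commute)
  qed
  also have "\<dots> \<le> L powr \<mu> * exp L"
  proof (rule mult_left_mono)
    have "L powr (- (2 / a * \<nu>)) \<le> L powr 1" using b\<nu> L1 by (intro powr_mono) auto
    also have "L powr 1 = L" using L1 by simp
    also have "L \<le> exp L" using exp_ge_add_one_self[of L] by linarith
    finally show "L powr (- (2 / a * \<nu>)) \<le> exp L" .
  qed simp
  finally have DXm: "(D * X) ^ m \<le> L powr \<mu> * exp L" .
  have "norm (solid_gegen \<nu> m p q) \<le> (16 * (\<nu> + 2) * X) ^ m" by (rule norm_solid_gegen_le[OF \<nu> p q])
  also have "16 * (\<nu> + 2) * X = 1 / 2 * (D * X)" by (simp add: D_def)
  also have "(1 / 2 * (D * X)) ^ m = (1 / 2) ^ m * (D * X) ^ m" by (simp only: power_mult_distrib)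
  also have "\<dots> \<le> (1 / 2) ^ m * (L powr \<mu> * exp L)" using DXm by (intro mult_left_mono) auto
  finally have Z: "norm (solid_gegen \<nu> m p q) \<le> (1 / 2) ^ m * (L powr \<mu> * exp L)" .
  have zL: "norm z / L \<le> L"
  proof -
    have "X powr (a / 2) \<le> (D * X) powr (a / 2)"
      using D X a by (intro powr_mono2) (auto simp: mult_le_cancel_right1)
    also have "\<dots> \<le> L" by (simp add: L_def)
    finally have "X powr (a / 2) * X powr (a / 2) \<le> L * L" using L1 by (intro mult_mono) auto
    also have "X powr (a / 2) * X powr (a / 2) = X powr a" by (simp flip: powr_add)
    finally show ?thesis using z L1 by (simp add: divide_le_eq)
  qed
  have "norm (solid_gegen \<nu> m p q * bessel_series \<mu> z) \<le> ((1 / 2) ^ m * (L powr \<mu> * exp L)) * norm (bessel_series \<mu> z)"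
    unfolding norm_mult by (intro mult_right_mono Z) auto
  also have "\<dots> = (1 / 2) ^ m * exp L * (L powr \<mu> * norm (bessel_series \<mu> z))" by simp
  also have "\<dots> \<le> (1 / 2) ^ m * exp L * exp (L + norm z / L)"
    by (intro mult_left_mono norm_bessel_series_le \<mu> L1) auto
  also have "\<dots> \<le> (1 / 2) ^ m * exp L * exp (L + L)" using zL by (intro mult_left_mono) auto
  also have "\<dots> = (1 / 2) ^ m * exp (3 * L)" by (simp add: mult.assoc flip: exp_add)
  also have "\<dots> \<le> (1 / 2) ^ m * exp (3 + 3 * (D * X) powr (a / 2))"
  proof -
    have "L \<le> 1 + (D * X) powr (a / 2)" by (auto simp: L_def max_def)
    thus ?thesis by (intro mult_left_mono) auto
  qed
  finally show ?thesis by (simp add: \<mu>_def D_def)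
qed

lemma real_bessel_series_eq_Re:
  assumes "\<mu> > -1"
  shows "real_bessel_series \<mu> x = Re (bessel_series \<mu> (of_real x))"
  using bessel_series_of_real[OF assms, of x] by simp

lemma continuous_on_bessel_series: "\<mu> > -1 \<Longrightarrow> continuous_on A (bessel_series \<mu>)"
  by (intro continuous_at_imp_continuous_on ballI DERIV_isCont[OF DERIV_bessel_series])

lemma borel_measurable_real_bessel_series [measurable]:
  assumes "\<mu> > -1"
  shows "real_bessel_series \<mu> \<in> borel_measurable borel"
proof (rule borel_measurable_continuous_onI)
  have "continuous_on UNIV (\<lambda>x. Re (bessel_series \<mu> (of_real x)))"
    by (intro continuous_intros continuous_on_compose2[OF continuous_on_bessel_series[OF assms, of UNIV]]) auto
  also have "(\<lambda>x. Re (bessel_series \<mu> (of_real x))) = real_bessel_series \<mu>"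
    using real_bessel_series_eq_Re[OF assms] by (intro ext) (rule sym)
  finally show "continuous_on UNIV (real_bessel_series \<mu>)" .
qed

text \<open>Two different indices are allowed because an off-diagonal pair of modes vanishes through
  its angular factor only if its radial integral exists.\<close>

lemma integrable_bessel_product:
  assumes \<mu>: "\<mu> > -1" "\<mu>' > -1" and p: "p > -1" and c: "c > 0" and A: "A \<ge> 0" and B: "B \<ge> 0"
  shows "integrable lborel (\<lambda>s. s powr p * indicator {0..} s * exp (- c * s) * (real_bessel_series \<mu> (- A * s) * real_bessel_series \<mu>' (- B * s)))"
proof -
  note [measurable] = borel_measurable_real_bessel_series[OF \<mu>(1)] borel_measurable_real_bessel_series[OF \<mu>(2)]
  define L where "L = max 1 (2 * (A + B) / c)"
  have L: "L \<ge> 1" "(A + B) / L \<le> c / 2"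
  proof -
    show L1: "L \<ge> 1" by (simp add: L_def)
    have "2 * (A + B) / c \<le> L" by (simp add: L_def)
    thus "(A + B) / L \<le> c / 2" using c L1 by (simp add: field_simps)
  qed
  have bd: "\<bar>real_bessel_series \<mu> x\<bar> \<le> L powr (- \<mu>) * exp (L + \<bar>x\<bar> / L)" if "\<mu> > -1" for \<mu> x
  proof -
    have "L powr (- \<mu>) * (L powr \<mu> * norm (bessel_series \<mu> (of_real x))) \<le> L powr (- \<mu>) * exp (L + norm (complex_of_real x) / L)"
      by (intro mult_left_mono norm_bessel_series_le that L) auto
    thus ?thesis using L unfolding bessel_series_of_real[OF that] by (simp add: mult.assoc[symmetric] flip: powr_add)
  qed
  define K where "K = L powr (- \<mu>) * exp L * (L powr (- \<mu>') * exp L)"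
  have "integrable lborel (\<lambda>s. K * (s powr (p + 1 - 1) * indicator {0..} s * exp (- (c / 2) * s)))"
    using has_bochner_integral_Gamma[of "p + 1" "c / 2"] p c
    by (intro integrable_mult_right) (auto simp: has_bochner_integral_iff)
  thus ?thesis
  proof (rule Bochner_Integration.integrable_bound)
    show "AE s in lborel. norm (s powr p * indicator {0..} s * exp (- c * s) * (real_bessel_series \<mu> (- A * s) * real_bessel_series \<mu>' (- B * s)))
      \<le> norm (K * (s powr (p + 1 - 1) * indicator {0..} s * exp (- (c / 2) * s)))"
    proof (rule AE_I2)
      fix s :: real
      show "norm (s powr p * indicator {0..} s * exp (- c * s) * (real_bessel_series \<mu> (- A * s) * real_bessel_series \<mu>' (- B * s)))
        \<le> norm (K * (s powr (p + 1 - 1) * indicator {0..} s * exp (- (c / 2) * s)))"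
      proof (cases "s \<ge> 0")
        case True
        have "norm (s powr p * indicator {0..} s * exp (- c * s) * (real_bessel_series \<mu> (- A * s) * real_bessel_series \<mu>' (- B * s))) =
          s powr p * exp (- c * s) * (\<bar>real_bessel_series \<mu> (- A * s)\<bar> * \<bar>real_bessel_series \<mu>' (- B * s)\<bar>)"
          using True by (simp add: abs_mult)
        also have "\<dots> \<le> s powr p * exp (- c * s) * ((L powr (- \<mu>) * exp (L + \<bar>- A * s\<bar> / L)) * (L powr (- \<mu>') * exp (L + \<bar>- B * s\<bar> / L)))"
          by (intro mult_left_mono mult_mono bd \<mu>) auto
        also have "\<dots> = K * (s powr p * exp (- c * s) * exp ((A + B) / L * s))"
        proof -
          have "exp ((A + B) / L * s) = exp (\<bar>- A * s\<bar> / L) * exp (\<bar>- B * s\<bar> / L)"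
            using True A B by (simp add: abs_mult add_divide_distrib distrib_right flip: exp_add)
          thus ?thesis by (simp only: K_def exp_add mult_ac)
        qed
        also have "\<dots> \<le> K * (s powr p * exp (- c * s) * exp (c / 2 * s))"
        proof -
          have "(A + B) / L * s \<le> c / 2 * s" using L True by (intro mult_right_mono) auto
          thus ?thesis by (intro mult_left_mono) (auto simp: K_def)
        qed
        also have "s powr p * exp (- c * s) * exp (c / 2 * s) = s powr (p + 1 - 1) * indicator {0..} s * exp (- (c / 2) * s)"
          using True by (simp add: mult.assoc flip: exp_add)
        also have "K * \<dots> \<le> norm (K * \<dots>)" by simp
        finally show ?thesis .
      qed simp
    qed
  qed measurable
qed

text \<open>p, q, Q, \<rho> stand for x \<bullet> y, |x|^2 |y|^2, |x| powr a and |y| powr a, but are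
  independent complex arguments so that time and coordinate lines can be complexified. Putting
  powers of \<tau> inside the zonal polynomial leaves a prefactor independent of m, and
  \<open>norm_gegen_bessel_le\<close> applies with X scaled by |\<tau>| powr (- 2 / a).\<close>

definition heat_mode :: "real \<Rightarrow> real \<Rightarrow> nat \<Rightarrow> complex \<Rightarrow> complex \<Rightarrow> complex \<Rightarrow> complex \<Rightarrow> complex \<Rightarrow> complex" where
  "heat_mode a \<nu> m \<tau> p q Q \<rho> =
     \<tau> powr of_real (- (2 / a * \<nu> + 1)) *
     (solid_gegen \<nu> m (\<tau> powr of_real (- (2 / a)) * p) ((\<tau> powr of_real (- (2 / a))) ^ 2 * q) *
      bessel_series (2 / a * (real m + \<nu>)) (Q * \<rho> / \<tau> ^ 2)) * exp (- ((Q + \<rho>) / \<tau>))"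

lemma norm_heat_mode_le:
  fixes p q Q \<rho> \<tau> :: complex and \<nu> a X :: real
  assumes \<nu>: "\<nu> \<ge> -1/2" and a: "a > 0" and b\<nu>: "2 / a * \<nu> > -1" and X: "X \<ge> 0" and \<tau>: "\<tau> \<noteq> 0"
    and p: "norm p \<le> X" and q: "norm q \<le> X ^ 2" and Q: "norm (Q * \<rho>) \<le> X powr a"
  shows "norm (heat_mode a \<nu> m \<tau> p q Q \<rho>) \<le>
    norm \<tau> powr (- (2 / a * \<nu> + 1)) * ((1 / 2) ^ m * exp (3 + 3 * ((32 * (\<nu> + 2)) powr (a / 2) * X powr (a / 2) / norm \<tau>))) *
      exp (- Re ((Q + \<rho>) / \<tau>))"
proof -
  define T where "T = norm \<tau>"
  have T: "T > 0" using \<tau> by (simp add: T_def)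
  define Y where "Y = T powr (- (2 / a)) * X"
  have n: "norm (\<tau> powr of_real r) = T powr r" for r by (simp add: norm_powr_real_powr' T_def)
  define G where "G = solid_gegen \<nu> m (\<tau> powr of_real (- (2 / a)) * p) ((\<tau> powr of_real (- (2 / a))) ^ 2 * q) *
      bessel_series (2 / a * (real m + \<nu>)) (Q * \<rho> / \<tau> ^ 2)"
  have "norm G \<le> (1 / 2) ^ m * exp (3 + 3 * (32 * (\<nu> + 2) * Y) powr (a / 2))"
    unfolding G_def
  proof (rule norm_gegen_bessel_le[OF \<nu> a b\<nu>])
    show "Y \<ge> 0" using X by (simp add: Y_def)
    show "norm (\<tau> powr of_real (- (2 / a)) * p) \<le> Y"
      unfolding norm_mult n Y_def using p by (intro mult_left_mono) auto
    show "norm ((\<tau> powr of_real (- (2 / a))) ^ 2 * q) \<le> Y\<^sup>2"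
      unfolding norm_mult norm_power n Y_def power_mult_distrib using q by (intro mult_left_mono) auto
    have "Y powr a = X powr a / T\<^sup>2"
    proof -
      have "(T powr (- (2 / a))) powr a = T powr (- 2)" using a by (simp add: powr_powr)
      also have "\<dots> = 1 / T\<^sup>2" using T by (simp add: powr_neg_numeral)
      finally show ?thesis unfolding Y_def using X T by (subst powr_mult) auto
    qed
    thus "norm (Q * \<rho> / \<tau>\<^sup>2) \<le> Y powr a"
      using Q by (simp add: norm_divide norm_power T_def divide_right_mono)
  qed
  also have "(32 * (\<nu> + 2) * Y) powr (a / 2) = (32 * (\<nu> + 2)) powr (a / 2) * X powr (a / 2) / T"
  proof -
    have "(T powr (- (2 / a))) powr (a / 2) = T powr (- 1)" using a by (simp add: powr_powr)
    also have "\<dots> = 1 / T" using T by (simp add: powr_neg_one)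
    finally have "Y powr (a / 2) = 1 / T * X powr (a / 2)" unfolding Y_def using X T by (subst powr_mult) auto
    thus ?thesis using X \<nu> by (subst powr_mult) (auto simp: Y_def)
  qed
  finally have G: "norm G \<le> (1 / 2) ^ m * exp (3 + 3 * ((32 * (\<nu> + 2)) powr (a / 2) * X powr (a / 2) / T))" .
  have "norm (heat_mode a \<nu> m \<tau> p q Q \<rho>) = T powr (- (2 / a * \<nu> + 1)) * norm G * exp (- Re ((Q + \<rho>) / \<tau>))"
    unfolding heat_mode_def G_def[symmetric] norm_mult n norm_exp_eq_Re uminus_complex.sel ..
  also have "\<dots> \<le> T powr (- (2 / a * \<nu> + 1)) * ((1 / 2) ^ m * exp (3 + 3 * ((32 * (\<nu> + 2)) powr (a / 2) * X powr (a / 2) / T))) * exp (- Re ((Q + \<rho>) / \<tau>))"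
    by (intro mult_right_mono mult_left_mono G) auto
  finally show ?thesis unfolding T_def .
qed

text \<open>S stands for |\<xi>| powr a. The prefactor is ((r |\<xi>|) powr (a / 2) / a) powr (2 m /
  a) written as a power of S; with the phase split off, the modes are real.\<close>

definition kernel_mode :: "real \<Rightarrow> real \<Rightarrow> nat \<Rightarrow> real \<Rightarrow> real \<Rightarrow> real" where
  "kernel_mode a \<nu> m r S = a powr (- (2 / a * real m)) * r ^ m * S powr (real m / a) *
     real_bessel_series (2 / a * (real m + \<nu>)) (- (r powr a / a\<^sup>2) * S)"

text \<open>Here w / 2 = - i y with y = (r s) powr (a / 2) / a > 0. The principal power therefore
  splits into a unimodular phase and a real power of y, and the Bessel series is evaluated at the
  real number - y^2.\<close>

lemma kernel_term_eq:
  fixes \<nu> a r s c :: real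
  assumes a: "a > 0" and b\<nu>: "2 / a * \<nu> > -1" and r: "r > 0" and s: "s > 0"
  defines "w \<equiv> of_real (2 * (r * s) powr (a / 2)) / (of_real a * \<i>) :: complex"
  shows "principal_power (w / 2) (2 / a * real m) * bessel_I_normalized (2 / a * (real m + \<nu>)) w * of_real c =
    (- \<i>) powr of_real (2 / a * real m) * of_real (kernel_mode a \<nu> m r (s powr a) * c)"
proof -
  define y where "y = (r * s) powr (a / 2) / a"
  have y: "y > 0" using a r s by (simp add: y_def)
  have w2: "w / 2 = of_real y * (- \<i>)"
    using a by (simp add: w_def y_def field_simps)
  have y2: "y\<^sup>2 = r powr a / a\<^sup>2 * s powr a"
    using r s by (simp add: y_def power2_eq_square powr_mult field_simps flip: powr_add)
  have yb: "y powr (2 / a * real m) = a powr (- (2 / a * real m)) * r ^ m * (s powr a) powr (real m / a)"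
  proof -
    have "y powr (2 / a * real m) = ((r * s) powr (a / 2)) powr (2 / a * real m) / a powr (2 / a * real m)"
      unfolding y_def using a r s by (subst powr_divide) auto
    also have "((r * s) powr (a / 2)) powr (2 / a * real m) = r ^ m * s ^ m"
      using a r s by (simp add: powr_powr powr_realpow power_mult_distrib)
    also have "s ^ m = (s powr a) powr (real m / a)"
      using a s by (simp add: powr_powr powr_realpow)
    finally show ?thesis by (simp add: powr_minus divide_inverse mult_ac)
  qed
  have "principal_power (w / 2) (2 / a * real m) = (- \<i>) powr of_real (2 / a * real m) * of_real (y powr (2 / a * real m))"
  proof (cases "m = 0")
    case False
    hence "principal_power (w / 2) (2 / a * real m) = (of_real y * (- \<i>)) powr of_real (2 / a * real m)"
      using a by (simp add: principal_power_def w2)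
    also have "\<dots> = of_real y powr of_real (2 / a * real m) * (- \<i>) powr of_real (2 / a * real m)"
      using y by (intro powr_times_real_left) auto
    also have "of_real y powr (of_real (2 / a * real m) :: complex) = of_real (y powr (2 / a * real m))"
      using y by (intro powr_of_real) auto
    finally show ?thesis by (simp only: mult.commute)
  qed (use y in \<open>simp add: principal_power_def\<close>)
  moreover have "bessel_I_normalized (2 / a * (real m + \<nu>)) w = of_real (real_bessel_series (2 / a * (real m + \<nu>)) (- (r powr a / a\<^sup>2) * s powr a))"
  proof -
    note \<mu> = bessel_index_gt[OF a b\<nu>, of m]
    have "(w / 2)\<^sup>2 = of_real (- (y\<^sup>2))" unfolding w2 by (simp add: power_mult_distrib)
    also have "- (y\<^sup>2) = - (r powr a / a\<^sup>2) * s powr a" unfolding y2 by simp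
    finally show ?thesis unfolding bessel_I_normalized_eq by (simp only: bessel_series_of_real[OF \<mu>])
  qed
  ultimately show ?thesis unfolding yb kernel_mode_def by (simp only: of_real_mult mult_ac)
qed

text \<open>For X = r s a powr (- 2 / a) the prefactor of the mode is X^m and the Bessel argument
  has modulus X powr a, so \<open>norm_gegen_bessel_le\<close> applies.\<close>

lemma norm_kernel_term_le:
  fixes \<nu> a r s c :: real
  assumes \<nu>: "\<nu> \<ge> -1/2" and a: "a > 0" and b\<nu>: "2 / a * \<nu> > -1" and r: "r > 0" and s: "s > 0" and c: "\<bar>c\<bar> \<le> 1"
  shows "\<bar>kernel_mode a \<nu> m r (s powr a) * solid_gegen \<nu> m c 1\<bar> \<le>
    (1 / 2) ^ m * exp (3 + 3 * ((32 * (\<nu> + 2) * r * a powr (- (2 / a))) powr (a / 2) * s powr (a / 2)))"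
proof -
  define X where "X = r * s * a powr (- (2 / a))"
  have X: "X \<ge> 0" using r s by (simp add: X_def)
  note \<mu> = bessel_index_gt[OF a b\<nu>, of m]
  let ?z = "- (r powr a / a\<^sup>2) * s powr a"
  have Xm: "X ^ m = a powr (- (2 / a * real m)) * r ^ m * (s powr a) powr (real m / a)"
  proof -
    have "(s powr a) powr (real m / a) = s ^ m" using a s by (simp add: powr_powr powr_realpow)
    moreover have "(a powr (- (2 / a))) ^ m = a powr (- (2 / a * real m))"
      using a by (simp add: powr_power mult.commute)
    ultimately show ?thesis by (simp add: X_def power_mult_distrib)
  qed
  have Xa: "X powr a = r powr a / a\<^sup>2 * s powr a"
  proof -
    have "(a powr (- (2 / a))) powr a = a powr (- 2)" using a by (simp add: powr_powr)
    also have "\<dots> = 1 / a\<^sup>2" using a by (simp add: powr_neg_numeral)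
    finally show ?thesis using r s unfolding X_def by (simp add: powr_mult)
  qed
  have "\<bar>kernel_mode a \<nu> m r (s powr a) * solid_gegen \<nu> m c 1\<bar> =
    norm (solid_gegen \<nu> m (of_real (X * c)) (of_real (X\<^sup>2 * 1)) * bessel_series (2 / a * (real m + \<nu>)) (of_real ?z))"
  proof -
    have "kernel_mode a \<nu> m r (s powr a) = X ^ m * real_bessel_series (2 / a * (real m + \<nu>)) ?z"
      by (simp only: kernel_mode_def Xm)
    thus ?thesis
      unfolding solid_gegen_of_real bessel_series_of_real[OF \<mu>] solid_gegen_scale norm_mult norm_of_real
      by (simp only: abs_mult mult_ac)
  qed
  also have "\<dots> \<le> (1 / 2) ^ m * exp (3 + 3 * (32 * (\<nu> + 2) * X) powr (a / 2))"
  proof (rule norm_gegen_bessel_le[OF \<nu> a b\<nu> X])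
    show "norm (complex_of_real (X * c)) \<le> X"
      using c X by (simp only: norm_of_real abs_mult) (simp add: mult_left_le)
    show "norm (complex_of_real (X\<^sup>2 * 1)) \<le> X\<^sup>2" by (simp only: norm_of_real) simp
    show "norm (complex_of_real ?z) \<le> X powr a" unfolding Xa norm_of_real by (simp add: abs_mult)
  qed
  also have "32 * (\<nu> + 2) * X = (32 * (\<nu> + 2) * r * a powr (- (2 / a))) * s" by (simp add: X_def)
  also have "((32 * (\<nu> + 2) * r * a powr (- (2 / a))) * s) powr (a / 2) = (32 * (\<nu> + 2) * r * a powr (- (2 / a))) powr (a / 2) * s powr (a / 2)"
    using r s \<nu> by (subst powr_mult) auto
  finally show ?thesis .
qed

lemma heat_mode_of_real:
  fixes T p q Q \<rho> :: real
  assumes T: "T > 0" and \<mu>: "2 / a * (real m + \<nu>) > -1"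
  shows "heat_mode a \<nu> m (of_real T) (of_real p) (of_real q) (of_real Q) (of_real \<rho>) =
    of_real (T powr (- (2 / a * \<nu> + 1)) *
     (solid_gegen \<nu> m (T powr (- (2 / a)) * p) ((T powr (- (2 / a))) ^ 2 * q) *
      real_bessel_series (2 / a * (real m + \<nu>)) (Q * \<rho> / T ^ 2)) * exp (- ((Q + \<rho>) / T)))"
proof -
  have pw: "of_real T powr (of_real r :: complex) = of_real (T powr r)" for r
    using T by (intro powr_of_real) auto
  show ?thesis
    unfolding heat_mode_def pw
    by (simp only: of_real_mult[symmetric] of_real_power[symmetric] of_real_divide[symmetric] of_real_add[symmetric]
      of_real_minus[symmetric] solid_gegen_of_real bessel_series_of_real[OF \<mu>] exp_of_real)
qed

text \<open>In the variable S = |\<xi>| powr a the volume, the weight and the two modes contribute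
  the exponents N / a - 1, (a - 2) / a and (m + n) / a, in total p = (2 \<nu> + m + n) / a. For m =
  n this is exactly the common Bessel index, as Weber's integral demands.\<close>

lemma has_bochner_integral_kernel_modes:
  fixes x y :: "'a::euclidean_space" and a t \<nu> :: real
  assumes a: "a > 0" "a > 2 - real DIM('a)" and \<nu>: "\<nu> = (real DIM('a) - 2) / 2"
    and x: "x \<noteq> 0" and y: "y \<noteq> 0" and t: "t > 0"
  shows "has_bochner_integral lborel (\<lambda>\<xi>.
     (kernel_mode a \<nu> m (norm x) (norm \<xi> powr a) * solid_gegen \<nu> m (sgn x \<bullet> sgn \<xi>) 1) *
     (kernel_mode a \<nu> n (norm y) (norm \<xi> powr a) * solid_gegen \<nu> n (sgn y \<bullet> sgn \<xi>) 1) *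
     (exp (- (t / a) * norm \<xi> powr a) / norm \<xi> powr (2 - a)))
    (if m = n then real DIM('a) / a * sphere_int (\<lambda>_::'a. 1) * solid_gegen \<nu> m (sgn x \<bullet> sgn y) 1 *
       (a powr (- (2 / a * real m)) * norm x ^ m * (a powr (- (2 / a * real m)) * norm y ^ m) *
        ((t / a) powr (- (2 / a * (real m + \<nu>)) - 1) * exp (- (norm x powr a / a\<^sup>2 + norm y powr a / a\<^sup>2) / (t / a)) *
         real_bessel_series (2 / a * (real m + \<nu>)) (norm x powr a / a\<^sup>2 * (norm y powr a / a\<^sup>2) / (t / a)\<^sup>2)))
     else 0)"
    (is "has_bochner_integral _ ?F _")
proof -
  note N = dim_index(1)[OF \<nu>] and \<nu>0 = dim_index(2)[OF \<nu>] and \<mu> = dim_bessel_index(2)[OF a \<nu>]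
  have ux: "norm (sgn x) = 1" and uy: "norm (sgn y) = 1" using x y by (simp_all add: norm_sgn)
  note [measurable] = borel_measurable_real_bessel_series[OF \<mu>]
  define g where "g = (\<lambda>S. kernel_mode a \<nu> m (norm x) S * kernel_mode a \<nu> n (norm y) S * (exp (- (t / a) * S) * S powr ((a - 2) / a)))"
  define A where "A = (\<lambda>\<eta>::'a. solid_gegen \<nu> m (sgn x \<bullet> \<eta>) 1 * solid_gegen \<nu> n (sgn y \<bullet> \<eta>) (1::real))"
  define \<kappa> where "\<kappa> = a powr (- (2 / a * real m)) * norm x ^ m * (a powr (- (2 / a * real n)) * norm y ^ n)"
  define p where "p = (2 * \<nu> + real m + real n) / a"
  have p: "p > -1" using a N by (simp add: p_def field_simps)
  define h where "h = (\<lambda>S. S powr p * indicator {0..} S * exp (- (t / a) * S) *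
     (real_bessel_series (2 / a * (real m + \<nu>)) (- (norm x powr a / a\<^sup>2) * S) * real_bessel_series (2 / a * (real n + \<nu>)) (- (norm y powr a / a\<^sup>2) * S)))"
  have Am [measurable]: "A \<in> borel_measurable borel" unfolding A_def by measurable
  have gm [measurable]: "g \<in> borel_measurable borel" unfolding g_def kernel_mode_def by measurable
  have Abd: "\<bar>A (sgn \<xi>)\<bar> \<le> (16 * (\<nu> + 2)) ^ m * (16 * (\<nu> + 2)) ^ n" for \<xi>
    unfolding A_def abs_mult using ux uy \<nu>0 by (intro mult_mono abs_solid_gegen_inner_sgn_le) auto
  have eq1: "(\<lambda>S. (S powr (real DIM('a) / a - 1) * indicator {0..} S) *\<^sub>R g S) = (\<lambda>S. \<kappa> * h S)"
  proof
    fix S :: real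
    have "S powr p = S powr (real DIM('a) / a - 1) * (S powr (real m / a) * (S powr (real n / a) * S powr ((a - 2) / a)))"
      unfolding powr_add[symmetric] using a by (intro arg_cong[where f = "\<lambda>r. S powr r"]) (simp add: p_def N field_simps)
    thus "(S powr (real DIM('a) / a - 1) * indicator {0..} S) *\<^sub>R g S = \<kappa> * h S"
      unfolding g_def h_def \<kappa>_def kernel_mode_def by (simp add: mult_ac)
  qed
  have hint: "integrable lborel h"
    unfolding h_def using a t p by (intro integrable_bessel_product \<mu>) auto
  have polar: "has_bochner_integral lborel (\<lambda>\<xi>. A (sgn \<xi>) *\<^sub>R g (norm \<xi> powr a)) ((real DIM('a) / a * sphere_int A) *\<^sub>R (\<kappa> * I))"
    if "has_bochner_integral lborel h I" for I
  proof (rule has_bochner_integral_polar[OF a(1) Am gm Abd])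
    show "has_bochner_integral lborel (\<lambda>S. (S powr (real DIM('a) / a - 1) * indicator {0..} S) *\<^sub>R g S) (\<kappa> * I)"
      unfolding eq1 using that by (rule has_bochner_integral_mult_right)
  qed
  have eq2: "(\<lambda>\<xi>. A (sgn \<xi>) *\<^sub>R g (norm \<xi> powr a)) = ?F"
  proof
    fix \<xi> :: 'a
    have "(norm \<xi> powr a) powr ((a - 2) / a) = 1 / norm \<xi> powr (2 - a)"
    proof -
      have "(norm \<xi> powr a) powr ((a - 2) / a) = norm \<xi> powr (- (2 - a))" using a by (simp add: powr_powr)
      thus ?thesis by (simp only: powr_minus_divide)
    qed
    thus "A (sgn \<xi>) *\<^sub>R g (norm \<xi> powr a) = ?F \<xi>" unfolding A_def g_def by (simp add: mult_ac)
  qed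
  have sA: "sphere_int A = (if m = n then sphere_int (\<lambda>_::'a. 1) * solid_gegen \<nu> n (sgn x \<bullet> sgn y) 1 else 0)"
    unfolding A_def by (rule sphere_int_gegen_gegen[OF ux uy \<nu>])
  show ?thesis
  proof (cases "m = n")
    case False
    from hint obtain I where "has_bochner_integral lborel h I" by (auto simp: integrable.simps)
    from polar[OF this] show ?thesis unfolding eq2 sA using False by simp
  next
    case True
    have "p = 2 / a * (real m + \<nu>)" using True a by (simp add: p_def field_simps)
    hence "has_bochner_integral lborel h ((t / a) powr (- (2 / a * (real m + \<nu>)) - 1) * exp (- (norm x powr a / a\<^sup>2 + norm y powr a / a\<^sup>2) / (t / a)) *
         real_bessel_series (2 / a * (real m + \<nu>)) (norm x powr a / a\<^sup>2 * (norm y powr a / a\<^sup>2) / (t / a)\<^sup>2))"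
      unfolding h_def True using a t by (simp only: ) (intro Weber_second_exponential_integral \<mu>, auto)
    from polar[OF this] show ?thesis unfolding eq2 sA using True by (simp add: \<kappa>_def mult_ac)
  qed
qed

lemma geometric_sums_half: "(\<Sum>m<M. (1 / 2 :: real) ^ m) \<le> 2"
  by (simp add: sum_gp_strict)

text \<open>The second bound is uniform in M, the constant 2 being the sum of the factors 2^-m; it
  is the majorant in \<xi> for integrating products of partial sums.\<close>

lemma kernel_B_sums:
  fixes x \<xi> :: "'a::euclidean_space" and a :: real
  assumes a: "a > 0" "a > 2 - real DIM('a)" and x: "x \<noteq> 0" and \<xi>: "\<xi> \<noteq> 0"
  defines "\<nu> \<equiv> (real DIM('a) - 2) / 2"
  defines "f \<equiv> \<lambda>m. (- \<i>) powr of_real (2 / a * real m) *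
      complex_of_real (kernel_mode a \<nu> m (norm x) (norm \<xi> powr a) * solid_gegen \<nu> m (sgn x \<bullet> sgn \<xi>) 1)"
    and "C \<equiv> 3 * (32 * (\<nu> + 2) * norm x * a powr (- (2 / a))) powr (a / 2)"
  shows "(\<lambda>M. of_real (Gamma (2 / a * \<nu> + 1)) * (\<Sum>m<M. f m)) \<longlonglongrightarrow> kernel_B a x \<xi>"
    and "norm (\<Sum>m<M. f m) \<le> 2 * exp (3 + C * norm \<xi> powr (a / 2))"
proof -
  have \<nu>: "\<nu> = (real DIM('a) - 2) / 2" by (simp add: \<nu>_def)
  note \<nu>0 = dim_index(2)[OF \<nu>] and b\<nu> = dim_bessel_index(1)[OF a \<nu>]
  have ux: "norm (sgn x) = 1" using x by (simp add: norm_sgn)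
  have c: "\<bar>sgn x \<bullet> sgn \<xi>\<bar> \<le> 1" by (rule abs_inner_sgn_le[OF ux])
  have nf: "norm (f m) \<le> (1 / 2) ^ m * exp (3 + C * norm \<xi> powr (a / 2))" for m
  proof -
    have "norm ((- \<i>) powr of_real (2 / a * real m)) = 1" by (simp add: norm_powr_real_powr')
    thus ?thesis
      using norm_kernel_term_le[OF \<nu>0 a(1) b\<nu> _ _ c, of "norm x" "norm \<xi>" m] x \<xi>
      by (simp only: f_def norm_mult norm_of_real C_def mult.assoc) simp
  qed
  have geo: "summable (\<lambda>m. (1 / 2) ^ m * exp (3 + C * norm \<xi> powr (a / 2)))"
    by (intro summable_mult2 summable_geometric) auto
  have "summable f" by (rule summable_norm_cancel[OF summable_comparison_test'[OF geo]]) (use nf in auto)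
  hence "(\<lambda>M. \<Sum>m<M. f m) \<longlonglongrightarrow> (\<Sum>m. f m)" by (rule summable_LIMSEQ)
  moreover have "kernel_B a x \<xi> = of_real (Gamma (2 / a * \<nu> + 1)) * (\<Sum>m. f m)"
  proof -
    have g: "gegenbauer_normalized \<nu> m (sgn x \<bullet> sgn \<xi>) = solid_gegen \<nu> m (sgn x \<bullet> sgn \<xi>) 1" for m
      by (rule gegenbauer_normalized_solid)
    show ?thesis
      unfolding kernel_B_def script_I_def \<nu>_def[symmetric] g f_def
      by (subst kernel_term_eq[OF a(1) b\<nu>]) (use x \<xi> in auto)
  qed
  ultimately show "(\<lambda>M. of_real (Gamma (2 / a * \<nu> + 1)) * (\<Sum>m<M. f m)) \<longlonglongrightarrow> kernel_B a x \<xi>"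
    by (auto intro: tendsto_mult)
  have "norm (\<Sum>m<M. f m) \<le> (\<Sum>m<M. (1 / 2) ^ m * exp (3 + C * norm \<xi> powr (a / 2)))"
    by (rule sum_norm_le) (rule nf)
  also have "\<dots> = (\<Sum>m<M. (1 / 2) ^ m) * exp (3 + C * norm \<xi> powr (a / 2))" by (rule sum_distrib_right[symmetric])
  also have "\<dots> \<le> 2 * exp (3 + C * norm \<xi> powr (a / 2))" by (intro mult_right_mono geometric_sums_half) auto
  finally show "norm (\<Sum>m<M. f m) \<le> 2 * exp (3 + C * norm \<xi> powr (a / 2))" .
qed

text \<open>The factors are the constant in front of the kernel integral, one Gamma prefactor from
  each \<open>script_I\<close>, the angular constant of polar coordinates, and a power of a^2 that
  appears when t / a is written as a t / a^2.\<close>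

definition heat_const :: "'a::euclidean_space itself \<Rightarrow> real \<Rightarrow> real" where
  "heat_const _ a = norm_const TYPE('a) a * (Gamma (2 / a * ((real DIM('a) - 2) / 2) + 1))\<^sup>2 *
     (real DIM('a) / a * sphere_int (\<lambda>_::'a. 1) * (a\<^sup>2) powr (2 / a * ((real DIM('a) - 2) / 2) + 1))"

lemma summable_heat_mode:
  fixes p q Q \<rho> \<tau> :: complex and \<nu> a X :: real
  assumes \<nu>: "\<nu> \<ge> -1/2" and a: "a > 0" and b\<nu>: "2 / a * \<nu> > -1" and X: "X \<ge> 0" and \<tau>: "\<tau> \<noteq> 0"
    and p: "norm p \<le> X" and q: "norm q \<le> X ^ 2" and Q: "norm (Q * \<rho>) \<le> X powr a"
  shows "summable (\<lambda>m. norm (heat_mode a \<nu> m \<tau> p q Q \<rho>))"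
proof (rule summable_comparison_test')
  show "summable (\<lambda>m. norm \<tau> powr (- (2 / a * \<nu> + 1)) * ((1 / 2) ^ m * exp (3 + 3 * ((32 * (\<nu> + 2)) powr (a / 2) * X powr (a / 2) / norm \<tau>))) *
      exp (- Re ((Q + \<rho>) / \<tau>)))"
    by (intro summable_mult summable_mult2 summable_geometric) auto
  show "norm (norm (heat_mode a \<nu> m \<tau> p q Q \<rho>)) \<le> norm \<tau> powr (- (2 / a * \<nu> + 1)) * ((1 / 2) ^ m * exp (3 + 3 * ((32 * (\<nu> + 2)) powr (a / 2) * X powr (a / 2) / norm \<tau>))) *
      exp (- Re ((Q + \<rho>) / \<tau>))" for m
    using norm_heat_mode_le[OF assms] by simp
qed

text \<open>Products of partial sums are integrated term by term, which leaves the diagonal terms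
  \<open>J m\<close>, and dominated convergence passes to the limit. It remains to match
  \<open>J m\<close> with \<open>heat_mode\<close> at T = a t: the m-th power of |x| |y| T powr (- 2
  / a) moves into the zonal polynomial by homogeneity, and a constant independent of m splits
  off.\<close>

theorem heat_kernel_eq_sum:
  fixes x y :: "'a::euclidean_space" and a t :: real
  assumes a: "a > 0" "a > 2 - real DIM('a)" and x: "x \<noteq> 0" and y: "y \<noteq> 0" and t: "t > 0"
  shows "heat_kernel a x y t = of_real (heat_const TYPE('a) a) *
    (\<Sum>m. heat_mode a ((real DIM('a) - 2) / 2) m (of_real (a * t)) (of_real (x \<bullet> y)) (of_real ((norm x)\<^sup>2 * (norm y)\<^sup>2))
       (of_real (norm x powr a)) (of_real (norm y powr a)))"
proof -
  define \<nu> where "\<nu> = (real DIM('a) - 2) / 2"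
  note \<nu>0 = dim_index(2)[OF \<nu>_def] and b\<nu> = dim_bessel_index(1)[OF a \<nu>_def] and \<mu> = dim_bessel_index(2)[OF a \<nu>_def]
  note [measurable] = borel_measurable_real_bessel_series[OF \<mu>]
  define G where "G = Gamma (2 / a * \<nu> + 1)"
  define \<theta> where "\<theta> = (\<lambda>m. (- \<i>) powr of_real (2 / a * real m))"
  define f where "f = (\<lambda>x m (\<xi>::'a). kernel_mode a \<nu> m (norm x) (norm \<xi> powr a) * solid_gegen \<nu> m (sgn x \<bullet> sgn \<xi>) (1::real))"
  define P where "P = (\<lambda>x M \<xi>. \<Sum>m<M. \<theta> m * complex_of_real (f x m \<xi>))"
  define W where "W = (\<lambda>\<xi>::'a. exp (- (t / a) * norm \<xi> powr a) / norm \<xi> powr (2 - a))"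
  define C where "C = (\<lambda>x::'a. 3 * (32 * (\<nu> + 2) * norm x * a powr (- (2 / a))) powr (a / 2))"
  have Plim: "(\<lambda>M. of_real G * P x M \<xi>) \<longlonglongrightarrow> kernel_B a x \<xi>" if "x \<noteq> 0" "\<xi> \<noteq> 0" for x \<xi> :: 'a
    using kernel_B_sums(1)[OF a that] unfolding P_def \<theta>_def f_def \<nu>_def G_def .
  have Pbd: "norm (P x M \<xi>) \<le> 2 * exp (3 + C x * norm \<xi> powr (a / 2))" if "x \<noteq> 0" "\<xi> \<noteq> 0" for x \<xi> :: 'a and M
    using kernel_B_sums(2)[OF a that] unfolding P_def \<theta>_def f_def \<nu>_def C_def .
  define F where "F = (\<lambda>M \<xi>. cnj (of_real G * P x M \<xi>) * (of_real G * P y M \<xi>) * of_real (W \<xi>))"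
  \<comment> \<open>Integrable at 0 because a - 2 > - N, and at infinity because |\<xi>| powr (a /
    2) loses against |\<xi>| powr a. The constant 4 exp 6 is the square of the 2 exp 3 from
    \<open>kernel_B_sums\<close>.\<close>
  define g where "g = (\<lambda>\<xi>::'a. G\<^sup>2 * (4 * exp 6) * (norm \<xi> powr (a - 2) * ((1 + norm \<xi>) ^ 0 * exp ((C x + C y) * norm \<xi> powr (a / 2)) * exp (- (t / a) * norm \<xi> powr a))))"
  have gint: "integrable lborel g"
    unfolding g_def using a t by (intro integrable_mult_right integrable_norm_powr_growth) auto
  have AE0: "AE \<xi> in lborel. (\<xi>::'a) \<noteq> 0" by (rule AE_lborel_singleton)
  have W: "W \<xi> = norm \<xi> powr (a - 2) * exp (- (t / a) * norm \<xi> powr a)" for \<xi>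
    using powr_minus_divide[of "norm \<xi>" "2 - a"] by (simp add: W_def)
  have Fbd: "norm (F M \<xi>) \<le> g \<xi>" if \<xi>: "\<xi> \<noteq> 0" for M \<xi>
  proof -
    have "norm (F M \<xi>) = G\<^sup>2 * (norm (P x M \<xi>) * norm (P y M \<xi>)) * W \<xi>"
      by (simp add: F_def norm_mult power2_eq_square W)
    also have "\<dots> \<le> G\<^sup>2 * ((2 * exp (3 + C x * norm \<xi> powr (a / 2))) * (2 * exp (3 + C y * norm \<xi> powr (a / 2)))) * W \<xi>"
      by (intro mult_right_mono mult_left_mono mult_mono Pbd x y \<xi>) (auto simp: W)
    also have "\<dots> = g \<xi>"
    proof -
      have "exp (3 + C x * norm \<xi> powr (a / 2)) * exp (3 + C y * norm \<xi> powr (a / 2)) = exp 6 * exp ((C x + C y) * norm \<xi> powr (a / 2))"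
        by (simp add: algebra_simps flip: exp_add)
      thus ?thesis unfolding g_def W by (simp add: mult_ac)
    qed
    finally show ?thesis .
  qed
  have Flim: "(\<lambda>M. F M \<xi>) \<longlonglongrightarrow> cnj (kernel_B a x \<xi>) * kernel_B a y \<xi> * of_real (W \<xi>)" if \<xi>: "\<xi> \<noteq> 0" for \<xi>
    unfolding F_def by (intro tendsto_intros Plim x y \<xi>)
  define J where "J = (\<lambda>m. real DIM('a) / a * sphere_int (\<lambda>_::'a. 1) * solid_gegen \<nu> m (sgn x \<bullet> sgn y) 1 *
       (a powr (- (2 / a * real m)) * norm x ^ m * (a powr (- (2 / a * real m)) * norm y ^ m) *
        ((t / a) powr (- (2 / a * (real m + \<nu>)) - 1) * exp (- (norm x powr a / a\<^sup>2 + norm y powr a / a\<^sup>2) / (t / a)) *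
         real_bessel_series (2 / a * (real m + \<nu>)) (norm x powr a / a\<^sup>2 * (norm y powr a / a\<^sup>2) / (t / a)\<^sup>2))))"
  have FI: "has_bochner_integral lborel (F M) (of_real (G\<^sup>2) * of_real (\<Sum>m<M. J m))" for M
  proof -
    have "has_bochner_integral lborel (\<lambda>\<xi>. \<Sum>m<M. \<Sum>n<M. (of_real (G\<^sup>2) * (cnj (\<theta> m) * \<theta> n)) * of_real (f x m \<xi> * f y n \<xi> * W \<xi>))
      (\<Sum>m<M. \<Sum>n<M. (of_real (G\<^sup>2) * (cnj (\<theta> m) * \<theta> n)) * of_real (if m = n then J m else 0))"
      unfolding f_def W_def J_def
      by (intro has_bochner_integral_sum has_bochner_integral_mult_right has_bochner_integral_of_real
        has_bochner_integral_kernel_modes a x y t \<nu>_def)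
    also have "(\<lambda>\<xi>. \<Sum>m<M. \<Sum>n<M. (of_real (G\<^sup>2) * (cnj (\<theta> m) * \<theta> n)) * of_real (f x m \<xi> * f y n \<xi> * W \<xi>)) = F M"
    proof
      fix \<xi>
      have "F M \<xi> = of_real (G\<^sup>2) * ((\<Sum>m<M. cnj (\<theta> m) * of_real (f x m \<xi>)) * (\<Sum>n<M. \<theta> n * of_real (f y n \<xi>))) * of_real (W \<xi>)"
        unfolding F_def P_def by (simp add: power2_eq_square mult_ac)
      also have "\<dots> = (\<Sum>m<M. \<Sum>n<M. (of_real (G\<^sup>2) * (cnj (\<theta> m) * \<theta> n)) * of_real (f x m \<xi> * f y n \<xi> * W \<xi>))"
        unfolding sum_product by (simp add: sum_distrib_left sum_distrib_right mult_ac)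
      finally show "(\<Sum>m<M. \<Sum>n<M. (of_real (G\<^sup>2) * (cnj (\<theta> m) * \<theta> n)) * of_real (f x m \<xi> * f y n \<xi> * W \<xi>)) = F M \<xi>" ..
    qed
    also have "(\<Sum>m<M. \<Sum>n<M. (of_real (G\<^sup>2) * (cnj (\<theta> m) * \<theta> n)) * of_real (if m = n then J m else 0)) =
       (\<Sum>m<M. of_real (G\<^sup>2) * of_real (J m))"
    proof (rule sum.cong[OF refl])
      fix m assume m: "m \<in> {..<M}"
      \<comment> \<open>The phases of the two expansions are conjugate on the diagonal and
        cancel.\<close>
      have "norm (\<theta> m) = 1" unfolding \<theta>_def by (simp add: norm_powr_real_powr')
      hence "cnj (\<theta> m) * \<theta> m = 1" using complex_norm_square[of "\<theta> m"] by (simp add: mult.commute)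
      moreover have "(\<Sum>n<M. (of_real (G\<^sup>2) * (cnj (\<theta> m) * \<theta> n)) * of_real (if m = n then J m else 0)) =
        (\<Sum>n<M. if m = n then of_real (G\<^sup>2) * (cnj (\<theta> m) * \<theta> n) * of_real (J m) else 0)"
        by (intro sum.cong) auto
      ultimately show "(\<Sum>n<M. (of_real (G\<^sup>2) * (cnj (\<theta> m) * \<theta> n)) * of_real (if m = n then J m else 0)) = of_real (G\<^sup>2) * of_real (J m)"
        using m by simp
    qed
    also have "\<dots> = of_real (G\<^sup>2) * of_real (\<Sum>m<M. J m)" by (simp add: sum_distrib_left)
    finally show ?thesis .
  qed
  have Fm: "F M \<in> borel_measurable lborel" for M using FI[of M] by (auto simp: has_bochner_integral_iff)
  have "(\<lambda>M. LINT \<xi>|lborel. F M \<xi>) \<longlonglongrightarrow> (LINT \<xi>|lborel. cnj (kernel_B a x \<xi>) * kernel_B a y \<xi> * of_real (W \<xi>))"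
  proof -
    \<comment> \<open>Convergence is known only off the origin, so measurability is proved for the
      version vanishing at 0 and the single value is then put back.\<close>
    define H where "H = (\<lambda>\<xi>. if \<xi> = 0 then 0 else cnj (kernel_B a x \<xi>) * kernel_B a y \<xi> * of_real (W \<xi>))"
    have Hm: "H \<in> borel_measurable lborel"
    proof (rule borel_measurable_LIMSEQ_metric)
      show "(\<lambda>\<xi>. if \<xi> = 0 then 0 else F M \<xi>) \<in> borel_measurable lborel" for M
        using Fm[of M] by measurable
      show "(\<lambda>M. if \<xi> = 0 then 0 else F M \<xi>) \<longlonglongrightarrow> H \<xi>" for \<xi>
        using Flim[of \<xi>] by (auto simp: H_def)
    qed
    have km: "(\<lambda>\<xi>. cnj (kernel_B a x \<xi>) * kernel_B a y \<xi> * of_real (W \<xi>)) \<in> borel_measurable lborel"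
    proof -
      have "(\<lambda>\<xi>. if \<xi> = 0 then cnj (kernel_B a x 0) * kernel_B a y 0 * of_real (W 0) else H \<xi>) \<in> borel_measurable lborel"
        using Hm by measurable
      also have "(\<lambda>\<xi>. if \<xi> = 0 then cnj (kernel_B a x 0) * kernel_B a y 0 * of_real (W 0) else H \<xi>) =
        (\<lambda>\<xi>. cnj (kernel_B a x \<xi>) * kernel_B a y \<xi> * of_real (W \<xi>))"
        by (auto simp: H_def)
      finally show ?thesis .
    qed
    show ?thesis
    proof (rule integral_dominated_convergence[OF km Fm gint])
      show "AE \<xi> in lborel. (\<lambda>M. F M \<xi>) \<longlonglongrightarrow> cnj (kernel_B a x \<xi>) * kernel_B a y \<xi> * of_real (W \<xi>)"
        using AE0 by eventually_elim (rule Flim)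
      show "AE \<xi> in lborel. norm (F M \<xi>) \<le> g \<xi>" for M
        using AE0 by eventually_elim (rule Fbd)
    qed
  qed
  hence lim1: "(\<lambda>M. of_real (G\<^sup>2) * of_real (\<Sum>m<M. J m)) \<longlonglongrightarrow> (LINT \<xi>|lborel. cnj (kernel_B a x \<xi>) * kernel_B a y \<xi> * of_real (W \<xi>))"
    unfolding has_bochner_integral_integral_eq[OF FI] .
  define h where "h = (\<lambda>m. heat_mode a \<nu> m (of_real (a * t)) (of_real (x \<bullet> y)) (of_real ((norm x)\<^sup>2 * (norm y)\<^sup>2))
       (of_real (norm x powr a)) (of_real (norm y powr a)))"
  define C1 where "C1 = real DIM('a) / a * sphere_int (\<lambda>_::'a. 1) * (a\<^sup>2) powr (2 / a * \<nu> + 1)"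
  have Jh: "of_real (J m) = of_real C1 * h m" for m
  proof -
    define T where "T = a * t"
    have T: "T > 0" using a t by (simp add: T_def)
    define c where "c = sgn x \<bullet> sgn y"
    define X where "X = T powr (- (2 / a)) * (norm x * norm y)"
    have xy: "x \<bullet> y = norm x * norm y * c" using x y by (simp add: c_def sgn_div_norm field_simps)
    have hm: "h m = of_real (T powr (- (2 / a * \<nu> + 1)) * (solid_gegen \<nu> m (X * c) (X\<^sup>2 * 1) *
        real_bessel_series (2 / a * (real m + \<nu>)) (norm x powr a * norm y powr a / T\<^sup>2)) * exp (- ((norm x powr a + norm y powr a) / T)))"
      unfolding h_def T_def[symmetric] heat_mode_of_real[OF T \<mu>] xy X_def by (simp only: power_mult_distrib mult_1_right mult_1_left mult_ac)
    have Xm: "X ^ m = T powr (- (2 / a * real m)) * (norm x ^ m * norm y ^ m)"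
      using T by (simp add: X_def power_mult_distrib powr_power mult.commute)
    have e1: "norm x powr a / a\<^sup>2 * (norm y powr a / a\<^sup>2) / (t / a)\<^sup>2 = norm x powr a * norm y powr a / T\<^sup>2"
      using a t by (simp add: T_def field_simps power2_eq_square)
    have e2: "- (norm x powr a / a\<^sup>2 + norm y powr a / a\<^sup>2) / (t / a) = - ((norm x powr a + norm y powr a) / T)"
      using a t by (simp add: T_def field_simps power2_eq_square)
    \<comment> \<open>As t / a = T / a^2, the last factor contributes a power of a^2 whose
      m-dependent part is cancelled by the two factors a powr (- 2 m / a).\<close>
    have e3: "a powr (- (2 / a * real m)) * a powr (- (2 / a * real m)) * (t / a) powr (- (2 / a * (real m + \<nu>)) - 1) =
       (a\<^sup>2) powr (2 / a * \<nu> + 1) * (T powr (- (2 / a * \<nu> + 1)) * T powr (- (2 / a * real m)))"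
    proof -
      have "t / a = T / a\<^sup>2" using a by (simp add: T_def power2_eq_square)
      hence "(t / a) powr (- (2 / a * (real m + \<nu>)) - 1) = T powr (- (2 / a * (real m + \<nu>)) - 1) / (a\<^sup>2) powr (- (2 / a * (real m + \<nu>)) - 1)"
        using T by (simp add: powr_divide)
      also have "\<dots> = T powr (- (2 / a * (real m + \<nu>)) - 1) * (a\<^sup>2) powr (2 / a * (real m + \<nu>) + 1)"
        using a powr_minus_divide[of "a\<^sup>2" "2 / a * (real m + \<nu>) + 1"] by simp
      finally have q1: "(t / a) powr (- (2 / a * (real m + \<nu>)) - 1) = T powr (- (2 / a * (real m + \<nu>)) - 1) * (a\<^sup>2) powr (2 / a * (real m + \<nu>) + 1)" .
      have "- (2 / a * (real m + \<nu>)) - 1 = - (2 / a * \<nu> + 1) + - (2 / a * real m)"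
        by (simp add: algebra_simps add_divide_distrib)
      hence q2: "T powr (- (2 / a * (real m + \<nu>)) - 1) = T powr (- (2 / a * \<nu> + 1)) * T powr (- (2 / a * real m))"
        by (simp only: powr_add)
      have q3: "a powr (- (2 / a * real m)) * a powr (- (2 / a * real m)) = (a\<^sup>2) powr (- (2 / a * real m))"
        using a by (simp add: power2_eq_square powr_mult)
      have q4: "(a\<^sup>2) powr (- (2 / a * real m)) * (a\<^sup>2) powr (2 / a * (real m + \<nu>) + 1) = (a\<^sup>2) powr (2 / a * \<nu> + 1)"
        unfolding powr_add[symmetric] by (simp add: algebra_simps add_divide_distrib)
      show ?thesis unfolding q1 q2 q3 q4[symmetric] by (simp only: mult_ac)
    qed
    define S1 where "S1 = sphere_int (\<lambda>_::'a. 1)"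
    define B where "B = real_bessel_series (2 / a * (real m + \<nu>)) (norm x powr a * norm y powr a / T\<^sup>2)"
    define E where "E = exp (- ((norm x powr a + norm y powr a) / T))"
    have "J m = real DIM('a) / a * S1 * solid_gegen \<nu> m c 1 * (norm x ^ m * norm y ^ m) *
       (a powr (- (2 / a * real m)) * a powr (- (2 / a * real m)) * (t / a) powr (- (2 / a * (real m + \<nu>)) - 1)) * (E * B)"
      unfolding J_def e1 e2 c_def[symmetric] S1_def[symmetric] B_def[symmetric] E_def[symmetric] by (simp only: mult_ac)
    also have "\<dots> = C1 * (T powr (- (2 / a * \<nu> + 1)) * (X ^ m * solid_gegen \<nu> m c 1 * B) * E)"
      unfolding e3 Xm C1_def S1_def[symmetric] by (simp only: mult_ac)
    finally show ?thesis unfolding hm solid_gegen_scale B_def[symmetric] E_def[symmetric]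
      by (simp only: of_real_mult)
  qed
  have hs: "summable h"
  proof (rule summable_norm_cancel, unfold h_def, rule summable_heat_mode[OF \<nu>0 a(1) b\<nu>])
    show "norm x * norm y \<ge> 0" by simp
    show "norm (complex_of_real (x \<bullet> y)) \<le> norm x * norm y" using Cauchy_Schwarz_ineq2[of x y] by simp
    show "norm (complex_of_real ((norm x)\<^sup>2 * (norm y)\<^sup>2)) \<le> (norm x * norm y)\<^sup>2"
      unfolding norm_of_real by (simp add: power_mult_distrib)
    show "norm (complex_of_real (norm x powr a) * complex_of_real (norm y powr a)) \<le> (norm x * norm y) powr a"
      by (simp add: norm_mult powr_mult)
  qed (use a t in auto)
  have "(\<lambda>M. of_real (G\<^sup>2) * of_real (\<Sum>m<M. J m)) = (\<lambda>M. of_real (G\<^sup>2 * C1) * (\<Sum>m<M. h m))"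
    by (simp add: Jh sum_distrib_left mult.assoc)
  moreover have "(\<lambda>M. of_real (G\<^sup>2 * C1) * (\<Sum>m<M. h m)) \<longlonglongrightarrow> of_real (G\<^sup>2 * C1) * (\<Sum>m. h m)"
    by (intro tendsto_mult tendsto_const summable_LIMSEQ hs)
  ultimately have "(LINT \<xi>|lborel. cnj (kernel_B a x \<xi>) * kernel_B a y \<xi> * of_real (W \<xi>)) = of_real (G\<^sup>2 * C1) * (\<Sum>m. h m)"
    using lim1 by (auto intro: LIMSEQ_unique)
  thus ?thesis
    unfolding heat_kernel_def W_def heat_const_def \<nu>_def[symmetric] G_def[symmetric] C1_def[symmetric] h_def[symmetric]
    by (simp add: mult_ac)
qed

section \<open>The heat equation for a single mode\<close>

lemma has_field_derivative_bessel_series: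
  assumes "(g has_field_derivative g') (at x within A)" "\<mu> > -1"
  shows "((\<lambda>x. bessel_series \<mu> (g x)) has_field_derivative bessel_series (\<mu> + 1) (g x) * g') (at x within A)"
  by (rule DERIV_chain2[OF DERIV_bessel_series[OF assms(2)] assms(1)])

lemma deriv2_eqI:
  fixes f :: "complex \<Rightarrow> complex"
  assumes r: "r > 0" and f: "\<And>s. s \<in> ball z r \<Longrightarrow> (f has_field_derivative f1 s) (at s)"
    and f1: "(f1 has_field_derivative d) (at z)"
  shows "(deriv ^^ 2) f z = d"
proof -
  have "eventually (\<lambda>s. s \<in> ball z r) (nhds z)" using r by (intro eventually_nhds_in_open) auto
  hence ev: "\<forall>\<^sub>F s in nhds z. deriv f s = f1 s"
    by eventually_elim (rule DERIV_imp_deriv[OF f])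
  have "(deriv ^^ 2) f z = deriv (deriv f) z" by (simp add: numeral_2_eq_2)
  also have "\<dots> = deriv f1 z" by (rule deriv_cong_ev[OF ev refl])
  also have "\<dots> = d" by (rule DERIV_imp_deriv[OF f1])
  finally show ?thesis .
qed

text \<open>The factor of a mode depending on Q = |x| powr a; c carries the power of \<tau>.
  \<open>heat_profile1\<close> and \<open>heat_profile2\<close> are the first two derivatives in
  Q.\<close>

definition heat_profile :: "real \<Rightarrow> complex \<Rightarrow> complex \<Rightarrow> complex \<Rightarrow> complex \<Rightarrow> complex" where
  "heat_profile \<mu> c \<tau> \<rho> Q = c * bessel_series \<mu> (Q * \<rho> / \<tau> ^ 2) * exp (- ((Q + \<rho>) / \<tau>))"

definition heat_profile1 :: "real \<Rightarrow> complex \<Rightarrow> complex \<Rightarrow> complex \<Rightarrow> complex \<Rightarrow> complex" where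
  "heat_profile1 \<mu> c \<tau> \<rho> Q = c * (bessel_series (\<mu> + 1) (Q * \<rho> / \<tau> ^ 2) * (\<rho> / \<tau> ^ 2) -
     bessel_series \<mu> (Q * \<rho> / \<tau> ^ 2) / \<tau>) * exp (- ((Q + \<rho>) / \<tau>))"

definition heat_profile2 :: "real \<Rightarrow> complex \<Rightarrow> complex \<Rightarrow> complex \<Rightarrow> complex \<Rightarrow> complex" where
  "heat_profile2 \<mu> c \<tau> \<rho> Q = c * (bessel_series (\<mu> + 2) (Q * \<rho> / \<tau> ^ 2) * (\<rho> / \<tau> ^ 2) ^ 2 -
     2 * bessel_series (\<mu> + 1) (Q * \<rho> / \<tau> ^ 2) * (\<rho> / \<tau> ^ 2) / \<tau> +
     bessel_series \<mu> (Q * \<rho> / \<tau> ^ 2) / \<tau> ^ 2) * exp (- ((Q + \<rho>) / \<tau>))"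

lemma DERIV_heat_profile:
  assumes "\<mu> > -1" "\<tau> \<noteq> 0"
  shows "(heat_profile \<mu> c \<tau> \<rho> has_field_derivative heat_profile1 \<mu> c \<tau> \<rho> Q) (at Q)"
proof -
  have "((\<lambda>Q. Q * \<rho> / \<tau> ^ 2) has_field_derivative \<rho> / \<tau> ^ 2) (at Q)"
    using DERIV_cdivide[OF DERIV_cmult_right[OF DERIV_ident, of \<rho>], of "\<tau> ^ 2"] by simp
  note B = has_field_derivative_bessel_series[OF this assms(1)]
  have E: "((\<lambda>Q. exp (- ((Q + \<rho>) / \<tau>))) has_field_derivative exp (- ((Q + \<rho>) / \<tau>)) * (- (1 / \<tau>))) (at Q)"
    using assms by (auto intro!: derivative_eq_intros)
  show ?thesis
    unfolding heat_profile_def[abs_def] heat_profile1_def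
    by (rule DERIV_cong[OF DERIV_mult[OF DERIV_cmult[OF B] E]]) (simp add: algebra_simps)
qed

lemma DERIV_heat_profile1:
  assumes "\<mu> > -1" "\<tau> \<noteq> 0"
  shows "(heat_profile1 \<mu> c \<tau> \<rho> has_field_derivative heat_profile2 \<mu> c \<tau> \<rho> Q) (at Q)"
proof -
  have D: "((\<lambda>Q. Q * \<rho> / \<tau> ^ 2) has_field_derivative \<rho> / \<tau> ^ 2) (at Q)"
    using DERIV_cdivide[OF DERIV_cmult_right[OF DERIV_ident, of \<rho>], of "\<tau> ^ 2"] by simp
  note B = has_field_derivative_bessel_series[OF D assms(1)]
  have "\<mu> + 1 > -1" using assms by simp
  note B1 = has_field_derivative_bessel_series[OF D this]
  have E: "((\<lambda>Q. exp (- ((Q + \<rho>) / \<tau>))) has_field_derivative exp (- ((Q + \<rho>) / \<tau>)) * (- (1 / \<tau>))) (at Q)"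
    using assms by (auto intro!: derivative_eq_intros)
  have m2: "\<mu> + 1 + 1 = \<mu> + 2" by simp
  show ?thesis
    unfolding heat_profile1_def[abs_def] heat_profile2_def
    by (rule DERIV_cong[OF DERIV_mult[OF DERIV_cmult[OF DERIV_diff[OF DERIV_cmult_right[OF B1] DERIV_cdivide[OF B]]] E]])
       (simp add: m2 algebra_simps power2_eq_square diff_divide_distrib add_divide_distrib)
qed

text \<open>For \<open>c = \<tau> powr - (\<mu> + 1)\<close> the profile is the heat kernel of the operator
  \<open>Q \<partial>\<^sup>2 + (\<mu> + 1) \<partial>\<close>; only the logarithmic derivative of \<open>c\<close> enters.\<close>

lemma heat_profile_equation:
  assumes "\<mu> > -1" and \<tau>: "\<tau> \<noteq> 0" and c: "(c has_field_derivative - of_real (\<mu> + 1) / \<tau> * c \<tau>) (at \<tau>)"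
  shows "((\<lambda>\<tau>. heat_profile \<mu> (c \<tau>) \<tau> \<rho> Q) has_field_derivative
    Q * heat_profile2 \<mu> (c \<tau>) \<tau> \<rho> Q + of_real (\<mu> + 1) * heat_profile1 \<mu> (c \<tau>) \<tau> \<rho> Q) (at \<tau>)"
proof -
  define z where "z = Q * \<rho> / \<tau> ^ 2"
  have D: "((\<lambda>\<tau>. Q * \<rho> / \<tau> ^ 2) has_field_derivative - 2 * Q * \<rho> / \<tau> ^ 3) (at \<tau>)"
    using \<tau> by (auto intro!: derivative_eq_intros simp: field_simps power2_eq_square power3_eq_cube)
  note B = has_field_derivative_bessel_series[OF D assms(1)]
  have E: "((\<lambda>\<tau>. exp (- ((Q + \<rho>) / \<tau>))) has_field_derivative exp (- ((Q + \<rho>) / \<tau>)) * ((Q + \<rho>) / \<tau> ^ 2)) (at \<tau>)"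
    using \<tau> by (auto intro!: derivative_eq_intros simp: field_simps power2_eq_square)
  define p0 p1 p2 e C M where "p0 = bessel_series \<mu> z" and "p1 = bessel_series (\<mu> + 1) z" and "p2 = bessel_series (\<mu> + 2) z"
    and "e = exp (- ((Q + \<rho>) / \<tau>))" and "C = c \<tau>" and "M = complex_of_real (\<mu> + 1)"
  have rec: "p0 = z * p2 + M * p1"
    unfolding p0_def p1_def p2_def M_def by (rule bessel_series_rec[OF assms(1), symmetric])
  have "(C * (p1 * (- 2 * Q * \<rho> / \<tau> ^ 3)) + (- M / \<tau> * C) * p0) * e + e * ((Q + \<rho>) / \<tau> ^ 2) * (C * p0) =
    Q * (C * (p2 * (\<rho> / \<tau> ^ 2) ^ 2 - 2 * p1 * (\<rho> / \<tau> ^ 2) / \<tau> + p0 / \<tau> ^ 2) * e) +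
    M * (C * (p1 * (\<rho> / \<tau> ^ 2) - p0 / \<tau>) * e)"
  proof -
    \<comment> \<open>The time derivative of the exponential produces (\<rho> / \<tau>^2) p0, the
      one term without a counterpart on the right. Bessel's equation trades it for the p2 and p1
      terms there; all others match directly.\<close>
    have "\<rho> / \<tau> ^ 2 * p0 = Q * (\<rho> / \<tau> ^ 2) ^ 2 * p2 + M * p1 * (\<rho> / \<tau> ^ 2)"
      unfolding rec z_def by (simp add: power2_eq_square algebra_simps)
    hence "e * C * (\<rho> / \<tau> ^ 2 * p0) = e * C * (Q * (\<rho> / \<tau> ^ 2) ^ 2 * p2 + M * p1 * (\<rho> / \<tau> ^ 2))" by simp
    moreover have "(C * (p1 * (- 2 * Q * \<rho> / \<tau> ^ 3)) + (- M / \<tau> * C) * p0) * e + e * ((Q + \<rho>) / \<tau> ^ 2) * (C * p0) =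
       e * C * (\<rho> / \<tau> ^ 2 * p0) + e * C * (p1 * (- 2 * Q * \<rho> / \<tau> ^ 3) - M / \<tau> * p0 + Q / \<tau> ^ 2 * p0)"
      by (simp add: algebra_simps add_divide_distrib)
    moreover have "p1 * (- 2 * Q * \<rho> / \<tau> ^ 3) = Q * (- (2 * p1 * (\<rho> / \<tau> ^ 2) / \<tau>))"
      by (simp add: power2_eq_square power3_eq_cube)
    ultimately show ?thesis by (simp add: algebra_simps) (simp add: power2_eq_square power3_eq_cube)
  qed
  thus ?thesis
    unfolding heat_profile_def heat_profile1_def heat_profile2_def
    by (intro DERIV_cong[OF DERIV_mult[OF DERIV_mult'[OF c B] E]])
       (simp add: p0_def p1_def p2_def e_def C_def M_def z_def mult_ac)
qed

text \<open>On the line x + s e with |e| = 1, the inner product with y is p0 + s pe and the squared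
  norm is q0 + 2 s xe + s^2. This differentiates p^k h(|x|^2) along that line.\<close>

lemma DERIV_power_comp_quadratic:
  fixes p0 pe q0 xe :: complex and h h1 :: "complex \<Rightarrow> complex"
  assumes "(h has_field_derivative h1 (q0 + 2 * s * xe + s ^ 2)) (at (q0 + 2 * s * xe + s ^ 2))"
  shows "((\<lambda>s. (p0 + s * pe) ^ k * h (q0 + 2 * s * xe + s ^ 2)) has_field_derivative
    of_nat k * (p0 + s * pe) ^ (k - 1) * pe * h (q0 + 2 * s * xe + s ^ 2) +
    (p0 + s * pe) ^ k * (h1 (q0 + 2 * s * xe + s ^ 2) * (2 * xe + 2 * s))) (at s)"
proof -
  have 1: "((\<lambda>s. (p0 + s * pe) ^ k) has_field_derivative of_nat k * (p0 + s * pe) ^ (k - 1) * pe) (at s)"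
    by (auto intro!: derivative_eq_intros)
  have 2: "((\<lambda>s. q0 + 2 * s * xe + s ^ 2) has_field_derivative 2 * xe + 2 * s) (at s)"
    by (auto intro!: derivative_eq_intros)
  show ?thesis
    by (rule DERIV_cong[OF DERIV_mult[OF 1 DERIV_chain2[OF assms 2]]]) (simp add: mult_ac)
qed

lemma DERIV2_power_comp_quadratic:
  fixes p0 pe q0 xe :: complex and h h1 :: "complex \<Rightarrow> complex"
  assumes h: "(h has_field_derivative h1 q0) (at q0)" and h1: "(h1 has_field_derivative h2) (at q0)"
  shows "((\<lambda>s. of_nat k * (p0 + s * pe) ^ (k - 1) * pe * h (q0 + 2 * s * xe + s ^ 2) +
    (p0 + s * pe) ^ k * (h1 (q0 + 2 * s * xe + s ^ 2) * (2 * xe + 2 * s))) has_field_derivative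
    of_nat k * of_nat (k - 1) * p0 ^ (k - 2) * h q0 * pe ^ 2 + 4 * of_nat k * p0 ^ (k - 1) * h1 q0 * (pe * xe) +
    4 * p0 ^ k * h2 * xe ^ 2 + 2 * p0 ^ k * h1 q0) (at 0)"
proof -
  have h: "(h has_field_derivative h1 (q0 + 2 * 0 * xe + 0 ^ 2)) (at (q0 + 2 * 0 * xe + 0 ^ 2))"
    and h1: "(h1 has_field_derivative h2) (at (q0 + 2 * 0 * xe + 0 ^ 2))" using h h1 by simp_all
  have 1: "((\<lambda>s. (p0 + s * pe) ^ (k - 1) * h (q0 + 2 * s * xe + s ^ 2)) has_field_derivative
    of_nat (k - 1) * (p0 + 0 * pe) ^ (k - 1 - 1) * pe * h (q0 + 2 * 0 * xe + 0 ^ 2) +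
    (p0 + 0 * pe) ^ (k - 1) * (h1 (q0 + 2 * 0 * xe + 0 ^ 2) * (2 * xe + 2 * 0))) (at 0)"
    by (rule DERIV_power_comp_quadratic[where s = 0 and h = h and ?h1.0 = h1 and k = "k - 1", OF h])
  have 2: "((\<lambda>s. (p0 + s * pe) ^ k * h1 (q0 + 2 * s * xe + s ^ 2)) has_field_derivative
    of_nat k * (p0 + 0 * pe) ^ (k - 1) * pe * h1 (q0 + 2 * 0 * xe + 0 ^ 2) +
    (p0 + 0 * pe) ^ k * (h2 * (2 * xe + 2 * 0))) (at 0)"
    by (rule DERIV_power_comp_quadratic[where s = 0 and h = h1 and ?h1.0 = "\<lambda>_. h2", OF h1])
  have 3: "((\<lambda>s. 2 * xe + 2 * s) has_field_derivative 2) (at 0)"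
    by (auto intro!: derivative_eq_intros)
  have eq: "(\<lambda>s. of_nat k * (p0 + s * pe) ^ (k - 1) * pe * h (q0 + 2 * s * xe + s ^ 2) +
    (p0 + s * pe) ^ k * (h1 (q0 + 2 * s * xe + s ^ 2) * (2 * xe + 2 * s))) =
    (\<lambda>s. of_nat k * pe * ((p0 + s * pe) ^ (k - 1) * h (q0 + 2 * s * xe + s ^ 2)) +
    ((p0 + s * pe) ^ k * h1 (q0 + 2 * s * xe + s ^ 2)) * (2 * xe + 2 * s))"
    by (simp add: fun_eq_iff mult_ac)
  have k: "k - 1 - 1 = k - 2" by simp
  show ?thesis unfolding eq
    by (rule DERIV_cong[OF DERIV_add[OF DERIV_cmult[OF 1] DERIV_mult[OF 2 3]]])
       (simp add: k[symmetric] algebra_simps power2_eq_square)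
qed

text \<open>For p0 = x \<bullet> y, q = |x|^2, Y = |y|^2 the left side is the Laplacian of Z(x)
  g(|x|^2), monomial by monomial of Z and with the sum over basis vectors already carried out. Terms
  with g undifferentiated make up the Laplacian of Z: A from the p-derivatives, B from q and the
  mixed ones, with A i and B (i + 1) cancelling by \<open>gegen_coeff_rec\<close>. The terms with g'
  and g'' combine because every monomial has degree m in x.\<close>

lemma solid_gegen_harmonic_sum:
  fixes p0 q Y g g1 g2 :: complex and \<nu> :: real
  defines "N \<equiv> of_real (2 * \<nu> + 2)"
  shows "(\<Sum>i\<le>m div 2. of_real (gegen_coeff \<nu> m i) * Y ^ i *
     (of_nat (m - 2 * i) * of_nat (m - 2 * i - 1) * p0 ^ (m - 2 * i - 2) * (q ^ i * g) * Y +
      4 * of_nat (m - 2 * i) * p0 ^ (m - 2 * i - 1) * (of_nat i * q ^ (i - 1) * g + q ^ i * g1) * p0 +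
      4 * p0 ^ (m - 2 * i) * (of_nat i * of_nat (i - 1) * q ^ (i - 2) * g + 2 * of_nat i * q ^ (i - 1) * g1 + q ^ i * g2) * q +
      2 * p0 ^ (m - 2 * i) * (of_nat i * q ^ (i - 1) * g + q ^ i * g1) * N)) =
    solid_gegen \<nu> m p0 (q * Y) * (4 * q * g2 + (4 * of_nat m + 2 * N) * g1)"
proof -
  define C where "C = (\<lambda>i. complex_of_real (gegen_coeff \<nu> m i))"
  define A where "A = (\<lambda>i. C i * (of_nat (m - 2 * i) * of_nat (m - 2 * i - 1)) * p0 ^ (m - 2 * i - 2) * Y ^ Suc i * q ^ i * g)"
  define B where "B = (\<lambda>i. C i * (4 * of_nat i * (of_real \<nu> + of_nat m - of_nat i)) * p0 ^ (m - 2 * i) * Y ^ i * q ^ (i - 1) * g)"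
  define D where "D = (\<lambda>i. C i * p0 ^ (m - 2 * i) * (q * Y) ^ i * (4 * q * g2 + (4 * of_nat m + 2 * N) * g1))"
  have "(\<Sum>i\<le>m div 2. of_real (gegen_coeff \<nu> m i) * Y ^ i *
     (of_nat (m - 2 * i) * of_nat (m - 2 * i - 1) * p0 ^ (m - 2 * i - 2) * (q ^ i * g) * Y +
      4 * of_nat (m - 2 * i) * p0 ^ (m - 2 * i - 1) * (of_nat i * q ^ (i - 1) * g + q ^ i * g1) * p0 +
      4 * p0 ^ (m - 2 * i) * (of_nat i * of_nat (i - 1) * q ^ (i - 2) * g + 2 * of_nat i * q ^ (i - 1) * g1 + q ^ i * g2) * q +
      2 * p0 ^ (m - 2 * i) * (of_nat i * q ^ (i - 1) * g + q ^ i * g1) * N)) = (\<Sum>i\<le>m div 2. A i + B i + D i)"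
  proof (intro sum.cong refl)
    fix i assume "i \<in> {..m div 2}"
    hence i: "2 * i \<le> m" by auto
    define k where "k = m - 2 * i"
    have km: "of_nat m = (of_nat k + 2 * of_nat i :: complex)"
    proof -
      have "m = k + 2 * i" using i by (simp add: k_def)
      thus ?thesis by simp
    qed
    have 1: "of_nat k * p0 ^ (k - 1) * p0 = of_nat k * p0 ^ k" by (cases k) auto
    have 2: "of_nat i * q ^ i = of_nat i * q ^ (i - 1) * q" by (cases i) auto
    have 3: "of_nat i * of_nat (i - 1) * q ^ (i - 2) * q = of_nat i * (of_nat i - 1) * q ^ (i - 1)"
    proof (cases i)
      case (Suc j)
      thus ?thesis by (cases j) auto
    qed simp
    have Ci: "complex_of_real (gegen_coeff \<nu> m i) = C i" by (simp add: C_def)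
    define P R where "P = p0 ^ k" and "R = q ^ (i - 1)"
    have a: "4 * of_nat k * p0 ^ (k - 1) * (of_nat i * R * g + q ^ i * g1) * p0 = 4 * of_nat k * P * (of_nat i * R * g + q ^ i * g1)"
    proof -
      have "4 * of_nat k * p0 ^ (k - 1) * (of_nat i * R * g + q ^ i * g1) * p0 = 4 * (of_nat k * p0 ^ (k - 1) * p0) * (of_nat i * R * g + q ^ i * g1)"
        by (simp only: mult_ac)
      thus ?thesis unfolding 1 P_def by (simp only: mult_ac)
    qed
    have b: "4 * P * (of_nat i * of_nat (i - 1) * q ^ (i - 2) * g + 2 * of_nat i * R * g1 + q ^ i * g2) * q =
      4 * P * (of_nat i * (of_nat i - 1) * R * g + 2 * (of_nat i * q ^ i) * g1 + q ^ i * g2 * q)"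
    proof -
      have "4 * P * (of_nat i * of_nat (i - 1) * q ^ (i - 2) * g + 2 * of_nat i * R * g1 + q ^ i * g2) * q =
        4 * P * ((of_nat i * of_nat (i - 1) * q ^ (i - 2) * q) * g + 2 * (of_nat i * R * q) * g1 + q ^ i * g2 * q)"
        by (simp add: algebra_simps)
      thus ?thesis unfolding 3 R_def 2[symmetric] .
    qed
    have Nn: "N = 2 * of_real \<nu> + 2" by (simp add: N_def)
    have "of_nat k * of_nat (k - 1) * p0 ^ (k - 2) * (q ^ i * g) * Y + 4 * of_nat k * P * (of_nat i * R * g + q ^ i * g1) +
      4 * P * (of_nat i * (of_nat i - 1) * R * g + 2 * (of_nat i * q ^ i) * g1 + q ^ i * g2 * q) + 2 * P * (of_nat i * R * g + q ^ i * g1) * N =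
      of_nat k * of_nat (k - 1) * p0 ^ (k - 2) * (q ^ i * g) * Y + P * R * g * (4 * of_nat i * (of_real \<nu> + of_nat m - of_nat i)) +
      P * q ^ i * (4 * q * g2 + (4 * of_nat m + 2 * N) * g1)"
      unfolding km Nn by (simp add: algebra_simps)
    hence "C i * Y ^ i * (of_nat k * of_nat (k - 1) * p0 ^ (k - 2) * (q ^ i * g) * Y + 4 * of_nat k * P * (of_nat i * R * g + q ^ i * g1) +
      4 * P * (of_nat i * (of_nat i - 1) * R * g + 2 * (of_nat i * q ^ i) * g1 + q ^ i * g2 * q) + 2 * P * (of_nat i * R * g + q ^ i * g1) * N) =
      C i * Y ^ i * (of_nat k * of_nat (k - 1) * p0 ^ (k - 2) * (q ^ i * g) * Y + P * R * g * (4 * of_nat i * (of_real \<nu> + of_nat m - of_nat i)) +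
      P * q ^ i * (4 * q * g2 + (4 * of_nat m + 2 * N) * g1))" by (simp only:)
    also have "\<dots> = A i + B i + D i"
      unfolding A_def B_def D_def k_def[symmetric] P_def R_def power_mult_distrib power_Suc by (simp only: distrib_left mult_ac)
    finally show "of_real (gegen_coeff \<nu> m i) * Y ^ i *
     (of_nat (m - 2 * i) * of_nat (m - 2 * i - 1) * p0 ^ (m - 2 * i - 2) * (q ^ i * g) * Y +
      4 * of_nat (m - 2 * i) * p0 ^ (m - 2 * i - 1) * (of_nat i * q ^ (i - 1) * g + q ^ i * g1) * p0 +
      4 * p0 ^ (m - 2 * i) * (of_nat i * of_nat (i - 1) * q ^ (i - 2) * g + 2 * of_nat i * q ^ (i - 1) * g1 + q ^ i * g2) * q +
      2 * p0 ^ (m - 2 * i) * (of_nat i * q ^ (i - 1) * g + q ^ i * g1) * N) = A i + B i + D i"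
      unfolding k_def[symmetric] Ci P_def[symmetric] R_def[symmetric] a b .
  qed
  also have "\<dots> = (\<Sum>i\<le>m div 2. A i + B i) + (\<Sum>i\<le>m div 2. D i)" by (rule sum.distrib)
  also have "(\<Sum>i\<le>m div 2. A i + B i) = 0"
  proof -
    \<comment> \<open>The two ends of the telescoping sum vanish: B 0 contains the factor i = 0, and
      A (m div 2) contains k (k - 1) with k equal to 0 or 1.\<close>
    have tel: "(\<Sum>i\<le>M. A i + B i) = B 0 + (\<Sum>i<M. A i + B (Suc i)) + A M" for M
      by (induction M) (auto simp: algebra_simps)
    have "B 0 = 0" by (simp add: B_def)
    moreover have "A (m div 2) = 0"
    proof -
      have "m - 2 * (m div 2) = 0 \<or> m - 2 * (m div 2) = 1" by linarith
      thus ?thesis by (auto simp: A_def)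
    qed
    moreover have "A i + B (Suc i) = 0" if "i < m div 2" for i
    proof -
      have i2: "2 * i + 2 \<le> m" using that by auto
      have e: "m - 2 * Suc i = m - 2 * i - 2" by simp
      have "A i + B (Suc i) = (C i * (of_nat (m - 2 * i) * of_nat (m - 2 * i - 1)) + C (Suc i) * (4 * of_nat (Suc i) * (of_real \<nu> + of_nat m - of_nat (Suc i)))) *
        (p0 ^ (m - 2 * i - 2) * Y ^ Suc i * q ^ i * g)"
      proof -
        have "A i = C i * (of_nat (m - 2 * i) * of_nat (m - 2 * i - 1)) * (p0 ^ (m - 2 * i - 2) * Y ^ Suc i * q ^ i * g)"
          unfolding A_def by (simp only: mult_ac)
        moreover have "B (Suc i) = C (Suc i) * (4 * of_nat (Suc i) * (of_real \<nu> + of_nat m - of_nat (Suc i))) * (p0 ^ (m - 2 * i - 2) * Y ^ Suc i * q ^ i * g)"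
          unfolding B_def e diff_Suc_1 by (simp only: mult_ac)
        ultimately show ?thesis by (simp only: distrib_right)
      qed
      also have "C i * (of_nat (m - 2 * i) * of_nat (m - 2 * i - 1)) + C (Suc i) * (4 * of_nat (Suc i) * (of_real \<nu> + of_nat m - of_nat (Suc i))) =
         of_real (gegen_coeff \<nu> m i * (real (m - 2 * i) * real (m - 2 * i - 1)) +
           gegen_coeff \<nu> m (Suc i) * (4 * real (Suc i) * (\<nu> + real m - real i - 1)))"
        by (simp add: C_def algebra_simps)
      also have "\<dots> = 0" by (simp only: gegen_coeff_rec[OF i2] of_real_0)
      finally show ?thesis by simp
    qed
    ultimately show ?thesis by (simp add: tel)
  qed
  also have "0 + (\<Sum>i\<le>m div 2. D i) = solid_gegen \<nu> m p0 (q * Y) * (4 * q * g2 + (4 * of_nat m + 2 * N) * g1)"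
    by (simp add: solid_gegen_def D_def C_def sum_distrib_right)
  finally show ?thesis .
qed

text \<open>Homogeneity extracts (\<tau> powr (- 2 / a))^m from the zonal polynomial. All powers are
  exponentials of multiples of the same Ln \<tau>, so they merge into one principal power for
  complex \<tau> too. In this form the zonal factor is free of \<tau>.\<close>

lemma heat_mode_eq_profile:
  assumes \<tau>: "\<tau> \<noteq> 0"
  shows "heat_mode a \<nu> m \<tau> p q Q \<rho> = solid_gegen \<nu> m p q *
    heat_profile (2 / a * (real m + \<nu>)) (\<tau> powr of_real (- (2 / a * (real m + \<nu>) + 1))) \<tau> \<rho> Q"
proof -
  have "\<tau> powr of_real (- (2 / a * \<nu> + 1)) * (\<tau> powr of_real (- (2 / a))) ^ m =
    exp (of_real (- (2 / a * \<nu> + 1)) * Ln \<tau> + of_nat m * (of_real (- (2 / a)) * Ln \<tau>))"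
    using \<tau> by (simp only: powr_def if_False exp_of_nat_mult exp_add)
  also have "of_real (- (2 / a * \<nu> + 1)) * Ln \<tau> + of_nat m * (of_real (- (2 / a)) * Ln \<tau>) =
    of_real (- (2 / a * (real m + \<nu>) + 1)) * Ln \<tau>"
    by (simp add: algebra_simps add_divide_distrib)
  also have "exp \<dots> = \<tau> powr of_real (- (2 / a * (real m + \<nu>) + 1))"
    using \<tau> by (simp only: powr_def if_False)
  finally have c: "\<tau> powr of_real (- (2 / a * (real m + \<nu>) + 1)) =
    \<tau> powr of_real (- (2 / a * \<nu> + 1)) * (\<tau> powr of_real (- (2 / a))) ^ m" ..
  show ?thesis unfolding heat_mode_def heat_profile_def solid_gegen_scale c by (simp only: mult_ac)
qed

lemma DERIV_heat_mode_time:
  assumes \<mu>: "2 / a * (real m + \<nu>) > -1" and \<tau>: "\<tau> \<notin> \<real>\<^sub>\<le>\<^sub>0"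
  defines "\<mu> \<equiv> 2 / a * (real m + \<nu>)"
  shows "((\<lambda>\<tau>. heat_mode a \<nu> m \<tau> p q Q \<rho>) has_field_derivative solid_gegen \<nu> m p q *
    (Q * heat_profile2 \<mu> (\<tau> powr of_real (- (\<mu> + 1))) \<tau> \<rho> Q + of_real (\<mu> + 1) * heat_profile1 \<mu> (\<tau> powr of_real (- (\<mu> + 1))) \<tau> \<rho> Q)) (at \<tau>)"
proof -
  have \<tau>0: "\<tau> \<noteq> 0" using \<tau> by auto
  have "((\<lambda>\<tau>. \<tau> powr of_real (- (\<mu> + 1))) has_field_derivative of_real (- (\<mu> + 1)) * \<tau> powr (of_real (- (\<mu> + 1)) - 1)) (at \<tau>)"
    by (rule has_field_derivative_powr[OF \<tau>])
  also have "of_real (- (\<mu> + 1)) * \<tau> powr (of_real (- (\<mu> + 1)) - 1) = - of_real (\<mu> + 1) / \<tau> * \<tau> powr of_real (- (\<mu> + 1))"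
  proof -
    have pd: "\<tau> powr (w - 1) = \<tau> powr w / \<tau>" for w using \<tau>0 by (simp add: powr_diff)
    show ?thesis unfolding pd of_real_minus by (simp only: times_divide_eq_right times_divide_eq_left)
  qed
  finally have c: "((\<lambda>\<tau>. \<tau> powr of_real (- (\<mu> + 1))) has_field_derivative - of_real (\<mu> + 1) / \<tau> * \<tau> powr of_real (- (\<mu> + 1))) (at \<tau>)" .
  have "((\<lambda>\<tau>. solid_gegen \<nu> m p q * heat_profile \<mu> (\<tau> powr of_real (- (\<mu> + 1))) \<tau> \<rho> Q) has_field_derivative solid_gegen \<nu> m p q *
    (Q * heat_profile2 \<mu> (\<tau> powr of_real (- (\<mu> + 1))) \<tau> \<rho> Q + of_real (\<mu> + 1) * heat_profile1 \<mu> (\<tau> powr of_real (- (\<mu> + 1))) \<tau> \<rho> Q)) (at \<tau>)"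
    by (rule DERIV_cmult[OF heat_profile_equation[OF \<mu>[folded \<mu>_def] \<tau>0 c]])
  thus ?thesis
  proof (rule has_field_derivative_transform_within_open[of _ _ _ "- {0}"])
    show "\<tau> \<in> - {0}" using \<tau>0 by simp
  qed (auto simp: heat_mode_eq_profile \<mu>_def)
qed

text \<open>q continues |x + s e|^2 to complex s, with R = |x|. For |s| < R / 4 the perturbation is
  at most 2 (R / 4) R + (R / 4)^2 = 9/16 R^2, so q stays in the right half-plane, where principal
  powers are holomorphic.\<close>

lemma quadratic_path_bounds:
  fixes s :: complex and R xe :: real
  assumes R: "R > 0" and xe: "\<bar>xe\<bar> \<le> R" and s: "s \<in> ball 0 (R / 4)"
  defines "q \<equiv> complex_of_real (R\<^sup>2) + 2 * s * complex_of_real xe + s ^ 2"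
  shows "Re q > 0" "norm q \<le> (2 * R) ^ 2" "q \<notin> \<real>\<^sub>\<le>\<^sub>0"
proof -
  have s4: "norm s \<le> R / 4" using s by simp
  have "norm (2 * s * complex_of_real xe + s ^ 2) \<le> norm (2 * s * complex_of_real xe) + norm (s ^ 2)"
    by (rule norm_triangle_ineq)
  also have "norm (2 * s * complex_of_real xe) = 2 * norm s * \<bar>xe\<bar>" by (simp add: norm_mult)
  also have "norm (s ^ 2) = (norm s)\<^sup>2" by (simp add: norm_power)
  also have "2 * norm s * \<bar>xe\<bar> + (norm s)\<^sup>2 \<le> 2 * (R / 4) * R + (R / 4)\<^sup>2"
    using s4 xe R by (intro add_mono mult_mono power_mono) auto
  also have "\<dots> = 9 / 16 * R\<^sup>2" by (simp add: power2_eq_square field_simps)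
  finally have b: "norm (2 * s * complex_of_real xe + s ^ 2) \<le> 9 / 16 * R\<^sup>2" .
  have q: "q = complex_of_real (R\<^sup>2) + (2 * s * complex_of_real xe + s ^ 2)" by (simp add: q_def)
  have R2: "R\<^sup>2 > 0" using R by simp
  have "Re q = R\<^sup>2 + Re (2 * s * complex_of_real xe + s ^ 2)" unfolding q by simp
  moreover have "\<bar>Re (2 * s * complex_of_real xe + s ^ 2)\<bar> \<le> 9 / 16 * R\<^sup>2" using b abs_Re_le_cmod order_trans by blast
  ultimately show Re: "Re q > 0" using R2 by linarith
  thus "q \<notin> \<real>\<^sub>\<le>\<^sub>0" by (auto simp: complex_nonpos_Reals_iff)
  have "norm q \<le> norm (complex_of_real (R\<^sup>2)) + norm (2 * s * complex_of_real xe + s ^ 2)" unfolding q by (rule norm_triangle_ineq)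
  also have "\<dots> \<le> R\<^sup>2 + 9 / 16 * R\<^sup>2" using b by (simp add: norm_power)
  also have "\<dots> \<le> (2 * R) ^ 2" using R2 by (simp add: power_mult_distrib)
  finally show "norm q \<le> (2 * R) ^ 2" .
qed

definition heat_mode_path :: "real \<Rightarrow> real \<Rightarrow> nat \<Rightarrow> complex \<Rightarrow> 'a::euclidean_space \<Rightarrow> 'a \<Rightarrow> 'a \<Rightarrow> complex \<Rightarrow> complex" where
  "heat_mode_path a \<nu> m \<tau> x e y s = heat_mode a \<nu> m \<tau> (of_real (x \<bullet> y) + s * of_real (e \<bullet> y))
     ((of_real ((norm x)\<^sup>2) + 2 * s * of_real (x \<bullet> e) + s ^ 2) * of_real ((norm y)\<^sup>2))
     ((of_real ((norm x)\<^sup>2) + 2 * s * of_real (x \<bullet> e) + s ^ 2) powr of_real (a / 2)) (of_real (norm y powr a))"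

text \<open>The mode is a zonal harmonic times G(|x|^2), where G(q) is the profile at q powr (a /
  2), so \<open>solid_gegen_harmonic_sum\<close> applies. The factor |x| powr (2 - a) / a reduces
  the result to a times the operator Q d^2 + (\<mu> + 1) d in Q; the same a arises from \<tau> = a t
  in the time derivative.\<close>

lemma laplacian_heat_mode_path:
  fixes x y :: "'a::euclidean_space" and a :: real and \<tau> :: complex and m :: nat
  assumes a: "a > 0" and x: "x \<noteq> 0" and \<tau>: "\<tau> \<noteq> 0"
  defines "\<nu> \<equiv> (real DIM('a) - 2) / 2"
  defines "\<mu> \<equiv> 2 / a * (real m + \<nu>)"
  assumes \<mu>: "\<mu> > -1"
  defines "c \<equiv> \<tau> powr of_real (- (\<mu> + 1))" and "Q \<equiv> complex_of_real (norm x powr a)" and "\<rho> \<equiv> complex_of_real (norm y powr a)"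
  shows "of_real (1 / a * norm x powr (2 - a)) * (\<Sum>e\<in>Basis. (deriv ^^ 2) (heat_mode_path a \<nu> m \<tau> x e y) 0) =
    of_real a * (solid_gegen \<nu> m (of_real (x \<bullet> y)) (of_real ((norm x)\<^sup>2 * (norm y)\<^sup>2)) *
      (Q * heat_profile2 \<mu> c \<tau> \<rho> Q + of_real (\<mu> + 1) * heat_profile1 \<mu> c \<tau> \<rho> Q))"
proof -
  define R where "R = norm x"
  have R: "R > 0" using x by (simp add: R_def)
  define q0 Y p0 where "q0 = complex_of_real (R\<^sup>2)" and "Y = complex_of_real ((norm y)\<^sup>2)" and "p0 = complex_of_real (x \<bullet> y)"
  define G where "G = (\<lambda>q. heat_profile \<mu> c \<tau> \<rho> (q powr of_real (a / 2)))"
  define G1 where "G1 = (\<lambda>q. heat_profile1 \<mu> c \<tau> \<rho> (q powr of_real (a / 2)) * (of_real (a / 2) * q powr (of_real (a / 2) - 1)))"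
  define G2 where "G2 = (\<lambda>q. heat_profile2 \<mu> c \<tau> \<rho> (q powr of_real (a / 2)) * (of_real (a / 2) * q powr (of_real (a / 2) - 1)) ^ 2 +
    heat_profile1 \<mu> c \<tau> \<rho> (q powr of_real (a / 2)) * (of_real (a / 2) * ((of_real (a / 2) - 1) * q powr (of_real (a / 2) - 1 - 1))))"
  have G: "(G has_field_derivative G1 q) (at q)" and G1: "(G1 has_field_derivative G2 q) (at q)" if q: "q \<notin> \<real>\<^sub>\<le>\<^sub>0" for q
  proof -
    note pw = has_field_derivative_powr[OF q]
    show "(G has_field_derivative G1 q) (at q)"
      unfolding G_def G1_def by (rule DERIV_chain2[OF DERIV_heat_profile[OF \<mu> \<tau>] pw])
    show "(G1 has_field_derivative G2 q) (at q)"
      unfolding G1_def G2_def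
      by (rule DERIV_cong[OF DERIV_mult[OF DERIV_chain2[OF DERIV_heat_profile1[OF \<mu> \<tau>] pw] DERIV_cmult[OF pw]]])
         (simp add: power2_eq_square mult_ac)
  qed
  define h where "h = (\<lambda>i q. q ^ i * G q)"
  define h1 where "h1 = (\<lambda>i q. of_nat i * q ^ (i - 1) * G q + q ^ i * G1 q)"
  define h2 where "h2 = (\<lambda>i q. of_nat i * of_nat (i - 1) * q ^ (i - 2) * G q + 2 * of_nat i * q ^ (i - 1) * G1 q + q ^ i * G2 q)"
  have h: "(h i has_field_derivative h1 i q) (at q)" and h1: "(h1 i has_field_derivative h2 i q) (at q)" if q: "q \<notin> \<real>\<^sub>\<le>\<^sub>0" for i q
  proof -
    have p: "((\<lambda>q. q ^ i) has_field_derivative of_nat i * q ^ (i - 1)) (at q)" for i and q :: complex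
      by (auto intro!: derivative_eq_intros)
    show "(h i has_field_derivative h1 i q) (at q)" unfolding h_def h1_def
      by (rule DERIV_cong[OF DERIV_mult[OF p G[OF q]]]) (simp add: mult_ac)
    show "(h1 i has_field_derivative h2 i q) (at q)" unfolding h1_def h2_def
      by (rule DERIV_cong[OF DERIV_add[OF DERIV_mult[OF DERIV_cmult[OF p] G[OF q]] DERIV_mult[OF p G1[OF q]]]])
         (simp add: algebra_simps numeral_2_eq_2)
  qed
  define C where "C = (\<lambda>i. complex_of_real (gegen_coeff \<nu> m i) * Y ^ i)"
  define k where "k = (\<lambda>i. m - 2 * i)"
  have d2: "(deriv ^^ 2) (heat_mode_path a \<nu> m \<tau> x e y) 0 = (\<Sum>i\<le>m div 2. C i *
      (of_nat (k i) * of_nat (k i - 1) * p0 ^ (k i - 2) * h i q0 * of_real (e \<bullet> y) ^ 2 +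
       4 * of_nat (k i) * p0 ^ (k i - 1) * h1 i q0 * (of_real (e \<bullet> y) * of_real (x \<bullet> e)) +
       4 * p0 ^ k i * h2 i q0 * of_real (x \<bullet> e) ^ 2 + 2 * p0 ^ k i * h1 i q0))"
    if e: "e \<in> Basis" for e
  proof -
    define pe xe where "pe = complex_of_real (e \<bullet> y)" and "xe = complex_of_real (x \<bullet> e)"
    have xeR: "\<bar>x \<bullet> e\<bar> \<le> R" unfolding R_def by (rule Basis_le_norm[OF e])
    have path: "heat_mode_path a \<nu> m \<tau> x e y = (\<lambda>s. \<Sum>i\<le>m div 2. C i * ((p0 + s * pe) ^ k i * h i (q0 + 2 * s * xe + s ^ 2)))"
    proof
      fix s
      show "heat_mode_path a \<nu> m \<tau> x e y s = (\<Sum>i\<le>m div 2. C i * ((p0 + s * pe) ^ k i * h i (q0 + 2 * s * xe + s ^ 2)))"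
        unfolding heat_mode_path_def heat_mode_eq_profile[OF \<tau>] R_def[symmetric] q0_def[symmetric] Y_def[symmetric] p0_def[symmetric]
          pe_def[symmetric] xe_def[symmetric] \<rho>_def[symmetric] \<mu>_def[symmetric] c_def[symmetric] solid_gegen_def sum_distrib_right
        by (intro sum.cong refl) (simp add: C_def k_def h_def G_def power_mult_distrib mult_ac)
    qed
    have "(deriv ^^ 2) (heat_mode_path a \<nu> m \<tau> x e y) 0 = (\<Sum>i\<le>m div 2. C i *
      (of_nat (k i) * of_nat (k i - 1) * p0 ^ (k i - 2) * h i q0 * pe ^ 2 +
       4 * of_nat (k i) * p0 ^ (k i - 1) * h1 i q0 * (pe * xe) +
       4 * p0 ^ k i * h2 i q0 * xe ^ 2 + 2 * p0 ^ k i * h1 i q0))"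
      unfolding path
    proof (rule deriv2_eqI)
      show "R / 4 > 0" using R by simp
      show "((\<lambda>s. \<Sum>i\<le>m div 2. C i * ((p0 + s * pe) ^ k i * h i (q0 + 2 * s * xe + s ^ 2))) has_field_derivative
        (\<Sum>i\<le>m div 2. C i * (of_nat (k i) * (p0 + s * pe) ^ (k i - 1) * pe * h i (q0 + 2 * s * xe + s ^ 2) +
          (p0 + s * pe) ^ k i * (h1 i (q0 + 2 * s * xe + s ^ 2) * (2 * xe + 2 * s))))) (at s)" if s: "s \<in> ball 0 (R / 4)" for s
      proof -
        have "q0 + 2 * s * xe + s ^ 2 \<notin> \<real>\<^sub>\<le>\<^sub>0"
          using quadratic_path_bounds(3)[OF R xeR s] unfolding q0_def xe_def .
        thus ?thesis by (intro DERIV_sum DERIV_cmult DERIV_power_comp_quadratic h)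
      qed
      have "q0 \<notin> \<real>\<^sub>\<le>\<^sub>0" using R unfolding q0_def by (simp only: nonpos_Reals_of_real_iff) simp
      thus "((\<lambda>s. \<Sum>i\<le>m div 2. C i * (of_nat (k i) * (p0 + s * pe) ^ (k i - 1) * pe * h i (q0 + 2 * s * xe + s ^ 2) +
          (p0 + s * pe) ^ k i * (h1 i (q0 + 2 * s * xe + s ^ 2) * (2 * xe + 2 * s)))) has_field_derivative
        (\<Sum>i\<le>m div 2. C i *
      (of_nat (k i) * of_nat (k i - 1) * p0 ^ (k i - 2) * h i q0 * pe ^ 2 +
       4 * of_nat (k i) * p0 ^ (k i - 1) * h1 i q0 * (pe * xe) +
       4 * p0 ^ k i * h2 i q0 * xe ^ 2 + 2 * p0 ^ k i * h1 i q0))) (at 0)"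
        by (intro DERIV_sum DERIV_cmult DERIV2_power_comp_quadratic h h1)
    qed
    thus ?thesis unfolding pe_def xe_def .
  qed
  have s1: "(\<Sum>e\<in>Basis. complex_of_real (e \<bullet> y) ^ 2) = Y"
    unfolding Y_def power2_norm_eq_inner euclidean_inner[of y y]
    by (simp add: inner_commute power2_eq_square)
  have s2: "(\<Sum>e\<in>Basis. complex_of_real (e \<bullet> y) * complex_of_real (x \<bullet> e)) = p0"
    unfolding p0_def euclidean_inner[of x y] by (simp add: inner_commute mult.commute)
  have s3: "(\<Sum>e\<in>Basis. complex_of_real (x \<bullet> e) ^ 2) = q0"
    unfolding q0_def R_def power2_norm_eq_inner euclidean_inner[of x x]
    by (simp add: power2_eq_square)
  have N: "of_nat DIM('a) = complex_of_real (2 * \<nu> + 2)" unfolding \<nu>_def by (simp add: field_simps)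
  have lin: "(\<Sum>e\<in>Basis. \<kappa> * (\<alpha> * U e + \<beta> * V e + \<gamma> * W e + \<delta>)) =
      \<kappa> * (\<alpha> * (\<Sum>e\<in>Basis. U e) + \<beta> * (\<Sum>e\<in>Basis. V e) + \<gamma> * (\<Sum>e\<in>Basis. W e) + \<delta> * complex_of_real (2 * \<nu> + 2))"
    for \<kappa> \<alpha> \<beta> \<gamma> \<delta> :: complex and U V W :: "'a \<Rightarrow> complex"
    unfolding sum_distrib_left[symmetric] sum.distrib sum_constant N by (simp only: mult.commute)
  have "(\<Sum>e\<in>Basis. (deriv ^^ 2) (heat_mode_path a \<nu> m \<tau> x e y) 0) =
    (\<Sum>i\<le>m div 2. \<Sum>e\<in>Basis. C i *
      (of_nat (k i) * of_nat (k i - 1) * p0 ^ (k i - 2) * h i q0 * of_real (e \<bullet> y) ^ 2 +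
       4 * of_nat (k i) * p0 ^ (k i - 1) * h1 i q0 * (of_real (e \<bullet> y) * of_real (x \<bullet> e)) +
       4 * p0 ^ k i * h2 i q0 * of_real (x \<bullet> e) ^ 2 + 2 * p0 ^ k i * h1 i q0))"
    by (subst sum.swap) (intro sum.cong refl d2)
  also have "\<dots> = (\<Sum>i\<le>m div 2. C i *
      (of_nat (k i) * of_nat (k i - 1) * p0 ^ (k i - 2) * h i q0 * Y +
       4 * of_nat (k i) * p0 ^ (k i - 1) * h1 i q0 * p0 +
       4 * p0 ^ k i * h2 i q0 * q0 + 2 * p0 ^ k i * h1 i q0 * complex_of_real (2 * \<nu> + 2)))"
    by (intro sum.cong refl) (simp only: lin s1 s2 s3)
  also have "\<dots> = solid_gegen \<nu> m p0 (q0 * Y) * (4 * q0 * G2 q0 + (4 * of_nat m + 2 * of_real (2 * \<nu> + 2)) * G1 q0)"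
    unfolding C_def k_def h_def h1_def h2_def
    by (rule solid_gegen_harmonic_sum)
  finally have lap: "(\<Sum>e\<in>Basis. (deriv ^^ 2) (heat_mode_path a \<nu> m \<tau> x e y) 0) = \<dots>" .
  define w where "w = complex_of_real (R powr (a - 2))"
  have q0pw: "q0 powr of_real r = of_real (R powr (2 * r))" for r
  proof -
    have "q0 powr of_real r = of_real ((R\<^sup>2) powr r)" unfolding q0_def using R by (intro powr_of_real) auto
    also have "(R\<^sup>2) powr r = R powr (2 * r)" using R by (simp add: powr_powr flip: powr_numeral)
    finally show ?thesis .
  qed
  have Qq: "q0 powr of_real (a / 2) = Q" unfolding q0pw Q_def R_def by simp
  have wq: "q0 powr (of_real (a / 2) - 1) = w"
    using q0pw[of "a / 2 - 1"] by (simp add: w_def algebra_simps)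
  have q0n: "q0 \<noteq> 0" using R by (simp add: q0_def)
  have Qw: "Q = q0 * w"
    using R powr_add[of R 2 "a - 2"] by (simp add: Q_def w_def q0_def R_def[symmetric] powr_numeral)
  have wq2: "q0 powr (of_real (a / 2) - 1 - 1) = w / q0"
  proof -
    have "q0 powr (v - 1) = q0 powr v / q0" for v using q0n by (simp add: powr_diff)
    thus ?thesis unfolding wq[symmetric] by (simp only:)
  qed
  define P1 P2 where "P1 = heat_profile1 \<mu> c \<tau> \<rho> Q" and "P2 = heat_profile2 \<mu> c \<tau> \<rho> Q"
  define A n' v where "A = complex_of_real a" and "n' = complex_of_nat m" and "v = complex_of_real \<nu>"
  have A0: "A \<noteq> 0" using a by (simp add: A_def)
  have mu1: "A * complex_of_real (\<mu> + 1) = 2 * (n' + v) + A"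
    unfolding \<mu>_def A_def n'_def v_def using a by (simp add: field_simps)
  have G1q: "G1 q0 = P1 * (A / 2 * w)" unfolding G1_def Qq wq P1_def A_def by simp
  have G2q: "G2 q0 = P2 * (A / 2 * w) ^ 2 + P1 * (A / 2 * ((A / 2 - 1) * (w / q0)))"
    unfolding G2_def Qq wq wq2 P1_def P2_def A_def by simp
  \<comment> \<open>The P1 terms are A (A - 2) w from G'' and A (2 m + 2 \<nu> + 2) w from G'.
    Together they are A (2 (m + \<nu>) + A) w, that is A^2 (\<mu> + 1) w.\<close>
  have "4 * q0 * G2 q0 + (4 * of_nat m + 2 * of_real (2 * \<nu> + 2)) * G1 q0 =
    A * w * (A * (q0 * w) * P2 + (2 * (n' + v) + A) * P1)"
    unfolding G1q G2q n'_def[symmetric] using q0n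
    by (simp add: v_def power2_eq_square field_simps)
  also have "\<dots> = A * w * (A * Q * P2 + A * complex_of_real (\<mu> + 1) * P1)" unfolding Qw mu1 ..
  also have "\<dots> = A ^ 2 * w * (Q * P2 + complex_of_real (\<mu> + 1) * P1)" by (simp add: power2_eq_square algebra_simps)
  finally have rad: "4 * q0 * G2 q0 + (4 * of_nat m + 2 * of_real (2 * \<nu> + 2)) * G1 q0 = A ^ 2 * w * (Q * P2 + complex_of_real (\<mu> + 1) * P1)" .
  have "complex_of_real (1 / a * norm x powr (2 - a)) * w = 1 / A"
  proof -
    have "norm x powr (2 - a) * R powr (a - 2) = 1" using R by (simp add: R_def flip: powr_add)
    hence "1 / a * norm x powr (2 - a) * R powr (a - 2) = 1 / a" by simp
    hence "complex_of_real (1 / a * norm x powr (2 - a) * R powr (a - 2)) = complex_of_real (1 / a)" by (simp only:)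
    thus ?thesis by (simp add: w_def A_def)
  qed
  hence kw: "complex_of_real (1 / a * norm x powr (2 - a)) * (A ^ 2 * w) = A"
    using A0 by (simp add: power2_eq_square field_simps)
  have "complex_of_real (1 / a * norm x powr (2 - a)) * (solid_gegen \<nu> m p0 (q0 * Y) * (A ^ 2 * w * (Q * P2 + complex_of_real (\<mu> + 1) * P1))) =
     (complex_of_real (1 / a * norm x powr (2 - a)) * (A ^ 2 * w)) * (solid_gegen \<nu> m p0 (q0 * Y) * (Q * P2 + complex_of_real (\<mu> + 1) * P1))"
    by (simp only: mult_ac)
  also have "\<dots> = A * (solid_gegen \<nu> m p0 (q0 * Y) * (Q * P2 + complex_of_real (\<mu> + 1) * P1))" unfolding kw ..
  finally have "complex_of_real (1 / a * norm x powr (2 - a)) * (solid_gegen \<nu> m p0 (q0 * Y) * (A ^ 2 * w * (Q * P2 + complex_of_real (\<mu> + 1) * P1))) =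
     A * (solid_gegen \<nu> m p0 (q0 * Y) * (Q * P2 + complex_of_real (\<mu> + 1) * P1))" .
  thus ?thesis
    unfolding lap rad P1_def[symmetric] P2_def[symmetric] A_def[symmetric] by (simp add: p0_def q0_def Y_def R_def)
qed

section \<open>The heat flow\<close>

text \<open>The sum over the modes is treated as an integral, so that differentiation under the sum and
  under the integral over \<open>y\<close> are a single step.\<close>

abbreviation mode_measure :: "(nat \<times> 'a::euclidean_space) measure" where
  "mode_measure \<equiv> count_space UNIV \<Otimes>\<^sub>M lborel"

lemma pair_sigma_finite_mode:
  "pair_sigma_finite (count_space (UNIV :: nat set)) (lborel :: 'a::euclidean_space measure)"
  by (simp add: pair_sigma_finite_def sigma_finite_measure_count_space sigma_finite_lborel)

lemma integrable_geometric_mode: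
  fixes G :: "'a::euclidean_space \<Rightarrow> real"
  assumes "integrable lborel G"
  shows "integrable mode_measure (\<lambda>(m, y). (1 / 2) ^ m * G y)"
proof (rule pair_sigma_finite.Fubini_integrable[OF pair_sigma_finite_mode])
  have [measurable]: "G \<in> borel_measurable borel" using assms by (auto simp: integrable_iff_bounded)
  show "(\<lambda>(m, y). (1 / 2) ^ m * G y) \<in> borel_measurable mode_measure"
    by (rule measurable_pair_measure_countable1) auto
  have "(\<lambda>m. LINT y|lborel. norm (case (m, y) of (m, y) \<Rightarrow> (1 / 2) ^ m * G y)) = (\<lambda>m. (1 / 2) ^ m * (LINT y|lborel. \<bar>G y\<bar>))"
    by (simp add: abs_mult)
  moreover have "integrable (count_space UNIV) (\<lambda>m::nat. (1 / 2) ^ m * (LINT y|lborel. \<bar>G y\<bar>))"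
    unfolding integrable_count_space_nat_iff
    by (simp add: abs_mult) (intro summable_mult2 summable_geometric, simp)
  ultimately show "integrable (count_space UNIV) (\<lambda>m. LINT y|lborel. norm (case (m, y) of (m, y) \<Rightarrow> (1 / 2) ^ m * G y))"
    by simp
  show "AE m in count_space UNIV. integrable lborel (\<lambda>y. case (m, y) of (m, y) \<Rightarrow> (1 / 2) ^ m * G y)"
    using assms by (intro AE_I2) simp
qed

lemma integral_suminf_mode:
  fixes f :: "nat \<Rightarrow> 'a::euclidean_space \<Rightarrow> complex"
  assumes f: "\<And>m. f m \<in> borel_measurable lborel" and G: "integrable lborel G"
    and bd: "\<And>m y. norm (f m y) \<le> (1 / 2) ^ m * G y"
  shows "(LINT y|lborel. (\<Sum>m. f m y)) = (LINT z|mode_measure. f (fst z) (snd z))"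
proof -
  have meas: "(\<lambda>(m, y). f m y) \<in> borel_measurable mode_measure"
    using f by (intro measurable_pair_measure_countable1) auto
  have int: "integrable mode_measure (\<lambda>(m, y). f m y)"
    by (rule Bochner_Integration.integrable_bound[OF integrable_geometric_mode[OF G] meas])
       (use bd in \<open>auto intro!: AE_I2 order_trans[OF bd] abs_ge_self\<close>)
  have "(LINT y|lborel. LINT m|count_space UNIV. f m y) = (LINT (m, y)|mode_measure. f m y)"
    by (rule pair_sigma_finite.integral_snd[OF pair_sigma_finite_mode int])
  moreover have "(LINT m|count_space UNIV. f m y) = (\<Sum>m. f m y)" for y
  proof (rule integral_count_space_nat)
    have "summable (\<lambda>m. (1 / 2 :: real) ^ m * G y)" by (intro summable_mult2 summable_geometric) simp
    hence "summable (\<lambda>m. norm (f m y))"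
      by (rule summable_comparison_test'[where N = 0]) (use bd in auto)
    thus "integrable (count_space UNIV) (\<lambda>m. f m y)" by (simp add: integrable_count_space_nat_iff)
  qed
  ultimately show ?thesis by (simp add: case_prod_unfold)
qed

lemma borel_measurable_bessel_series [measurable]:
  "\<mu> > -1 \<Longrightarrow> bessel_series \<mu> \<in> borel_measurable borel"
  by (intro borel_measurable_continuous_onI continuous_on_bessel_series)

lemma borel_measurable_heat_mode:
  fixes p q Q \<rho> :: "'b \<Rightarrow> complex"
  assumes [measurable]: "p \<in> borel_measurable M" "q \<in> borel_measurable M" "Q \<in> borel_measurable M" "\<rho> \<in> borel_measurable M"
    and \<mu>: "2 / a * (real m + \<nu>) > -1"
  shows "(\<lambda>y. heat_mode a \<nu> m \<tau> (p y) (q y) (Q y) (\<rho> y)) \<in> borel_measurable M"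
proof -
  note [measurable] = borel_measurable_bessel_series[OF \<mu>]
  show ?thesis unfolding heat_mode_def solid_gegen_def by measurable
qed

section \<open>Majorants for the modes times the weighted initial function\<close>

definition growth_bound :: "real \<Rightarrow> nat \<Rightarrow> real \<Rightarrow> real \<Rightarrow> 'a::euclidean_space \<Rightarrow> real" where
  "growth_bound a k C \<kappa> y = norm y powr (a - 2) * ((1 + norm y) ^ k * exp (C * norm y powr (a / 2)) * exp (- \<kappa> * norm y powr a))"

lemma integrable_growth_bound:
  assumes "a > 0" "a > 2 - real DIM('a::euclidean_space)" "\<kappa> > 0"
  shows "integrable lborel (growth_bound a k C \<kappa> :: 'a \<Rightarrow> real)"
  unfolding growth_bound_def using assms by (intro integrable_norm_powr_growth) auto

lemma norm_mult_weight_le: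
  fixes u :: "'a::euclidean_space \<Rightarrow> complex"
  assumes u: "\<And>y. norm (u y) \<le> C0 * (1 + norm y) ^ k"
    and h: "norm h \<le> K * ((1 / 2) ^ m * exp (C * norm y powr (a / 2)) * exp (- \<kappa> * norm y powr a))" and K: "K \<ge> 0"
  shows "norm (h * (u y / of_real (norm y powr (2 - a)))) \<le> (1 / 2) ^ m * (K * C0 * growth_bound a k C \<kappa> y)"
proof -
  have "norm (h * (u y / of_real (norm y powr (2 - a)))) = norm h * (norm (u y) * norm y powr (a - 2))"
    using powr_minus_divide[of "norm y" "2 - a"] by (simp add: norm_mult norm_divide)
  also have "\<dots> \<le> K * ((1 / 2) ^ m * exp (C * norm y powr (a / 2)) * exp (- \<kappa> * norm y powr a)) * (C0 * (1 + norm y) ^ k * norm y powr (a - 2))"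
    using K by (intro mult_mono h mult_right_mono u) auto
  also have "\<dots> = (1 / 2) ^ m * (K * C0 * growth_bound a k C \<kappa> y)"
    by (simp add: growth_bound_def mult_ac)
  finally show ?thesis .
qed

text \<open>The real part of |y| powr a / \<tau> is |y| powr a Re (1 / \<tau>), so a lower bound for
  Re (1 / \<tau>) yields the decay, while |\<tau>| \<ge> T1 controls everything else. Both
  conditions persist on a small disc around a positive time.\<close>

lemma heat_mode_growth:
  fixes x y :: "'a::euclidean_space" and p q Q \<tau> :: complex and R T1 :: real
  assumes \<nu>: "\<nu> \<ge> -1/2" and a: "a > 0" and b\<nu>: "2 / a * \<nu> > -1" and R: "R \<ge> 0" and T1: "T1 > 0" and \<kappa>: "\<kappa> > 0"
    and \<tau>: "norm \<tau> \<ge> T1" "Re (1 / \<tau>) \<ge> \<kappa>"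
    and p: "norm p \<le> R * norm y" and q: "norm q \<le> (R * norm y) ^ 2" and Q: "norm Q \<le> R powr a"
  shows "norm (heat_mode a \<nu> m \<tau> p q Q (of_real (norm y powr a))) \<le>
    T1 powr (- (2 / a * \<nu> + 1)) * exp (3 + R powr a / T1) *
      ((1 / 2) ^ m * exp (3 * (32 * (\<nu> + 2) * R) powr (a / 2) / T1 * norm y powr (a / 2)) * exp (- \<kappa> * norm y powr a))"
proof -
  define D where "D = (32 * (\<nu> + 2) * R) powr (a / 2)"
  have \<tau>0: "\<tau> \<noteq> 0" using \<tau>(1) T1 by auto
  have "norm (heat_mode a \<nu> m \<tau> p q Q (of_real (norm y powr a))) \<le>
    norm \<tau> powr (- (2 / a * \<nu> + 1)) * ((1 / 2) ^ m * exp (3 + 3 * ((32 * (\<nu> + 2)) powr (a / 2) * (R * norm y) powr (a / 2) / norm \<tau>))) *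
      exp (- Re ((Q + of_real (norm y powr a)) / \<tau>))"
  proof (rule norm_heat_mode_le[OF \<nu> a b\<nu> _ \<tau>0 p q])
    show "norm (Q * of_real (norm y powr a)) \<le> (R * norm y) powr a"
      using Q R by (simp add: norm_mult powr_mult mult_right_mono)
  qed (use R in auto)
  also have "(32 * (\<nu> + 2)) powr (a / 2) * (R * norm y) powr (a / 2) = D * norm y powr (a / 2)"
    using R \<nu> by (simp add: D_def powr_mult)
  also have "norm \<tau> powr (- (2 / a * \<nu> + 1)) * ((1 / 2) ^ m * exp (3 + 3 * (D * norm y powr (a / 2) / norm \<tau>))) * exp (- Re ((Q + of_real (norm y powr a)) / \<tau>)) \<le>
    T1 powr (- (2 / a * \<nu> + 1)) * ((1 / 2) ^ m * exp (3 + 3 * (D * norm y powr (a / 2) / T1))) * exp (R powr a / T1 + - \<kappa> * norm y powr a)"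
  proof (intro mult_mono)
    show "norm \<tau> powr (- (2 / a * \<nu> + 1)) \<le> T1 powr (- (2 / a * \<nu> + 1))"
      using \<tau>(1) T1 b\<nu> by (intro powr_mono2') auto
    have "D * norm y powr (a / 2) / norm \<tau> \<le> D * norm y powr (a / 2) / T1"
      using \<tau>(1) T1 by (intro divide_left_mono mult_nonneg_nonneg) (auto simp: D_def intro!: mult_pos_pos)
    thus "exp (3 + 3 * (D * norm y powr (a / 2) / norm \<tau>)) \<le> exp (3 + 3 * (D * norm y powr (a / 2) / T1))" by simp
    have "- Re (Q / \<tau>) \<le> norm (Q / \<tau>)" using abs_Re_le_cmod[of "Q / \<tau>"] by linarith
    also have "\<dots> \<le> R powr a / T1"
      unfolding norm_divide using Q \<tau>(1) T1 by (intro frac_le) auto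
    finally have 1: "- Re (Q / \<tau>) \<le> R powr a / T1" .
    have "Re (of_real (norm y powr a) / \<tau>) = norm y powr a * Re (1 / \<tau>)"
      by (simp add: Re_divide)
    also have "\<dots> \<ge> norm y powr a * \<kappa>" using \<tau>(2) by (intro mult_left_mono) auto
    finally have "Re (of_real (norm y powr a) / \<tau>) \<ge> \<kappa> * norm y powr a" by (simp add: mult.commute)
    with 1 show "exp (- Re ((Q + of_real (norm y powr a)) / \<tau>)) \<le> exp (R powr a / T1 + - \<kappa> * norm y powr a)"
      by (simp add: add_divide_distrib)
  qed auto
  also have "\<dots> = T1 powr (- (2 / a * \<nu> + 1)) * exp (3 + R powr a / T1) *
      ((1 / 2) ^ m * exp (3 * D / T1 * norm y powr (a / 2)) * exp (- \<kappa> * norm y powr a))"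
  proof -
    have "exp (3 + 3 * (D * norm y powr (a / 2) / T1)) * exp (R powr a / T1 + - \<kappa> * norm y powr a) =
      exp (3 + R powr a / T1) * (exp (3 * D / T1 * norm y powr (a / 2)) * exp (- \<kappa> * norm y powr a))"
      by (simp add: algebra_simps flip: exp_add)
    thus ?thesis by (simp only: mult_ac)
  qed
  finally show ?thesis unfolding D_def .
qed

lemma holomorphic_on_bessel_series_compose:
  assumes "f holomorphic_on A" "\<mu> > -1"
  shows "(\<lambda>s. bessel_series \<mu> (f s)) holomorphic_on A"
proof -
  have "bessel_series \<mu> holomorphic_on UNIV"
    using DERIV_bessel_series[OF assms(2)] by (auto simp: holomorphic_on_open)
  thus ?thesis using holomorphic_on_compose_gen[OF assms(1), of "bessel_series \<mu>" UNIV] by (simp add: o_def)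
qed

lemma holomorphic_on_heat_mode_path:
  fixes x e y :: "'a::euclidean_space"
  assumes x: "x \<noteq> 0" and e: "e \<in> Basis" and \<tau>: "\<tau> \<noteq> 0" and \<mu>: "2 / a * (real m + \<nu>) > -1"
  shows "heat_mode_path a \<nu> m \<tau> x e y holomorphic_on ball 0 (norm x / 4)"
proof -
  have q: "complex_of_real ((norm x)\<^sup>2) + 2 * s * of_real (x \<bullet> e) + s ^ 2 \<notin> \<real>\<^sub>\<le>\<^sub>0" if "s \<in> ball 0 (norm x / 4)" for s
    using quadratic_path_bounds(3)[OF _ Basis_le_norm[OF e] that] x by simp
  have Q: "(\<lambda>s. (complex_of_real ((norm x)\<^sup>2) + 2 * s * of_real (x \<bullet> e) + s ^ 2) powr of_real (a / 2)) holomorphic_on ball 0 (norm x / 4)"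
    by (intro holomorphic_on_powr q holomorphic_intros)
  show ?thesis
    unfolding heat_mode_path_def[abs_def] heat_mode_eq_profile[OF \<tau>] heat_profile_def solid_gegen_def
    by (intro holomorphic_on_bessel_series_compose \<mu> Q holomorphic_intros) (use \<tau> in auto)
qed

context
  fixes a :: real and u :: "'a::euclidean_space \<Rightarrow> complex" and \<nu> C0 :: real and k :: nat
  assumes \<nu>: "\<nu> = (real DIM('a) - 2) / 2" and a: "a > 0" "a > 2 - real DIM('a)"
    and u_meas [measurable]: "u \<in> borel_measurable borel" and u_growth: "\<And>y. norm (u y) \<le> C0 * (1 + norm y) ^ k"
begin

definition weight :: "'a \<Rightarrow> complex" where
  "weight y = u y / of_real (norm y powr (2 - a))"

lemma measurable_weight [measurable]: "weight \<in> borel_measurable borel"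
  unfolding weight_def by measurable

lemmas index_bounds = dim_index(2)[OF \<nu>] dim_bessel_index[OF a \<nu>]

definition flow_integrand :: "real \<Rightarrow> 'a \<Rightarrow> nat \<times> 'a \<Rightarrow> complex" where
  "flow_integrand t x = (\<lambda>(m, y). heat_mode a \<nu> m (of_real (a * t)) (of_real (x \<bullet> y)) (of_real ((norm x)\<^sup>2 * (norm y)\<^sup>2))
     (of_real (norm x powr a)) (of_real (norm y powr a)) * weight y)"

lemma norm_heat_mode_weight_le:
  fixes p q Q \<tau> :: complex and R T1 \<kappa> :: real and y :: 'a
  assumes "R \<ge> 0" "T1 > 0" "\<kappa> > 0" "norm \<tau> \<ge> T1" "Re (1 / \<tau>) \<ge> \<kappa>"
    and "norm p \<le> R * norm y" "norm q \<le> (R * norm y) ^ 2" "norm Q \<le> R powr a"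
  shows "norm (heat_mode a \<nu> m \<tau> p q Q (of_real (norm y powr a)) * weight y) \<le>
    (1 / 2) ^ m * (T1 powr (- (2 / a * \<nu> + 1)) * exp (3 + R powr a / T1) * C0 *
      growth_bound a k (3 * (32 * (\<nu> + 2) * R) powr (a / 2) / T1) \<kappa> y)"
  unfolding weight_def
  by (rule norm_mult_weight_le[OF u_growth heat_mode_growth]) (use a index_bounds assms in auto)

lemma heat_flow_eq:
  assumes x: "x \<noteq> 0" and t: "t > 0"
  shows "heat_flow a t u x = of_real (norm_const TYPE('a) a) * of_real (heat_const TYPE('a) a) *
    (LINT z|mode_measure. flow_integrand t x z)"
proof -
  define h where "h = (\<lambda>m y. heat_mode a \<nu> m (of_real (a * t)) (of_real (x \<bullet> y)) (of_real ((norm x)\<^sup>2 * (norm y)\<^sup>2))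
     (of_real (norm x powr a)) (of_real (norm y powr a)))"
  define G where "G = (\<lambda>y. (a * t) powr (- (2 / a * \<nu> + 1)) * exp (3 + norm x powr a / (a * t)) * C0 *
      growth_bound a k (3 * (32 * (\<nu> + 2) * norm x) powr (a / 2) / (a * t)) (1 / (a * t)) (y :: 'a))"
  have at: "a * t > 0" using a t by simp
  have bd: "norm (h m y * weight y) \<le> (1 / 2) ^ m * G y" for m y
    unfolding h_def G_def
  proof (rule norm_heat_mode_weight_le)
    show "norm (complex_of_real (x \<bullet> y)) \<le> norm x * norm y" using Cauchy_Schwarz_ineq2[of x y] by simp
    show "norm (complex_of_real ((norm x)\<^sup>2 * (norm y)\<^sup>2)) \<le> (norm x * norm y)\<^sup>2"
      unfolding norm_of_real by (simp add: power_mult_distrib)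
    show "a * t \<le> norm (complex_of_real (a * t))" unfolding norm_of_real by simp
    have "1 / complex_of_real (a * t) = of_real (1 / (a * t))" by simp
    thus "1 / (a * t) \<le> Re (1 / complex_of_real (a * t))" by (simp only: Re_complex_of_real)
  qed (use a at in auto)
  have Gint: "integrable lborel G"
    unfolding G_def using a at by (intro integrable_mult_right integrable_growth_bound) auto
  have meas: "(\<lambda>y. h m y * weight y) \<in> borel_measurable lborel" for m
    unfolding h_def by (intro borel_measurable_times borel_measurable_heat_mode index_bounds) measurable
  have pt: "heat_kernel a x y t * u y / of_real (norm y powr (2 - a)) =
     of_real (heat_const TYPE('a) a) * (\<Sum>m. h m y * weight y)" for y
  \<comment> \<open>The series for the kernel requires y to be nonzero. At y = 0 both sides are 0,
    because \<open>0 powr (2 - a) = 0\<close> and division by 0 gives 0.\<close>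
  proof (cases "y = 0")
    case False
    have "summable (\<lambda>m. norm (h m y))"
      unfolding h_def
    proof (rule summable_heat_mode[OF index_bounds(1) a(1) index_bounds(2)])
      show "norm x * norm y \<ge> 0" by simp
      show "norm (complex_of_real (x \<bullet> y)) \<le> norm x * norm y" using Cauchy_Schwarz_ineq2[of x y] by simp
      show "norm (complex_of_real ((norm x)\<^sup>2 * (norm y)\<^sup>2)) \<le> (norm x * norm y)\<^sup>2"
        unfolding norm_of_real by (simp add: power_mult_distrib)
      show "norm (complex_of_real (norm x powr a) * complex_of_real (norm y powr a)) \<le> (norm x * norm y) powr a"
        by (simp add: norm_mult powr_mult)
    qed (use a t in auto)
    hence s: "summable (\<lambda>m. h m y)" by (rule summable_norm_cancel)
    have "heat_kernel a x y t * u y / of_real (norm y powr (2 - a)) = of_real (heat_const TYPE('a) a) * (\<Sum>m. h m y) * weight y"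
      unfolding heat_kernel_eq_sum[OF a x False t, folded \<nu>] weight_def h_def by simp
    also have "\<dots> = of_real (heat_const TYPE('a) a) * (\<Sum>m. h m y * weight y)"
      by (simp add: suminf_mult2[OF s] mult.assoc)
    finally show ?thesis .
  qed (simp add: weight_def)
  have "heat_flow a t u x = of_real (norm_const TYPE('a) a) * (of_real (heat_const TYPE('a) a) * (LINT y|lborel. (\<Sum>m. h m y * weight y)))"
    unfolding heat_flow_def pt by simp
  also have "(LINT y|lborel. (\<Sum>m. h m y * weight y)) = (LINT z|mode_measure. h (fst z) (snd z) * weight (snd z))"
    by (rule integral_suminf_mode[OF meas Gint bd])
  finally show ?thesis by (simp add: flow_integrand_def h_def case_prod_unfold mult.assoc)
qed

section \<open>Complexified integrands in space and time, with majorants and holomorphy\<close>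

definition path_integrand :: "real \<Rightarrow> 'a \<Rightarrow> 'a \<Rightarrow> complex \<Rightarrow> nat \<times> 'a \<Rightarrow> complex" where
  "path_integrand t x e s = (\<lambda>(m, y). heat_mode_path a \<nu> m (of_real (a * t)) x e y s * weight y)"

definition time_integrand :: "'a \<Rightarrow> complex \<Rightarrow> nat \<times> 'a \<Rightarrow> complex" where
  "time_integrand x s = (\<lambda>(m, y). heat_mode a \<nu> m (of_real a * s) (of_real (x \<bullet> y)) (of_real ((norm x)\<^sup>2 * (norm y)\<^sup>2))
     (of_real (norm x powr a)) (of_real (norm y powr a)) * weight y)"

lemma time_integrand_of_real: "time_integrand x (of_real t) = flow_integrand t x"
  by (simp add: time_integrand_def flow_integrand_def)

lemma path_integrand_of_real:
  assumes x: "x \<noteq> 0" and e: "e \<in> Basis" and s: "\<bar>s\<bar> < norm x / 4"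
  shows "path_integrand t x e (of_real s) = flow_integrand t (x + s *\<^sub>R e)" "x + s *\<^sub>R e \<noteq> 0"
proof -
  have ne: "norm (x + s *\<^sub>R e) > 0"
  proof -
    have "norm x \<le> norm (x + s *\<^sub>R e) + norm (s *\<^sub>R e)" using norm_triangle_ineq4[of "x + s *\<^sub>R e" "s *\<^sub>R e"] by simp
    moreover have "norm (s *\<^sub>R e) = \<bar>s\<bar>" using e by simp
    moreover have "norm x > 0" using x by simp
    ultimately show ?thesis using s by linarith
  qed
  thus "x + s *\<^sub>R e \<noteq> 0" by auto
  have n2: "(norm x)\<^sup>2 + 2 * s * (x \<bullet> e) + s\<^sup>2 = (norm (x + s *\<^sub>R e))\<^sup>2"
    using e unfolding power2_norm_eq_inner by (simp add: inner_add inner_commute algebra_simps power2_eq_square inner_Basis)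
  have q: "complex_of_real ((norm x)\<^sup>2) + 2 * of_real s * of_real (x \<bullet> e) + (of_real s) ^ 2 = of_real ((norm (x + s *\<^sub>R e))\<^sup>2)"
    unfolding n2[symmetric] by simp
  have pw: "complex_of_real ((norm (x + s *\<^sub>R e))\<^sup>2) powr of_real (a / 2) = of_real (norm (x + s *\<^sub>R e) powr a)"
  proof -
    have "complex_of_real ((norm (x + s *\<^sub>R e))\<^sup>2) powr of_real (a / 2) = of_real (((norm (x + s *\<^sub>R e))\<^sup>2) powr (a / 2))"
      by (intro powr_of_real) auto
    also have "((norm (x + s *\<^sub>R e))\<^sup>2) powr (a / 2) = norm (x + s *\<^sub>R e) powr a"
      using ne by (simp add: powr_powr flip: powr_numeral)
    finally show ?thesis .
  qed
  show "path_integrand t x e (of_real s) = flow_integrand t (x + s *\<^sub>R e)"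
    unfolding path_integrand_def flow_integrand_def heat_mode_path_def q pw
    by (simp add: fun_eq_iff inner_add_left)
qed

lemma path_integrand_dominated:
  assumes x: "x \<noteq> 0" and e: "e \<in> Basis" and t: "t > 0"
  obtains g where "integrable mode_measure g"
    and "\<And>s z. s \<in> ball 0 (norm x / 4) \<Longrightarrow> norm (path_integrand t x e s z) \<le> g z"
proof -
  define R where "R = norm x"
  have R: "R > 0" using x by (simp add: R_def)
  define G where "G = (\<lambda>y. (a * t) powr (- (2 / a * \<nu> + 1)) * exp (3 + (2 * R) powr a / (a * t)) * C0 *
      growth_bound a k (3 * (32 * (\<nu> + 2) * (2 * R)) powr (a / 2) / (a * t)) (1 / (a * t)) (y :: 'a))"
  have at: "a * t > 0" using a t by simp
  have Gint: "integrable lborel G"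
    unfolding G_def using a at by (intro integrable_mult_right integrable_growth_bound) auto
  have bd: "norm (path_integrand t x e s (m, y)) \<le> (1 / 2) ^ m * G y" if s: "s \<in> ball 0 (norm x / 4)" for s m y
    unfolding path_integrand_def prod.case heat_mode_path_def G_def
  proof (rule norm_heat_mode_weight_le)
    note qb = quadratic_path_bounds[OF R Basis_le_norm[OF e, of x, folded R_def] s[folded R_def], folded R_def]
    have "norm (complex_of_real (x \<bullet> y) + s * complex_of_real (e \<bullet> y)) \<le> \<bar>x \<bullet> y\<bar> + norm s * \<bar>e \<bullet> y\<bar>"
      using norm_triangle_ineq[of "complex_of_real (x \<bullet> y)" "s * complex_of_real (e \<bullet> y)"] by (simp add: norm_mult)
    also have "\<dots> \<le> R * norm y + R * norm y"
    proof (intro add_mono mult_mono)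
      show "\<bar>x \<bullet> y\<bar> \<le> R * norm y" unfolding R_def by (rule Cauchy_Schwarz_ineq2)
      have "norm s < norm x / 4" using s by simp
      thus "norm s \<le> R" using norm_ge_zero[of s] unfolding R_def by linarith
      show "\<bar>e \<bullet> y\<bar> \<le> norm y" using Cauchy_Schwarz_ineq2[of e y] e by simp
    qed (use s R in \<open>auto simp: R_def\<close>)
    finally show "norm (complex_of_real (x \<bullet> y) + s * complex_of_real (e \<bullet> y)) \<le> 2 * R * norm y" by simp
    show "norm ((complex_of_real ((norm x)\<^sup>2) + 2 * s * complex_of_real (x \<bullet> e) + s\<^sup>2) * complex_of_real ((norm y)\<^sup>2)) \<le> (2 * R * norm y)\<^sup>2"
      unfolding norm_mult power_mult_distrib[of "2 * R"] R_def[symmetric] using qb(2)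
      by (intro mult_mono) (auto simp: norm_power)
    show "norm ((complex_of_real ((norm x)\<^sup>2) + 2 * s * complex_of_real (x \<bullet> e) + s\<^sup>2) powr complex_of_real (a / 2)) \<le> (2 * R) powr a"
    proof -
      have "norm ((complex_of_real ((norm x)\<^sup>2) + 2 * s * complex_of_real (x \<bullet> e) + s\<^sup>2) powr complex_of_real (a / 2)) =
        norm (complex_of_real (R\<^sup>2) + 2 * s * complex_of_real (x \<bullet> e) + s\<^sup>2) powr (a / 2)"
        by (simp add: norm_powr_real_powr' R_def)
      also have "\<dots> \<le> ((2 * R)\<^sup>2) powr (a / 2)" using qb(2) a by (intro powr_mono2) auto
      also have "\<dots> = (2 * R) powr a" 
      proof -
        have "(2 * R)\<^sup>2 = (2 * R) powr 2" using R by (simp add: powr_numeral)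
        thus ?thesis by (simp only: powr_powr) simp
      qed
      finally show ?thesis .
    qed
    show "a * t \<le> norm (complex_of_real (a * t))" unfolding norm_of_real by simp
    have "1 / complex_of_real (a * t) = of_real (1 / (a * t))" by simp
    thus "1 / (a * t) \<le> Re (1 / complex_of_real (a * t))" by (simp only: Re_complex_of_real)
  qed (use a at R in auto)
  show ?thesis
    by (rule that[OF integrable_geometric_mode[OF Gint]]) (use bd in auto)
qed

lemma time_integrand_dominated:
  assumes x: "x \<noteq> 0" and t: "t > 0"
  obtains g where "integrable mode_measure g"
    and "\<And>s z. s \<in> ball (of_real t) (t / 2) \<Longrightarrow> norm (time_integrand x s z) \<le> g z"
proof -
  define T1 where "T1 = a * t / 2"
  \<comment> \<open>On the disc of radius t / 2 one has Re \<tau> \<ge> T1 and |\<tau>| \<le> 3 T1,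
    hence Re (1 / \<tau>) = Re \<tau> / |\<tau>|^2 is at least this.\<close>
  define \<kappa> where "\<kappa> = T1 / (3 * T1)\<^sup>2"
  have T1: "T1 > 0" using a t by (simp add: T1_def)
  have \<kappa>: "\<kappa> > 0" using T1 by (simp add: \<kappa>_def)
  define G where "G = (\<lambda>y. T1 powr (- (2 / a * \<nu> + 1)) * exp (3 + norm x powr a / T1) * C0 *
      growth_bound a k (3 * (32 * (\<nu> + 2) * norm x) powr (a / 2) / T1) \<kappa> (y :: 'a))"
  have Gint: "integrable lborel G"
    unfolding G_def using a \<kappa> by (intro integrable_mult_right integrable_growth_bound) auto
  have bd: "norm (time_integrand x s (m, y)) \<le> (1 / 2) ^ m * G y" if s: "s \<in> ball (of_real t) (t / 2)" for s m y
    unfolding time_integrand_def prod.case G_def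
  proof (rule norm_heat_mode_weight_le)
    have d: "norm (complex_of_real t - s) < t / 2" using s by (simp add: dist_norm)
    have Re: "Re s \<ge> t / 2"
      using d abs_Re_le_cmod[of "complex_of_real t - s"] by simp
    have ReT: "Re (of_real a * s) \<ge> T1" using Re a by (simp add: T1_def)
    show nT: "T1 \<le> norm (of_real a * s)" using ReT complex_Re_le_cmod order_trans by blast
    have "norm s \<le> norm (complex_of_real t) + norm (complex_of_real t - s)"
      using norm_triangle_ineq4[of "complex_of_real t" "complex_of_real t - s"] by simp
    also have "\<dots> \<le> 3 * (t / 2)" using d t by simp
    finally have nT2: "norm (of_real a * s) \<le> 3 * T1" using a by (simp add: norm_mult T1_def)
    have "Re (1 / (of_real a * s)) = Re (of_real a * s) / (norm (of_real a * s))\<^sup>2"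
      unfolding Re_divide cmod_power2 by simp
    also have "\<dots> \<ge> T1 / (3 * T1)\<^sup>2"
      using ReT nT nT2 T1 by (intro frac_le power_mono) auto
    finally show "\<kappa> \<le> Re (1 / (of_real a * s))" by (simp add: \<kappa>_def)
    show "norm (complex_of_real (x \<bullet> y)) \<le> norm x * norm y" using Cauchy_Schwarz_ineq2[of x y] by simp
    show "norm (complex_of_real ((norm x)\<^sup>2 * (norm y)\<^sup>2)) \<le> (norm x * norm y)\<^sup>2"
      unfolding norm_of_real by (simp add: power_mult_distrib)
  qed (use a T1 \<kappa> in auto)
  show ?thesis
    by (rule that[OF integrable_geometric_mode[OF Gint]]) (use bd in auto)
qed

lemma measurable_path_integrand: "path_integrand t x e s \<in> borel_measurable mode_measure"
  unfolding path_integrand_def heat_mode_path_def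
  by (rule measurable_pair_measure_countable1)
     (simp, simp, intro borel_measurable_times borel_measurable_heat_mode index_bounds, measurable)

lemma measurable_time_integrand: "time_integrand x s \<in> borel_measurable mode_measure"
  unfolding time_integrand_def
  by (rule measurable_pair_measure_countable1)
     (simp, simp, intro borel_measurable_times borel_measurable_heat_mode index_bounds, measurable)

lemma holomorphic_path_integrand:
  assumes x: "x \<noteq> 0" and e: "e \<in> Basis" and t: "t > 0"
  shows "(\<lambda>s. path_integrand t x e s z) holomorphic_on ball 0 (norm x / 4)"
proof -
  have "complex_of_real (a * t) \<noteq> 0" using a t by simp
  thus ?thesis unfolding path_integrand_def case_prod_unfold
    by (intro holomorphic_intros holomorphic_on_heat_mode_path x e index_bounds)
qed

lemma DERIV_time_integrand:
  assumes t: "t > 0" and s: "s \<in> ball (of_real t) (t / 2)"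
  defines "\<mu> \<equiv> \<lambda>m. 2 / a * (real m + \<nu>)"
  shows "((\<lambda>s. time_integrand x s (m, y)) has_field_derivative
     of_real a * (solid_gegen \<nu> m (of_real (x \<bullet> y)) (of_real ((norm x)\<^sup>2 * (norm y)\<^sup>2)) *
      (of_real (norm x powr a) * heat_profile2 (\<mu> m) ((of_real a * s) powr of_real (- (\<mu> m + 1))) (of_real a * s) (of_real (norm y powr a)) (of_real (norm x powr a)) +
       of_real (\<mu> m + 1) * heat_profile1 (\<mu> m) ((of_real a * s) powr of_real (- (\<mu> m + 1))) (of_real a * s) (of_real (norm y powr a)) (of_real (norm x powr a)))) * weight y) (at s)"
proof -
  have "norm (complex_of_real t - s) < t / 2" using s by (simp add: dist_norm)
  hence "Re s \<ge> t / 2" using abs_Re_le_cmod[of "complex_of_real t - s"] by simp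
  hence "Re s > 0" using t by linarith
  hence "Re (of_real a * s) > 0" using a by simp
  hence ns: "of_real a * s \<notin> \<real>\<^sub>\<le>\<^sub>0" by (auto simp: complex_nonpos_Reals_iff)
  have 1: "((\<lambda>s. of_real a * s) has_field_derivative of_real a) (at s)"
    by (auto intro!: derivative_eq_intros)
  show ?thesis unfolding time_integrand_def prod.case \<mu>_def
    by (rule DERIV_cong[OF DERIV_cmult_right[OF DERIV_chain2[OF DERIV_heat_mode_time[OF index_bounds(3) ns] 1]]])
       (simp only: mult_ac)
qed

lemma deriv2_path_integrand:
  assumes x: "x \<noteq> 0" and e: "e \<in> Basis" and t: "t > 0"
  shows "(deriv ^^ 2) (\<lambda>s. path_integrand t x e s (m, y)) 0 =
    (deriv ^^ 2) (heat_mode_path a \<nu> m (of_real (a * t)) x e y) 0 * weight y"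
proof -
  have t0: "complex_of_real (a * t) \<noteq> 0" using a t by simp
  have "(deriv ^^ 2) (\<lambda>s. weight y * heat_mode_path a \<nu> m (of_real (a * t)) x e y s) 0 =
    weight y * (deriv ^^ 2) (heat_mode_path a \<nu> m (of_real (a * t)) x e y) 0"
    by (rule higher_deriv_cmult[OF holomorphic_on_heat_mode_path[OF x e t0 index_bounds(3)]]) (use x in auto)
  thus ?thesis by (simp add: path_integrand_def mult.commute)
qed

text \<open>Both sides reduce to the same multiple of Q d^2 + (\<mu> + 1) d applied to the profile,
  for each single pair (m, y). Integration over \<open>mode_measure\<close> therefore gives the
  equation for the flow.\<close>

lemma integrand_equation:
  assumes x: "x \<noteq> 0" and t: "t > 0"
  shows "deriv (\<lambda>s. time_integrand x s z) (of_real t) =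
    of_real (1 / a * norm x powr (2 - a)) * (\<Sum>e\<in>Basis. (deriv ^^ 2) (\<lambda>s. path_integrand t x e s z) 0)"
proof -
  obtain m y where z: "z = (m, y)" by (cases z)
  have "complex_of_real (a * t) \<noteq> 0" using a t by simp
  note lap = laplacian_heat_mode_path[OF a(1) x this index_bounds(3)[unfolded \<nu>], where y = y and m = m, folded \<nu>]
  have tb: "complex_of_real t \<in> ball (of_real t) (t / 2)" using t by simp
  have "(\<Sum>e\<in>Basis. (deriv ^^ 2) (\<lambda>s. path_integrand t x e s z) 0) =
    (\<Sum>e\<in>Basis. (deriv ^^ 2) (heat_mode_path a \<nu> m (of_real (a * t)) x e y) 0) * weight y"
    unfolding z sum_distrib_right by (intro sum.cong refl deriv2_path_integrand x t)
  hence "of_real (1 / a * norm x powr (2 - a)) * (\<Sum>e\<in>Basis. (deriv ^^ 2) (\<lambda>s. path_integrand t x e s z) 0) =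
    (of_real (1 / a * norm x powr (2 - a)) * (\<Sum>e\<in>Basis. (deriv ^^ 2) (heat_mode_path a \<nu> m (of_real (a * t)) x e y) 0)) * weight y"
    by (simp only: mult.assoc)
  note eq = this[unfolded lap]
  show ?thesis
    unfolding z DERIV_imp_deriv[OF DERIV_time_integrand[OF t tb]] eq[unfolded z of_real_mult[of a t]] ..
qed

section \<open>Differentiation of the heat flow\<close>

definition flow_const :: complex where
  "flow_const = of_real (norm_const TYPE('a) a) * of_real (heat_const TYPE('a) a)"

lemma has_vector_derivative_heat_flow_time:
  assumes x: "x \<noteq> 0" and t: "t > 0"
  shows "((\<lambda>\<tau>. heat_flow a \<tau> u x) has_vector_derivative
     flow_const * (LINT z|mode_measure. deriv (\<lambda>s. time_integrand x s z) (of_real t))) (at t)"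
    and "integrable mode_measure (\<lambda>z. deriv (\<lambda>s. time_integrand x s z) (of_real t))"
proof -
  obtain g where g: "integrable mode_measure g"
    and bd: "\<And>s z. s \<in> ball (of_real t) (t / 2) \<Longrightarrow> norm (time_integrand x s z) \<le> g z"
    using time_integrand_dominated[OF x t] by blast
  have hol: "(\<lambda>s. time_integrand x s z) holomorphic_on ball (of_real t) (t / 2)" for z
  proof (cases z)
    case (Pair m y)
    show ?thesis unfolding Pair holomorphic_on_open[OF open_ball]
      using DERIV_time_integrand[OF t] by blast
  qed
  have "((\<lambda>s. LINT z|mode_measure. time_integrand x s z) has_field_derivative
      (LINT z|mode_measure. deriv (\<lambda>s. time_integrand x s z) (of_real t))) (at (of_real t))"
    by (rule integral_holomorphic_parameter(1)[where f = "time_integrand x", OF hol measurable_time_integrand bd g]) (use t in auto)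
  hence "((\<lambda>s. flow_const * (LINT z|mode_measure. time_integrand x s z)) has_field_derivative
      flow_const * (LINT z|mode_measure. deriv (\<lambda>s. time_integrand x s z) (of_real t))) (at (of_real t))"
    by (rule DERIV_cmult)
  hence "((\<lambda>\<tau>. flow_const * (LINT z|mode_measure. time_integrand x (of_real \<tau>) z)) has_vector_derivative
      flow_const * (LINT z|mode_measure. deriv (\<lambda>s. time_integrand x s z) (of_real t))) (at t)"
    by (rule has_vector_derivative_real_field)
  thus "((\<lambda>\<tau>. heat_flow a \<tau> u x) has_vector_derivative
     flow_const * (LINT z|mode_measure. deriv (\<lambda>s. time_integrand x s z) (of_real t))) (at t)"
    by (rule has_vector_derivative_transform_within_open[where S = "{0<..}"])
       (use t in \<open>auto simp: heat_flow_eq[OF x] time_integrand_of_real flow_const_def\<close>)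
  show "integrable mode_measure (\<lambda>z. deriv (\<lambda>s. time_integrand x s z) (of_real t))"
    by (rule integrable_deriv_parameter[where f = "time_integrand x" and r = "t / 2", OF _ hol measurable_time_integrand bd g]) (use t in auto)
qed

lemma heat_flow_path:
  assumes x: "x \<noteq> 0" and e: "e \<in> Basis" and t: "t > 0"
  defines "\<Phi> \<equiv> \<lambda>s. LINT z|mode_measure. deriv (\<lambda>s. path_integrand t x e s z) s"
  shows "\<And>s. \<bar>s\<bar> < norm x / 4 \<Longrightarrow>
      ((\<lambda>s. heat_flow a t u (x + s *\<^sub>R e)) has_vector_derivative flow_const * \<Phi> (of_real s)) (at s)"
    and "((\<lambda>s. flow_const * \<Phi> (of_real s)) has_vector_derivative
      flow_const * (LINT z|mode_measure. (deriv ^^ 2) (\<lambda>s. path_integrand t x e s z) 0)) (at 0)"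
    and "integrable mode_measure (\<lambda>z. (deriv ^^ 2) (\<lambda>s. path_integrand t x e s z) 0)"
proof -
  define r where "r = norm x / 4"
  have r: "r > 0" using x by (simp add: r_def)
  obtain g where g: "integrable mode_measure g"
    and bd: "\<And>s z. s \<in> ball 0 r \<Longrightarrow> norm (path_integrand t x e s z) \<le> g z"
    using path_integrand_dominated[OF x e t] unfolding r_def by blast
  have hol: "(\<lambda>s. path_integrand t x e s z) holomorphic_on ball 0 r" for z
    unfolding r_def by (rule holomorphic_path_integrand[OF x e t])
  show "((\<lambda>s. heat_flow a t u (x + s *\<^sub>R e)) has_vector_derivative flow_const * \<Phi> (of_real s)) (at s)"
    if s: "\<bar>s\<bar> < norm x / 4" for s
  proof -
    have sb: "complex_of_real s \<in> ball 0 r" using s by (simp add: r_def)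
    have "((\<lambda>s. flow_const * (LINT z|mode_measure. path_integrand t x e s z)) has_field_derivative flow_const * \<Phi> (of_real s)) (at (of_real s))"
      unfolding \<Phi>_def
      by (rule DERIV_cmult[OF integral_holomorphic_parameter(1)[where f = "path_integrand t x e", OF hol measurable_path_integrand bd g sb]])
    hence "((\<lambda>s. flow_const * (LINT z|mode_measure. path_integrand t x e (of_real s) z)) has_vector_derivative flow_const * \<Phi> (of_real s)) (at s)"
      by (rule has_vector_derivative_real_field)
    thus ?thesis
    proof (rule has_vector_derivative_transform_within_open[where S = "{- r<..<r}"])
      fix h assume "h \<in> {- r<..<r}"
      hence h: "\<bar>h\<bar> < norm x / 4" by (auto simp: r_def)
      show "flow_const * (LINT z|mode_measure. path_integrand t x e (of_real h) z) = heat_flow a t u (x + h *\<^sub>R e)"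
        unfolding heat_flow_eq[OF path_integrand_of_real(2)[OF x e h] t] path_integrand_of_real(1)[OF x e h] flow_const_def ..
    qed (use s in \<open>auto simp: r_def\<close>)
  qed
  have "(\<Phi> has_field_derivative (LINT z|mode_measure. (deriv ^^ 2) (\<lambda>s. path_integrand t x e s z) 0)) (at (of_real 0))"
    unfolding \<Phi>_def of_real_0
    by (rule integral_holomorphic_parameter_second(1)[where f = "path_integrand t x e", OF r hol measurable_path_integrand bd g])
  hence "((\<lambda>s. flow_const * \<Phi> s) has_field_derivative
      flow_const * (LINT z|mode_measure. (deriv ^^ 2) (\<lambda>s. path_integrand t x e s z) 0)) (at (of_real 0))"
    by (rule DERIV_cmult)
  thus "((\<lambda>s. flow_const * \<Phi> (of_real s)) has_vector_derivative
      flow_const * (LINT z|mode_measure. (deriv ^^ 2) (\<lambda>s. path_integrand t x e s z) 0)) (at 0)"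
    by (rule has_vector_derivative_real_field)
  show "integrable mode_measure (\<lambda>z. (deriv ^^ 2) (\<lambda>s. path_integrand t x e s z) 0)"
    by (rule integral_holomorphic_parameter_second(2)[where f = "path_integrand t x e", OF r hol measurable_path_integrand bd g])
qed

lemma has_vector_derivative_partial_deriv_heat_flow:
  assumes x: "x \<noteq> 0" and e: "e \<in> Basis" and t: "t > 0"
  shows "((\<lambda>s. partial_deriv e (heat_flow a t u) (x + s *\<^sub>R e)) has_vector_derivative
     flow_const * (LINT z|mode_measure. (deriv ^^ 2) (\<lambda>s. path_integrand t x e s z) 0)) (at 0)"
proof (rule has_vector_derivative_transform_within_open[OF heat_flow_path(2)[OF x e t], where S = "{- (norm x / 4)<..<norm x / 4}"])
  fix s assume "s \<in> {- (norm x / 4)<..<norm x / 4}"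
  hence s: "\<bar>s\<bar> < norm x / 4" by auto
  \<comment> \<open>\<open>partial_deriv\<close> at x + s e takes a derivative at parameter 0 along
    the line through x + s e. Shifting the parameter by s identifies it with the derivative at s
    along the line through x.\<close>
  have "((\<lambda>h. heat_flow a t u (x + h *\<^sub>R e)) has_vector_derivative
      flow_const * (LINT z|mode_measure. deriv (\<lambda>s. path_integrand t x e s z) (of_real s))) (at (s + 0))"
    using heat_flow_path(1)[OF x e t s] by simp
  moreover have "((\<lambda>h. s + h) has_vector_derivative 1) (at 0)"
    using has_vector_derivative_add[OF has_vector_derivative_const[of s] has_vector_derivative_id, of "at 0"] by simp
  ultimately have "((\<lambda>h. heat_flow a t u (x + (s + h) *\<^sub>R e)) has_vector_derivative
      flow_const * (LINT z|mode_measure. deriv (\<lambda>s. path_integrand t x e s z) (of_real s))) (at 0)"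
    using vector_diff_chain_at[of "\<lambda>h. s + h" 1 0 "\<lambda>h. heat_flow a t u (x + h *\<^sub>R e)"]
    by (simp add: o_def)
  hence "((\<lambda>h. heat_flow a t u (x + s *\<^sub>R e + h *\<^sub>R e)) has_vector_derivative
      flow_const * (LINT z|mode_measure. deriv (\<lambda>s. path_integrand t x e s z) (of_real s))) (at 0)"
    by (simp add: scaleR_add_left add.assoc)
  thus "flow_const * (LINT z|mode_measure. deriv (\<lambda>s. path_integrand t x e s z) (of_real s)) =
      partial_deriv e (heat_flow a t u) (x + s *\<^sub>R e)"
    unfolding partial_deriv_def by (rule vector_derivative_at[symmetric])
qed (use x in auto)

lemma laplacian_exists_heat_flow:
  assumes x: "x \<noteq> 0" and t: "t > 0"
  shows "laplacian_exists (heat_flow a t u) x"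
  unfolding laplacian_exists_def
proof (intro ballI conjI)
  fix e :: 'a assume e: "e \<in> Basis"
  have "\<forall>\<^sub>F z in nhds x. z \<in> - {0}" using x by (intro eventually_nhds_in_open) auto
  thus "\<forall>\<^sub>F z in nhds x. (\<lambda>s. heat_flow a t u (z + s *\<^sub>R e)) differentiable at 0"
  proof eventually_elim
    case (elim z)
    hence "z \<noteq> 0" by simp
    thus ?case using heat_flow_path(1)[OF _ e t, of z 0] by (auto intro: differentiableI_vector)
  qed
  show "(\<lambda>s. partial_deriv e (heat_flow a t u) (x + s *\<^sub>R e)) differentiable at 0"
    using has_vector_derivative_partial_deriv_heat_flow[OF x e t] by (rule differentiableI_vector)
qed

lemma heat_flow_equation:
  assumes x: "x \<noteq> 0" and t: "t > 0"
  shows "vector_derivative (\<lambda>\<tau>. heat_flow a \<tau> u x) (at t) =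
    of_real (1 / a * norm x powr (2 - a)) * laplacian (heat_flow a t u) x"
proof -
  have pd: "partial_deriv e (partial_deriv e (heat_flow a t u)) x =
     flow_const * (LINT z|mode_measure. (deriv ^^ 2) (\<lambda>s. path_integrand t x e s z) 0)" if e: "e \<in> Basis" for e
    using has_vector_derivative_partial_deriv_heat_flow[OF x e t]
    unfolding partial_deriv_def[of e "partial_deriv e (heat_flow a t u)"] by (rule vector_derivative_at)
  have "laplacian (heat_flow a t u) x = (\<Sum>e\<in>Basis. flow_const * (LINT z|mode_measure. (deriv ^^ 2) (\<lambda>s. path_integrand t x e s z) 0))"
    unfolding laplacian_def by (intro sum.cong refl pd)
  also have "\<dots> = flow_const * (LINT z|mode_measure. (\<Sum>e\<in>Basis. (deriv ^^ 2) (\<lambda>s. path_integrand t x e s z) 0))"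
    unfolding sum_distrib_left[symmetric]
    by (subst Bochner_Integration.integral_sum) (use heat_flow_path(3)[OF x _ t] in auto)
  finally have "of_real (1 / a * norm x powr (2 - a)) * laplacian (heat_flow a t u) x =
    flow_const * (of_real (1 / a * norm x powr (2 - a)) * (LINT z|mode_measure. (\<Sum>e\<in>Basis. (deriv ^^ 2) (\<lambda>s. path_integrand t x e s z) 0)))"
    by (simp only: mult_ac)
  also have "\<dots> = flow_const * (LINT z|mode_measure. deriv (\<lambda>s. time_integrand x s z) (of_real t))"
    unfolding integrand_equation[OF x t] by (simp only: integral_mult_right_zero)
  also have "\<dots> = vector_derivative (\<lambda>\<tau>. heat_flow a \<tau> u x) (at t)"
    using has_vector_derivative_heat_flow_time(1)[OF x t] by (rule vector_derivative_at[symmetric])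
  finally show ?thesis ..
qed

lemma differentiable_heat_flow_time:
  assumes "x \<noteq> 0" "t > 0"
  shows "(\<lambda>\<tau>. heat_flow a \<tau> u x) differentiable (at t)"
  using has_vector_derivative_heat_flow_time(1)[OF assms] by (rule differentiableI_vector)

end

theorem corollary4p16:
  fixes a :: real and u :: "'a::euclidean_space \<Rightarrow> complex"
  assumes "a > max 0 (2 - real DIM('a))"
    and "continuous_on UNIV u"
    and "polynomial_growth u"
  shows "\<forall>t>0. \<forall>x. x \<noteq> 0 \<longrightarrow>
    (\<lambda>\<tau>. heat_flow a \<tau> u x) differentiable (at t) \<and>
    laplacian_exists (heat_flow a t u) x \<and>
    vector_derivative (\<lambda>\<tau>. heat_flow a \<tau> u x) (at t) -
      of_real (1 / a * norm x powr (2 - a)) * laplacian (heat_flow a t u) x = 0"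
proof (intro allI impI)
  fix t :: real and x :: 'a
  assume t: "t > 0" and x: "x \<noteq> 0"
  have a: "a > 0" "a > 2 - real DIM('a)" using assms(1) by auto
  have u: "u \<in> borel_measurable borel" using assms(2) by (rule borel_measurable_continuous_onI)
  obtain C0 k where "\<And>y. norm (u y) \<le> C0 * (1 + norm y) ^ k"
    using assms(3) unfolding polynomial_growth_def by blast
  \<comment> \<open>\<open>refl\<close> discharges the defining equation of \<nu> in the context,
    which sets \<nu> to (N - 2) / 2.\<close>
  note facts = refl a u this
  show "(\<lambda>\<tau>. heat_flow a \<tau> u x) differentiable (at t) \<and>
    laplacian_exists (heat_flow a t u) x \<and>
    vector_derivative (\<lambda>\<tau>. heat_flow a \<tau> u x) (at t) -
      of_real (1 / a * norm x powr (2 - a)) * laplacian (heat_flow a t u) x = 0"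
    using differentiable_heat_flow_time[OF facts x t] laplacian_exists_heat_flow[OF facts x t]
      heat_flow_equation[OF facts x t] by simp
qed

end
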